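(* Let $\underline C=(C_1,\dots,C_d)$ be a row contraction on a Hilbert space $\mathcal H_C$. Then there is a one-to-one correspondence between unitary equivalence classes of minimal contractive liftings $\underline E$ of $\underline C$ and equivalence classes of injective symbols $\Theta:\mathcal D\to\Gamma\otimes\mathcal D_C$ of contractive multi-analytic operators (where $\mathcal D$ ranges over Hilbert spaces). The dimension of $\mathcal D$ is equal to the defect of the corresponding $\underline E$. The correspondence is given explicitly by the two mappings $\mathcal E$ (from contractive multi-analytic operators to contractive liftings) and $\mathcal M$ (in the opposite direction) defined in the context: on these equivalence classes $\mathcal E$ and $\mathcal M$ induce well-defined maps which are inverse to each other.
   Context: Hilbert spaces are complex; $d\ge 1$ is a fixed integer. $P_X$ denotes the orthogonal projection onto $X$. **Multi-analytic operators.** $\Gamma=\bigoplus_{n\ge0}(\mathbb C^d)^{\otimes n}$ is the full Fock space, $e_\emptyset$ its vacuum vector (the unit of $(\mathbb C^d)^{\otimes 0}=\mathbb C$), $L_j$ the left creation operator $L_jx=e_j\otimes x$ ($j=1,\dots,d$). For Hilbert spaces $\mathcal D,\mathcal L$, a bounded operator $M_\Theta:\Gamma\otimes\mathcal D\to\Gamma\otimes\mathcal L$ is multi-analytic if $M_\Theta(L_j\otimes I)=(L_j\otimes I)M_\Theta$ for all $j$; its symbol is $\Theta:\mathcal D\to\Gamma\otimes\mathcal L$, $\Theta(\delta)=M_\Theta(e_\emptyset\otimes\delta)$, which determines $M_\Theta$. It is contractive if $\|M_\Theta\|\le1$. Two symbols $\Theta:\mathcal D\to\Gamma\otimes\mathcal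 L$, $\Theta':\mathcal D'\to\Gamma\otimes\mathcal L$ (same $\mathcal L$) are equivalent if $\Theta'\circ v=\Theta$ for some unitary $v:\mathcal D\to\mathcal D'$. **Row contractions and liftings.** A $d$-tuple $\underline T$ on $\mathcal H_T$ is a row contraction if $\sum_jT_jT_j^*\le I$, and a row isometry if the $T_j$ are isometries with orthogonal ranges. $D_T=(\delta_{ij}I-T_i^*T_j)^{1/2}_{d\times d}$ on $\bigoplus_1^d\mathcal H_T$ is the defect operator, $\mathcal D_T=\overline{\mathrm{range}\,D_T}$ the defect space, and $\dim\mathcal D_T$ the defect of $\underline T$. A lifting of $\underline C$ is a $d$-tuple $\underline E$ on $\mathcal H_E=\mathcal H_C\oplus\mathcal H_A$ of the form $E_j=\begin{pmatrix} C_j & 0 \\ B_j & A_j \end{pmatrix}$; it is contractive if $\underline E$ is a row contraction, and minimal if $\mathcal H_E$ is the smallest closed subspace invariant under all $E_j$ and containing $\mathcal H_C$. Liftings $\underline E,\underline E'$ of $\underline C$ are unitarily equivalent if there is a unitary $u:\mathcal H_E\to\mathcal H_{E'}$ with $uE_j=E_j'u$ for all $j$ and $u|_{\mathcal H_C}=I$. **Minimal isometric dilation.** For a word $\alpha=\alpha_1\cdots\alpha_m$ in $\{1,\dots,d\}$ put $T_\alpha=T_{\alpha_1}\cdots T_{\alpha_m}$, $T_\emptyset=I$. An isometric dilation of $\underline T$ is a row isometry $\underline V$ on a space containing $\mathcal H_T$ with $T_\alpha=P_{\mathcal H_T}V_\alpha|_{\mathcal H_T}$ for all words $\alpha$; it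 is minimal if the space is the smallest closed $\underline V$-invariant subspace containing $\mathcal H_T$. The minimal isometric dilation, unique up to unitary equivalence, is denoted $\underline V^T$. It is realized on $\mathcal H_T\oplus(\Gamma\otimes\mathcal D_T)$ by $V^T_j(h\oplus\eta)=T_jh\oplus\big(e_\emptyset\otimes D_T\iota_jh+(L_j\otimes I)\eta\big)$, with $\iota_j:\mathcal H_T\to\bigoplus_1^d\mathcal H_T$ the $j$-th inclusion. In any isometric dilation $\underline V$, put $\mathcal L_T=\overline{\mathrm{span}}\{\mathcal H_T,V_1\mathcal H_T,\dots,V_d\mathcal H_T\}\ominus\mathcal H_T$; it is a wandering subspace, there is a canonical unitary $\kappa_T:\mathcal D_T\to\mathcal L_T$, $D_T(\bigoplus_i\xi_i)\mapsto\sum_i(V_i-T_i)\xi_i$, and it extends to the canonical unitary $K_T:\Gamma\otimes\mathcal D_T\to\bigoplus_\alpha V_\alpha\mathcal L_T$, $(L_\alpha\otimes I)(e_\emptyset\otimes\delta)\mapsto V_\alpha\kappa_T\delta$. **The map $\mathcal E$.** Given a contractive multi-analytic $M_\Theta:\Gamma\otimes\mathcal D\to\Gamma\otimes\mathcal D_C$, let $\Delta_\Theta=(I-M_\Theta^*M_\Theta)^{1/2}$, $\mathcal H_\Theta=(\Gamma\otimes\mathcal D_C)\oplus\overline{\Delta_\Theta(\Gamma\otimes\mathcal D)}$, and let $\underline V$ be the row isometry on $\mathcal H_\Theta$ given by $V_j(\eta\oplus\Delta_\Theta\xi)=(L_j\otimes I)\eta\oplus\Delta_\Theta(L_j\otimes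 I)\xi$. Let $\mathcal H_{\mathcal D}=\{M_\Theta\xi\oplus\Delta_\Theta\xi:\xi\in\Gamma\otimes\mathcal D\}$ (closed, $\underline V$-invariant), $\mathcal H_A=\mathcal H_\Theta\ominus\mathcal H_{\mathcal D}$, and $\hat{\mathcal H}=\mathcal H_C\oplus\mathcal H_\Theta$. Let $\hat{\underline V}$ be the row isometry on $\hat{\mathcal H}$ which restricts to $\underline V$ on $\mathcal H_\Theta$ and to $\underline V^C$ (in the realization $V^C_j(h\oplus\eta)=C_jh\oplus\big(e_\emptyset\otimes D_C\iota_jh+(L_j\otimes I)\eta\big)$, with $\iota_j:\mathcal H_C\to\bigoplus_1^d\mathcal H_C$ the $j$-th inclusion) on $\mathcal H_C\oplus(\Gamma\otimes\mathcal D_C)$. With $\mathcal H_E=\mathcal H_C\oplus\mathcal H_A$, define $\mathcal E(M_\Theta)=\underline E$ by $E_j=P_{\mathcal H_E}\hat V_j|_{\mathcal H_E}$; it is a contractive lifting of $\underline C$. **The map $\mathcal M$.** Given a contractive lifting $\underline E$ of $\underline C$, $\underline V^E$ is also an isometric dilation of $\underline C$; form $\mathcal L_E$ and $\mathcal L_C$ and the canonical unitaries $K_E,K_C$ with respect to $\underline V^E$. Then $\mathcal M(\underline E)=K_C^*\,P\,K_E:\Gamma\otimes\mathcal D_E\to\Gamma\otimes\mathcal D_C$, where $P$ is the orthogonal projection onto $\bigoplus_\alpha V^E_\alpha\mathcal L_C$; it is a contractive multi-analytic operator. *)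

theory Defs
  imports "HOL-Analysis.Analysis"
begin

unbundle cardinal_syntax


section \<open>Complex Hilbert spaces\<close>

text \<open>
  The complex inner product is antilinear in the first argument and extends the real inner
  product of the superclass, so norm and topology are those of \<^class>\<open>real_inner\<close>.
\<close>

class complex_hilbert = real_inner + complete_space +
  fixes scaleC :: "complex \<Rightarrow> 'a \<Rightarrow> 'a"  (infixr \<open>*\<^sub>C\<close> 75)
    and cinner :: "'a \<Rightarrow> 'a \<Rightarrow> complex"
  assumes scaleC_add_right: "a *\<^sub>C (x + y) = a *\<^sub>C x + a *\<^sub>C y"
    and scaleC_add_left: "(a + b) *\<^sub>C x = a *\<^sub>C x + b *\<^sub>C x"
    and scaleC_scaleC: "a *\<^sub>C b *\<^sub>C x = (a * b) *\<^sub>C x"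
    and scaleC_of_real: "complex_of_real r *\<^sub>C x = r *\<^sub>R x"
    and cinner_commute: "cinner x y = cnj (cinner y x)"
    and cinner_add_right: "cinner x (y + z) = cinner x y + cinner x z"
    and cinner_scaleC_right: "cinner x (a *\<^sub>C y) = a * cinner x y"
    and Re_cinner: "Re (cinner x y) = inner x y"
begin

lemma Im_cinner: "Im (cinner x y) = - inner x (\<i> *\<^sub>C y)"
  using Re_cinner [of x "\<i> *\<^sub>C y"] by (simp add: cinner_scaleC_right)

lemma cinner_self: "cinner x x = complex_of_real (inner x x)"
proof -
  have "Im (cinner x x) = 0"
    using arg_cong [OF cinner_commute [of x x], of Im] by simp
  then show ?thesis
    by (simp add: complex_eq_iff Re_cinner)
qed

lemma cinner_scaleC_left: "cinner (a *\<^sub>C x) y = cnj a * cinner x y"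
  by (metis cinner_commute cinner_scaleC_right complex_cnj_mult)

lemma cinner_add_left: "cinner (x + y) z = cinner x z + cinner y z"
  by (metis cinner_commute cinner_add_right complex_cnj_add)

end

lemma norm_scaleC: "norm (a *\<^sub>C x) = cmod a * norm (x :: 'a::complex_hilbert)"
proof -
  have "complex_of_real (inner (a *\<^sub>C x) (a *\<^sub>C x)) = complex_of_real ((cmod a)\<^sup>2 * inner x x)"
    unfolding cinner_self [symmetric] of_real_mult complex_norm_square
    by (simp add: cinner_scaleC_left cinner_scaleC_right)
  then have "inner (a *\<^sub>C x) (a *\<^sub>C x) = (cmod a)\<^sup>2 * inner x x"
    using of_real_eq_iff by blast
  then show ?thesis
    by (simp add: norm_eq_sqrt_inner real_sqrt_mult)
qed

instantiation complex :: complex_hilbert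
begin

definition scaleC_complex :: "complex \<Rightarrow> complex \<Rightarrow> complex"
  where "scaleC_complex a x = a * x"

definition cinner_complex :: "complex \<Rightarrow> complex \<Rightarrow> complex"
  where "cinner_complex x y = cnj x * y"

instance
  by standard
    (auto simp: scaleC_complex_def cinner_complex_def algebra_simps scaleR_conv_of_real
      inner_complex_def)

end

instantiation prod :: (complex_hilbert, complex_hilbert) complex_hilbert
begin

definition scaleC_prod :: "complex \<Rightarrow> 'a \<times> 'b \<Rightarrow> 'a \<times> 'b"
  where "scaleC_prod a x = (a *\<^sub>C fst x, a *\<^sub>C snd x)"

definition cinner_prod :: "'a \<times> 'b \<Rightarrow> 'a \<times> 'b \<Rightarrow> complex"
  where "cinner_prod x y = cinner (fst x) (fst y) + cinner (snd x) (snd y)"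

instance
proof
  fix x y :: "'a \<times> 'b"
  show "cinner x y = cnj (cinner y x)"
    unfolding cinner_prod_def by (metis cinner_commute complex_cnj_add)
qed (auto simp: scaleC_prod_def cinner_prod_def scaleC_add_right scaleC_add_left scaleC_scaleC
      scaleC_of_real cinner_add_right cinner_scaleC_right Re_cinner inner_prod_def algebra_simps
      prod_eq_iff)

end

instantiation vec :: (complex_hilbert, finite) complex_hilbert
begin

definition scaleC_vec :: "complex \<Rightarrow> 'a ^ 'b \<Rightarrow> 'a ^ 'b"
  where "scaleC_vec a x = (\<chi> i. a *\<^sub>C x $ i)"

definition cinner_vec :: "'a ^ 'b \<Rightarrow> 'a ^ 'b \<Rightarrow> complex"
  where "cinner_vec x y = (\<Sum>i\<in>UNIV. cinner (x $ i) (y $ i))"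

instance
proof
  fix x y :: "'a ^ 'b"
  show "cinner x y = cnj (cinner y x)"
    unfolding cinner_vec_def cnj_sum by (intro sum.cong refl cinner_commute)
qed (auto simp: scaleC_vec_def cinner_vec_def scaleC_add_right scaleC_add_left scaleC_scaleC
      scaleC_of_real cinner_add_right cinner_scaleC_right Re_cinner inner_vec_def
      sum.distrib sum_distrib_left vec_eq_iff)

end


section \<open>Square-summable families\<close>

typedef (overloaded) ('w, 'a) ell2 = "{f :: 'w \<Rightarrow> 'a::real_inner. (\<lambda>w. (norm (f w))\<^sup>2) summable_on UNIV}"
  morphisms coord Abs_ell2
  by (rule exI [of _ "\<lambda>_. 0"]) simp

setup_lifting type_definition_ell2

lemma summable_coord: "(\<lambda>w. (norm (coord f w))\<^sup>2) summable_on UNIV"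
  using coord [of f] by simp

lemma ell2_eqI: "(\<And>w. coord f w = coord g w) \<Longrightarrow> f = g"
  by (metis coord_inject ext)

lemma square_summable_add:
  fixes f g :: "'w \<Rightarrow> 'a::real_inner"
  assumes "(\<lambda>w. (norm (f w))\<^sup>2) summable_on UNIV" "(\<lambda>w. (norm (g w))\<^sup>2) summable_on UNIV"
  shows "(\<lambda>w. (norm (f w + g w))\<^sup>2) summable_on UNIV"
proof (rule summable_on_comparison_test)
  show "(\<lambda>w. 2 * (norm (f w))\<^sup>2 + 2 * (norm (g w))\<^sup>2) summable_on UNIV"
    by (intro summable_on_add summable_on_cmult_right assms)
  show "(norm (f w + g w))\<^sup>2 \<le> 2 * (norm (f w))\<^sup>2 + 2 * (norm (g w))\<^sup>2" for w
  proof -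
    have "(norm (f w + g w))\<^sup>2 \<le> (norm (f w) + norm (g w))\<^sup>2"
      by (intro power_mono norm_triangle_ineq) auto
    also have "\<dots> \<le> 2 * (norm (f w))\<^sup>2 + 2 * (norm (g w))\<^sup>2"
      using sum_squares_bound [of "norm (f w)" "norm (g w)"] by (simp add: power2_sum)
    finally show ?thesis .
  qed
qed auto

lemma square_summable_scale:
  fixes f :: "'w \<Rightarrow> 'a::real_inner" and g :: "'w \<Rightarrow> 'b::real_inner"
  assumes "(\<lambda>w. (norm (f w))\<^sup>2) summable_on UNIV" "\<And>w. norm (g w) = c * norm (f w)"
  shows "(\<lambda>w. (norm (g w))\<^sup>2) summable_on UNIV"
  using assms by (simp add: power_mult_distrib summable_on_cmult_right)

lemma summable_inner:
  fixes f g :: "'w \<Rightarrow> 'a::real_inner"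
  assumes "(\<lambda>w. (norm (f w))\<^sup>2) summable_on UNIV" "(\<lambda>w. (norm (g w))\<^sup>2) summable_on UNIV"
  shows "(\<lambda>w. inner (f w) (g w)) summable_on UNIV"
proof (rule Infinite_Sum.abs_summable_summable, rule Infinite_Sum.abs_summable_on_comparison_test')
  show "(\<lambda>w. (norm (f w))\<^sup>2 + (norm (g w))\<^sup>2) summable_on UNIV"
    using assms by (rule summable_on_add)
  show "norm (inner (f w) (g w)) \<le> (norm (f w))\<^sup>2 + (norm (g w))\<^sup>2" for w
  proof -
    have "\<bar>inner (f w) (g w)\<bar> \<le> norm (f w) * norm (g w)"
      by (rule Cauchy_Schwarz_ineq2)
    moreover have "0 \<le> norm (f w) * norm (g w)"
      by simp
    ultimately show ?thesis
      using sum_squares_bound [of "norm (f w)" "norm (g w)"] unfolding real_norm_def mult.assoc by linarith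
  qed
qed

instantiation ell2 :: (type, real_inner) real_inner
begin

lift_definition zero_ell2 :: "('a, 'b) ell2" is "\<lambda>_. 0"
  by simp

lift_definition plus_ell2 :: "('a, 'b) ell2 \<Rightarrow> ('a, 'b) ell2 \<Rightarrow> ('a, 'b) ell2"
  is "\<lambda>f g w. f w + g w"
  by (rule square_summable_add)

lift_definition uminus_ell2 :: "('a, 'b) ell2 \<Rightarrow> ('a, 'b) ell2" is "\<lambda>f w. - f w"
  by simp

lift_definition minus_ell2 :: "('a, 'b) ell2 \<Rightarrow> ('a, 'b) ell2 \<Rightarrow> ('a, 'b) ell2"
  is "\<lambda>f g w. f w - g w"
  subgoal for f g using square_summable_add [of f "\<lambda>w. - g w"] by simp
  done

lift_definition scaleR_ell2 :: "real \<Rightarrow> ('a, 'b) ell2 \<Rightarrow> ('a, 'b) ell2" is "\<lambda>r f w. r *\<^sub>R f w"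
  by (erule square_summable_scale) (rule norm_scaleR)

definition inner_ell2 :: "('a, 'b) ell2 \<Rightarrow> ('a, 'b) ell2 \<Rightarrow> real"
  where "inner_ell2 f g = (\<Sum>\<^sub>\<infinity>w. inner (coord f w) (coord g w))"

definition norm_ell2 :: "('a, 'b) ell2 \<Rightarrow> real"
  where "norm_ell2 f = sqrt (inner f f)"

definition dist_ell2 :: "('a, 'b) ell2 \<Rightarrow> ('a, 'b) ell2 \<Rightarrow> real"
  where "dist_ell2 f g = norm (f - g)"

definition sgn_ell2 :: "('a, 'b) ell2 \<Rightarrow> ('a, 'b) ell2"
  where "sgn_ell2 f = scaleR (inverse (norm f)) f"

definition uniformity_ell2 :: "(('a, 'b) ell2 \<times> ('a, 'b) ell2) filter"
  where "uniformity_ell2 = (INF e\<in>{0<..}. principal {(x, y). dist x y < e})"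

definition open_ell2 :: "('a, 'b) ell2 set \<Rightarrow> bool"
  where "open_ell2 U = (\<forall>x\<in>U. eventually (\<lambda>(x', y). x' = x \<longrightarrow> y \<in> U) uniformity)"

instance
proof
  fix f g h :: "('a, 'b) ell2" and r s :: real
  show "f + g + h = f + (g + h)" "f + g = g + f" "0 + f = f" "- f + f = 0" "f - g = f + - g"
    "r *\<^sub>R (f + g) = r *\<^sub>R f + r *\<^sub>R g" "(r + s) *\<^sub>R f = r *\<^sub>R f + s *\<^sub>R f"
    "r *\<^sub>R s *\<^sub>R f = (r * s) *\<^sub>R f" "1 *\<^sub>R f = f"
    by (transfer; simp add: algebra_simps)+
  show "sgn f = scaleR (inverse (norm f)) f" "dist f g = norm (f - g)" "norm f = sqrt (inner f f)"
    by (simp_all add: sgn_ell2_def dist_ell2_def norm_ell2_def)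
  show "uniformity = (INF e\<in>{0<..}. principal {(x, y :: ('a, 'b) ell2). dist x y < e})"
    by (fact uniformity_ell2_def)
  show "open U = (\<forall>x\<in>U. eventually (\<lambda>(x', y). x' = x \<longrightarrow> y \<in> U) uniformity)"
    for U :: "('a, 'b) ell2 set"
    by (fact open_ell2_def)
  have sm: "(\<lambda>w. inner (coord f w) (coord g w)) summable_on UNIV" for f g :: "('a, 'b) ell2"
    by (rule summable_inner [OF summable_coord summable_coord])
  show "inner f g = inner g f"
    by (simp add: inner_ell2_def inner_commute)
  show "inner (f + g) h = inner f h + inner g h"
    by (simp add: inner_ell2_def plus_ell2.rep_eq inner_add_left infsum_add sm)
  show "inner (r *\<^sub>R f) g = r * inner f g"
    by (simp add: inner_ell2_def scaleR_ell2.rep_eq infsum_cmult_right')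
  show "0 \<le> inner f f"
    by (simp add: inner_ell2_def infsum_nonneg)
  show "inner f f = 0 \<longleftrightarrow> f = 0"
  proof
    assume "inner f f = 0"
    then have "inner (coord f w) (coord f w) = 0" for w
      using nonneg_infsum_le_0D [of "\<lambda>w. inner (coord f w) (coord f w)" UNIV w] sm [of f f]
      by (simp add: inner_ell2_def)
    then show "f = 0"
      by (intro ell2_eqI) (simp add: zero_ell2.rep_eq)
  qed (simp add: inner_ell2_def zero_ell2.rep_eq)
qed

end

lemma norm_ell2_square: "(norm f)\<^sup>2 = (\<Sum>\<^sub>\<infinity>w. (norm (coord f w))\<^sup>2)"
  by (simp add: power2_norm_eq_inner inner_ell2_def)

lemma sum_coord_le: "finite F \<Longrightarrow> (\<Sum>w\<in>F. (norm (coord f w))\<^sup>2) \<le> (norm f)\<^sup>2"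
  unfolding norm_ell2_square by (rule finite_sum_le_infsum) (auto simp: summable_coord)

lemma norm_coord_le: "norm (coord f w) \<le> norm f"
  using sum_coord_le [of "{w}" f] by (simp add: power2_le_iff_abs_le)

instance ell2 :: (type, "{real_inner, complete_space}") complete_space
proof
  fix X :: "nat \<Rightarrow> ('a, 'b) ell2"
  assume X: "Cauchy X"
  have "Cauchy (\<lambda>n. coord (X n) w)" for w
  proof (rule CauchyI)
    fix e :: real
    assume "e > 0"
    then obtain N where N: "\<And>m n. m \<ge> N \<Longrightarrow> n \<ge> N \<Longrightarrow> norm (X m - X n) < e"
      using X unfolding Cauchy_iff by blast
    have "norm (coord (X m) w - coord (X n) w) \<le> norm (X m - X n)" for m n
      using norm_coord_le [of "X m - X n" w] by (simp add: minus_ell2.rep_eq)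
    then show "\<exists>M. \<forall>m\<ge>M. \<forall>n\<ge>M. norm (coord (X m) w - coord (X n) w) < e"
      using N by (meson order.strict_trans1)
  qed
  then have "\<forall>w. \<exists>l. (\<lambda>n. coord (X n) w) \<longlonglongrightarrow> l"
    by (meson Cauchy_convergent convergent_def)
  then obtain f where f: "\<And>w. (\<lambda>n. coord (X n) w) \<longlonglongrightarrow> f w"
    by metis
  have bound: "(\<Sum>w\<in>F. (norm (coord (X n) w - f w))\<^sup>2) \<le> e\<^sup>2"
    if F: "finite F" and n: "n \<ge> N" and N: "\<And>m n. m \<ge> N \<Longrightarrow> n \<ge> N \<Longrightarrow> norm (X m - X n) < e"
    for F n N e
  proof (rule tendsto_upperbound)
    show "(\<lambda>m. \<Sum>w\<in>F. (norm (coord (X n) w - coord (X m) w))\<^sup>2)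
        \<longlonglongrightarrow> (\<Sum>w\<in>F. (norm (coord (X n) w - f w))\<^sup>2)"
      by (intro tendsto_sum tendsto_power tendsto_norm tendsto_diff tendsto_const f)
    have "(\<Sum>w\<in>F. (norm (coord (X n) w - coord (X m) w))\<^sup>2) \<le> e\<^sup>2" if "m \<ge> N" for m
    proof -
      have "(\<Sum>w\<in>F. (norm (coord (X n) w - coord (X m) w))\<^sup>2) \<le> (norm (X n - X m))\<^sup>2"
        using sum_coord_le [OF F, of "X n - X m"] by (simp add: minus_ell2.rep_eq)
      also have "\<dots> \<le> e\<^sup>2"
        using N [OF n that] by (intro power_mono) auto
      finally show ?thesis .
    qed
    then show "\<forall>\<^sub>F m in sequentially. (\<Sum>w\<in>F. (norm (coord (X n) w - coord (X m) w))\<^sup>2) \<le> e\<^sup>2"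
      by (auto simp: eventually_sequentially)
  qed simp
  have summ: "(\<lambda>w. (norm (coord (X n) w - f w))\<^sup>2) summable_on UNIV"
    if "n \<ge> N" "\<And>m n. m \<ge> N \<Longrightarrow> n \<ge> N \<Longrightarrow> norm (X m - X n) < e" for n N e
    by (rule nonneg_bdd_above_summable_on)
      (auto simp: bdd_above_def intro!: exI [of _ "e\<^sup>2"] bound that)
  obtain N1 where N1: "\<And>m n. m \<ge> N1 \<Longrightarrow> n \<ge> N1 \<Longrightarrow> norm (X m - X n) < 1"
    using X unfolding Cauchy_iff by (meson zero_less_one)
  have "(\<lambda>w. (norm (f w))\<^sup>2) summable_on UNIV"
    using square_summable_add [OF summable_coord [of "- X N1"] summ [of N1 N1 1]] N1
    by (simp add: uminus_ell2.rep_eq norm_minus_commute)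
  then obtain g where g: "\<And>w. coord g w = f w"
    by (metis Abs_ell2_inverse mem_Collect_eq)
  have "X \<longlonglongrightarrow> g"
  proof (rule LIMSEQ_I)
    fix r :: real
    assume r: "r > 0"
    then obtain N where N: "\<And>m n. m \<ge> N \<Longrightarrow> n \<ge> N \<Longrightarrow> norm (X m - X n) < r / 2"
      using X unfolding Cauchy_iff by (meson half_gt_zero)
    have "norm (X n - g) < r" if n: "n \<ge> N" for n
    proof -
      have "(norm (X n - g))\<^sup>2 \<le> (r / 2)\<^sup>2"
        unfolding norm_ell2_square minus_ell2.rep_eq g
        by (rule infsum_le_finite_sums [OF summ [OF n N]]) (auto intro: bound n N)
      then have "norm (X n - g) \<le> r / 2"
        using r by (simp add: power2_le_iff_abs_le)
      then show ?thesis
        using r by simp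
    qed
    then show "\<exists>no. \<forall>n\<ge>no. norm (X n - g) < r"
      by blast
  qed
  then show "convergent X"
    by (auto simp: convergent_def)
qed

lemma summable_cinner:
  fixes f g :: "'w \<Rightarrow> 'a::complex_hilbert"
  assumes "(\<lambda>w. (norm (f w))\<^sup>2) summable_on UNIV" "(\<lambda>w. (norm (g w))\<^sup>2) summable_on UNIV"
  shows "(\<lambda>w. cinner (f w) (g w)) summable_on UNIV"
proof -
  have "(\<lambda>w. complex_of_real (inner (f w) (g w))
      + (- \<i>) * complex_of_real (inner (f w) (\<i> *\<^sub>C g w))) summable_on UNIV"
    by (intro summable_on_add summable_on_cmult_right summable_on_of_real summable_inner assms)
      (rule square_summable_scale [OF assms(2), of _ 1], simp add: norm_scaleC)
  also have "(\<lambda>w. complex_of_real (inner (f w) (g w))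
      + (- \<i>) * complex_of_real (inner (f w) (\<i> *\<^sub>C g w))) = (\<lambda>w. cinner (f w) (g w))"
    by (auto simp: fun_eq_iff complex_eq_iff Re_cinner Im_cinner)
  finally show ?thesis .
qed

instantiation ell2 :: (type, complex_hilbert) complex_hilbert
begin

lift_definition scaleC_ell2 :: "complex \<Rightarrow> ('a, 'b) ell2 \<Rightarrow> ('a, 'b) ell2" is "\<lambda>a f w. a *\<^sub>C f w"
  by (erule square_summable_scale) (rule norm_scaleC)

definition cinner_ell2 :: "('a, 'b) ell2 \<Rightarrow> ('a, 'b) ell2 \<Rightarrow> complex"
  where "cinner_ell2 f g = (\<Sum>\<^sub>\<infinity>w. cinner (coord f w) (coord g w))"

instance
proof
  fix f g h :: "('a, 'b) ell2" and a b :: complex and r :: real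
  show "a *\<^sub>C (f + g) = a *\<^sub>C f + a *\<^sub>C g" "(a + b) *\<^sub>C f = a *\<^sub>C f + b *\<^sub>C f"
    "a *\<^sub>C b *\<^sub>C f = (a * b) *\<^sub>C f" "complex_of_real r *\<^sub>C f = r *\<^sub>R f"
    by (transfer; simp add: scaleC_add_right scaleC_add_left scaleC_scaleC scaleC_of_real)+
  have sm: "(\<lambda>w. cinner (coord f w) (coord g w)) summable_on UNIV" for f g :: "('a, 'b) ell2"
    by (rule summable_cinner [OF summable_coord summable_coord])
  show "cinner f g = cnj (cinner g f)"
    unfolding cinner_ell2_def infsum_cnj [symmetric] by (intro infsum_cong cinner_commute)
  show "cinner f (g + h) = cinner f g + cinner f h"
    by (simp add: cinner_ell2_def plus_ell2.rep_eq cinner_add_right infsum_add sm)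
  show "cinner f (a *\<^sub>C g) = a * cinner f g"
    by (simp add: cinner_ell2_def scaleC_ell2.rep_eq cinner_scaleC_right infsum_cmult_right')
  show "Re (cinner f g) = inner f g"
    by (simp add: cinner_ell2_def inner_ell2_def infsum_Re [OF sm, symmetric] Re_cinner)
qed

end


section \<open>Subspaces and operators\<close>

text \<open>
  A Hilbert space is a closed complex subspace \<open>X\<close> of some type of class
  \<^class>\<open>complex_hilbert\<close>, possibly the whole type. An operator on \<open>X\<close> is a total function of
  which only the values on \<open>X\<close> matter, and the notions below are relative to such carriers.
\<close>

definition closed_csubspace :: "'a::complex_hilbert set \<Rightarrow> bool"
  where "closed_csubspace X \<longleftrightarrow>
    0 \<in> X \<and> (\<forall>x\<in>X. \<forall>y\<in>X. x + y \<in> X) \<and> (\<forall>a. \<forall>x\<in>X. a *\<^sub>C x \<in> X) \<and> closed X"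

abbreviation closed_cspan :: "'a::complex_hilbert set \<Rightarrow> 'a set"
  where "closed_cspan S \<equiv> closed_csubspace hull S"

definition ortho_diff :: "'a::complex_hilbert set \<Rightarrow> 'a set \<Rightarrow> 'a set"  (infixl \<open>\<ominus>\<close> 65)
  where "X \<ominus> Y = {x \<in> X. \<forall>y\<in>Y. cinner y x = 0}"

definition proj :: "'a::complex_hilbert set \<Rightarrow> 'a \<Rightarrow> 'a"
  where "proj X x = (THE p. p \<in> X \<and> (\<forall>z\<in>X. cinner z (x - p) = 0))"

definition bounded_op ::
    "'a::complex_hilbert set \<Rightarrow> 'b::complex_hilbert set \<Rightarrow> ('a \<Rightarrow> 'b) \<Rightarrow> bool"
  where "bounded_op X Y T \<longleftrightarrow>
    (\<forall>x\<in>X. T x \<in> Y) \<and>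
    (\<forall>x\<in>X. \<forall>y\<in>X. T (x + y) = T x + T y) \<and> (\<forall>a. \<forall>x\<in>X. T (a *\<^sub>C x) = a *\<^sub>C T x) \<and>
    (\<exists>K. \<forall>x\<in>X. norm (T x) \<le> K * norm x)"

definition unitary_op ::
    "'a::complex_hilbert set \<Rightarrow> 'b::complex_hilbert set \<Rightarrow> ('a \<Rightarrow> 'b) \<Rightarrow> bool"
  where "unitary_op X Y u \<longleftrightarrow>
    bounded_op X Y u \<and> u ` X = Y \<and> (\<forall>x\<in>X. \<forall>y\<in>X. cinner (u x) (u y) = cinner x y)"

text \<open>The adjoint of \<open>T : X \<rightarrow> Y\<close>; the codomain does not enter.\<close>

definition adj :: "'a::complex_hilbert set \<Rightarrow> ('a \<Rightarrow> 'b::complex_hilbert) \<Rightarrow> 'b \<Rightarrow> 'a"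
  where "adj X T y = (THE x. x \<in> X \<and> (\<forall>z\<in>X. cinner z x = cinner (T z) y))"

definition positive_op :: "'a::complex_hilbert set \<Rightarrow> ('a \<Rightarrow> 'a) \<Rightarrow> bool"
  where "positive_op X S \<longleftrightarrow> bounded_op X X S \<and> (\<forall>x\<in>X. cinner x (S x) \<in> \<real>\<^sub>\<ge>\<^sub>0)"

text \<open>The positive square root is unique on \<open>X\<close>, whence \<open>SOME\<close> is harmless.\<close>

definition sqrt_op :: "'a::complex_hilbert set \<Rightarrow> ('a \<Rightarrow> 'a) \<Rightarrow> 'a \<Rightarrow> 'a"
  where "sqrt_op X Q = (SOME S. positive_op X S \<and> (\<forall>x\<in>X. S (S x) = Q x))"

definition orthonormal_basis :: "'a::complex_hilbert set \<Rightarrow> 'a set \<Rightarrow> bool"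
  where "orthonormal_basis X B \<longleftrightarrow>
    B \<subseteq> X \<and> (\<forall>b\<in>B. norm b = 1) \<and> (\<forall>b\<in>B. \<forall>c\<in>B. b \<noteq> c \<longrightarrow> cinner b c = 0) \<and>
    closed_cspan B = X"

text \<open>
  The Hilbert dimension, as a cardinal: all orthonormal bases of \<open>X\<close> have the same cardinality.
  Dimensions of spaces of different types are compared with \<open>=o\<close>.
\<close>

definition hilbert_dim :: "'a::complex_hilbert set \<Rightarrow> 'a rel"
  where "hilbert_dim X = |SOME B. orthonormal_basis X B|"


section \<open>The full Fock space and multi-analytic operators\<close>

text \<open>
  Throughout, \<open>d\<close> is the cardinality of a finite type \<open>'d\<close>. Words over \<open>'d\<close> index the canonical
  orthonormal basis of the full Fock space \<open>\<Gamma>\<close>, which is thus \<open>('d, complex) fock\<close>, and for a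
  Hilbert space \<open>D\<close> the Hilbert space tensor product \<open>\<Gamma> \<otimes> D\<close> is the space \<open>Fock D\<close> of
  square-summable families in \<open>D\<close> indexed by words; see \<open>cinner_tensor\<close> and
  \<open>Fock_eq_closed_cspan\<close> below.
\<close>

type_synonym ('d, 'a) fock = "('d list, 'a) ell2"

lift_definition tensor :: "('w, complex) ell2 \<Rightarrow> 'a::complex_hilbert \<Rightarrow> ('w, 'a) ell2"
  (infixr \<open>\<otimes>\<close> 70) is "\<lambda>x \<delta> w. x w *\<^sub>C \<delta>"
  subgoal for x \<delta> by (rule square_summable_scale [of x _ "norm \<delta>"]) (simp_all add: norm_scaleC)
  done

lift_definition basis_vec :: "'w \<Rightarrow> ('w, complex) ell2" is "\<lambda>w v. if v = w then 1 else 0"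
  by (rule finite_nonzero_values_imp_summable_on) simp

definition vacuum :: "('d, complex) fock"
  where "vacuum = basis_vec []"

definition Fock :: "'a::complex_hilbert set \<Rightarrow> ('d, 'a) fock set"
  where "Fock D = {\<eta>. \<forall>w. coord \<eta> w \<in> D}"

text \<open>\<open>creation j\<close> is \<open>L\<^sub>j \<otimes> I\<close>; see \<open>creation_tensor\<close> and \<open>creation_basis_vec\<close>.\<close>

lift_definition creation :: "'d \<Rightarrow> ('d, 'a::complex_hilbert) fock \<Rightarrow> ('d, 'a) fock"
  is "\<lambda>j \<eta> w. case w of [] \<Rightarrow> 0 | i # v \<Rightarrow> if i = j then \<eta> v else 0"
  subgoal for j \<eta>
  proof -
    assume "(\<lambda>w. (norm (\<eta> w))\<^sup>2) summable_on UNIV"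
    then have "(\<lambda>w. (norm (\<eta> (tl w)))\<^sup>2) summable_on range (Cons j)"
      by (subst summable_on_reindex) (auto simp: o_def)
    then show ?thesis
      by (rule summable_on_cong_neutral [THEN iffD2, rotated -1]) (auto split: list.splits)
  qed
  done

lemma cinner_tensor: "cinner (x \<otimes> \<delta>) (y \<otimes> \<epsilon>) = cinner x y * cinner \<delta> \<epsilon>"
  by (simp add: cinner_ell2_def tensor.rep_eq cinner_scaleC_left cinner_scaleC_right
      cinner_complex_def mult_ac infsum_cmult_right')

lemma creation_tensor: "creation j (x \<otimes> \<delta>) = creation j x \<otimes> \<delta>"
proof (rule ell2_eqI)
  have "0 *\<^sub>C \<delta> = 0"
    using scaleC_of_real [of 0 \<delta>] by simp
  then show "coord (creation j (x \<otimes> \<delta>)) w = coord (creation j x \<otimes> \<delta>) w" for w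
    by (auto simp: creation.rep_eq tensor.rep_eq split: list.splits)
qed

lemma creation_basis_vec: "creation j (basis_vec w) = basis_vec (j # w)"
  by (rule ell2_eqI) (auto simp: creation.rep_eq basis_vec.rep_eq split: list.splits)

lemma closed_csubspace_Fock:
  fixes D :: "'a::complex_hilbert set"
  assumes "closed_csubspace D"
  shows "closed_csubspace (Fock D :: ('d, 'a) fock set)"
proof -
  have "closed (Fock D :: ('d, 'a) fock set)"
    unfolding closed_sequential_limits
  proof (intro allI impI)
    fix X and \<eta> :: "('d, 'a) fock"
    assume X: "(\<forall>n. X n \<in> Fock D) \<and> X \<longlonglongrightarrow> \<eta>"
    have "(\<lambda>n. coord (X n) w) \<longlonglongrightarrow> coord \<eta> w" for w
    proof (rule metric_tendsto_imp_tendsto [OF conjunct2 [OF X]], rule always_eventually, rule allI)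
      show "dist (coord (X n) w) (coord \<eta> w) \<le> dist (X n) \<eta>" for n
        using norm_coord_le [of "X n - \<eta>" w] by (simp add: dist_norm minus_ell2.rep_eq)
    qed
    moreover have "coord (X n) w \<in> D" for n w
      using X by (simp add: Fock_def)
    moreover have "closed D"
      using assms by (simp add: closed_csubspace_def)
    ultimately have "coord \<eta> w \<in> D" for w
      using closed_sequentially [of D "\<lambda>n. coord (X n) w" "coord \<eta> w"] by simp
    then show "\<eta> \<in> Fock D"
      by (simp add: Fock_def)
  qed
  then show ?thesis
    using assms
    by (auto simp: closed_csubspace_def Fock_def zero_ell2.rep_eq plus_ell2.rep_eq
        scaleC_ell2.rep_eq)
qed

lemma Fock_eq_closed_cspan:
  fixes D :: "'a::complex_hilbert set"
  assumes D: "closed_csubspace D"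
  shows "(Fock D :: ('d, 'a) fock set) = closed_cspan {x \<otimes> \<delta> |x \<delta>. \<delta> \<in> D}"
    (is "?F = closed_cspan ?S")
proof
  have "?S \<subseteq> ?F"
    using D by (auto simp: Fock_def tensor.rep_eq closed_csubspace_def)
  then show "closed_cspan ?S \<subseteq> ?F"
    by (rule hull_minimal) (rule closed_csubspace_Fock [OF D])
next
  show "?F \<subseteq> closed_cspan ?S"
    unfolding hull_def
  proof (intro subsetI InterI)
    fix \<eta> :: "('d, 'a) fock" and K :: "('d, 'a) fock set"
    assume \<eta>: "\<eta> \<in> ?F" and "K \<in> {K. closed_csubspace K \<and> ?S \<subseteq> K}"
    then have K: "closed_csubspace K" "?S \<subseteq> K"
      by auto
    define g where "g F = (\<Sum>w\<in>F. basis_vec w \<otimes> coord \<eta> w)" for F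
    have one_zero: "1 *\<^sub>C x = x" "0 *\<^sub>C x = 0" for x :: 'a
      using scaleC_of_real [of 1 x] scaleC_of_real [of 0 x] by auto
    have g: "g F \<in> K \<and> (\<forall>v. coord (g F) v = (if v \<in> F then coord \<eta> v else 0))"
      if "finite F" for F
      using that
    proof induction
      case empty
      then show ?case
        using K(1) by (auto simp: g_def closed_csubspace_def zero_ell2.rep_eq)
    next
      case (insert w F)
      have "basis_vec w \<otimes> coord \<eta> w \<in> K"
        using K(2) \<eta> by (auto simp: Fock_def)
      moreover have "g F \<in> K" and F: "\<And>v. coord (g F) v = (if v \<in> F then coord \<eta> v else 0)"
        using insert by auto
      ultimately have "g (insert w F) \<in> K"
        using K(1) insert by (simp add: g_def closed_csubspace_def)
      moreover have "coord (g (insert w F)) v = (if v \<in> insert w F then coord \<eta> v else 0)" for v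
        using insert F [of v]
        by (simp add: g_def plus_ell2.rep_eq tensor.rep_eq basis_vec.rep_eq one_zero)
      ultimately show ?case
        by blast
    qed
    have "\<exists>y\<in>K. dist y \<eta> < e" if "e > 0" for e
    proof -
      let ?h = "\<lambda>w. (norm (coord \<eta> w))\<^sup>2"
      have "e\<^sup>2 / 2 > 0"
        using that by simp
      then obtain F where F: "finite F" "dist (sum ?h F) (infsum ?h UNIV) \<le> e\<^sup>2 / 2"
        using infsum_finite_approximation [OF summable_coord [of \<eta>], of "e\<^sup>2 / 2"] by blast
      have "(norm (\<eta> - g F))\<^sup>2 = infsum ?h (- F)"
        unfolding norm_ell2_square
        by (rule infsum_cong_neutral) (use g [OF F(1)] in \<open>auto simp: minus_ell2.rep_eq\<close>)
      also have "\<dots> = infsum ?h UNIV - sum ?h F"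
        using infsum_Diff [OF summable_coord [of \<eta>] summable_on_finite [OF F(1)]] F(1)
        by (simp add: Compl_eq_Diff_UNIV)
      also have "\<dots> \<le> e\<^sup>2 / 2"
        using F(2) unfolding dist_real_def by linarith
      also have "\<dots> < e\<^sup>2"
        using \<open>e\<^sup>2 / 2 > 0\<close> by simp
      finally have "norm (\<eta> - g F) < e"
        by (rule power2_less_imp_less) (use that in simp)
      then have "dist (g F) \<eta> < e"
        by (simp add: dist_norm norm_minus_commute)
      then show ?thesis
        using g [OF F(1)] by blast
    qed
    then show "\<eta> \<in> K"
      using closed_approachable [of K \<eta>] K(1) by (simp add: closed_csubspace_def)
  qed
qed

definition multi_analytic ::
    "'a::complex_hilbert set \<Rightarrow> 'b::complex_hilbert set \<Rightarrow> (('d, 'a) fock \<Rightarrow> ('d, 'b) fock) \<Rightarrow> bool"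
  where "multi_analytic D L M \<longleftrightarrow>
    bounded_op (Fock D) (Fock L) M \<and> (\<forall>j. \<forall>\<xi>\<in>Fock D. M (creation j \<xi>) = creation j (M \<xi>))"

definition contractive_multi_analytic ::
    "'a::complex_hilbert set \<Rightarrow> 'b::complex_hilbert set \<Rightarrow> (('d, 'a) fock \<Rightarrow> ('d, 'b) fock) \<Rightarrow> bool"
  where "contractive_multi_analytic D L M \<longleftrightarrow>
    multi_analytic D L M \<and> (\<forall>\<xi>\<in>Fock D. norm (M \<xi>) \<le> norm \<xi>)"

definition symbol :: "(('d, 'a::complex_hilbert) fock \<Rightarrow> ('d, 'b) fock) \<Rightarrow> 'a \<Rightarrow> ('d, 'b) fock"
  where "symbol M \<delta> = M (vacuum \<otimes> \<delta>)"

definition injective_contractive_symbol ::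
    "'a::complex_hilbert set \<Rightarrow> 'b::complex_hilbert set \<Rightarrow> (('d, 'a) fock \<Rightarrow> ('d, 'b) fock) \<Rightarrow> bool"
  where "injective_contractive_symbol D L M \<longleftrightarrow>
    closed_csubspace D \<and> contractive_multi_analytic D L M \<and> inj_on (symbol M) D"

definition symbol_equiv ::
    "'a::complex_hilbert set \<Rightarrow> ('a \<Rightarrow> ('d, 'b) fock) \<Rightarrow>
     'e::complex_hilbert set \<Rightarrow> ('e \<Rightarrow> ('d, 'b) fock) \<Rightarrow> bool"
  where "symbol_equiv D \<Theta> D' \<Theta>' \<longleftrightarrow> (\<exists>v. unitary_op D D' v \<and> (\<forall>\<delta>\<in>D. \<Theta>' (v \<delta>) = \<Theta> \<delta>))"


section \<open>Row contractions, defects and liftings\<close>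

definition row_contraction :: "'h::complex_hilbert set \<Rightarrow> ('d::finite \<Rightarrow> 'h \<Rightarrow> 'h) \<Rightarrow> bool"
  where "row_contraction H T \<longleftrightarrow>
    (\<forall>j. bounded_op H H (T j)) \<and> positive_op H (\<lambda>x. x - (\<Sum>j\<in>UNIV. T j (adj H (T j) x)))"

text \<open>The direct sum of \<open>d\<close> copies of \<open>H\<close>, and its \<open>j\<close>-th inclusion \<^term>\<open>axis j\<close>.\<close>

definition copies :: "'h set \<Rightarrow> ('h ^ 'd::finite) set"
  where "copies H = {x. \<forall>i. x $ i \<in> H}"

definition defect_op ::
    "'h::complex_hilbert set \<Rightarrow> ('d::finite \<Rightarrow> 'h \<Rightarrow> 'h) \<Rightarrow> 'h ^ 'd \<Rightarrow> 'h ^ 'd"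
  where "defect_op H T = sqrt_op (copies H)
    (\<lambda>x. \<chi> i. \<Sum>j\<in>UNIV. (if i = j then x $ j else 0) - adj H (T i) (T j (x $ j)))"

definition defect_space ::
    "'h::complex_hilbert set \<Rightarrow> ('d::finite \<Rightarrow> 'h \<Rightarrow> 'h) \<Rightarrow> ('h ^ 'd) set"
  where "defect_space H T = closure (defect_op H T ` copies H)"

definition defect ::
    "'h::complex_hilbert set \<Rightarrow> ('d::finite \<Rightarrow> 'h \<Rightarrow> 'h) \<Rightarrow> ('h ^ 'd) rel"
  where "defect H T = hilbert_dim (defect_space H T)"

definition contractive_lifting ::
    "'c::complex_hilbert set \<Rightarrow> ('d::finite \<Rightarrow> 'c \<Rightarrow> 'c) \<Rightarrow>
     'a::complex_hilbert set \<Rightarrow> ('d \<Rightarrow> 'c \<times> 'a \<Rightarrow> 'c \<times> 'a) \<Rightarrow> bool"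
  where "contractive_lifting HC C HA E \<longleftrightarrow>
    closed_csubspace HA \<and> row_contraction (HC \<times> HA) E \<and>
    (\<exists>B A. (\<forall>j. bounded_op HC HA (B j) \<and> bounded_op HA HA (A j)) \<and>
      (\<forall>j. \<forall>h\<in>HC. \<forall>a\<in>HA. E j (h, a) = (C j h, B j h + A j a)))"

definition minimal_lifting ::
    "'c::complex_hilbert set \<Rightarrow> 'a::complex_hilbert set \<Rightarrow> ('d \<Rightarrow> 'c \<times> 'a \<Rightarrow> 'c \<times> 'a) \<Rightarrow> bool"
  where "minimal_lifting HC HA E \<longleftrightarrow>
    (\<forall>K. closed_csubspace K \<and> K \<subseteq> HC \<times> HA \<and> HC \<times> {0} \<subseteq> K \<and> (\<forall>j. E j ` K \<subseteq> K)
      \<longrightarrow> K = HC \<times> HA)"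

definition minimal_contractive_lifting ::
    "'c::complex_hilbert set \<Rightarrow> ('d::finite \<Rightarrow> 'c \<Rightarrow> 'c) \<Rightarrow>
     'a::complex_hilbert set \<Rightarrow> ('d \<Rightarrow> 'c \<times> 'a \<Rightarrow> 'c \<times> 'a) \<Rightarrow> bool"
  where "minimal_contractive_lifting HC C HA E \<longleftrightarrow>
    contractive_lifting HC C HA E \<and> minimal_lifting HC HA E"

definition lifting_equiv ::
    "'c::complex_hilbert set \<Rightarrow>
     'a::complex_hilbert set \<Rightarrow> ('d \<Rightarrow> 'c \<times> 'a \<Rightarrow> 'c \<times> 'a) \<Rightarrow>
     'b::complex_hilbert set \<Rightarrow> ('d \<Rightarrow> 'c \<times> 'b \<Rightarrow> 'c \<times> 'b) \<Rightarrow> bool"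
  where "lifting_equiv HC HA E HA' E' \<longleftrightarrow>
    (\<exists>u. unitary_op (HC \<times> HA) (HC \<times> HA') u \<and>
      (\<forall>j. \<forall>x\<in>HC \<times> HA. u (E j x) = E' j (u x)) \<and> (\<forall>h\<in>HC. u (h, 0) = (h, 0)))"


section \<open>The minimal isometric dilation\<close>

definition min_dilation ::
    "'h::complex_hilbert set \<Rightarrow> ('d::finite \<Rightarrow> 'h \<Rightarrow> 'h) \<Rightarrow>
     'd \<Rightarrow> 'h \<times> ('d, 'h ^ 'd) fock \<Rightarrow> 'h \<times> ('d, 'h ^ 'd) fock"
  where "min_dilation H T j = (\<lambda>(h, \<eta>).
    (T j h, vacuum \<otimes> defect_op H T (axis j h) + creation j \<eta>))"

text \<open>
  Below, \<open>V\<close> is an isometric dilation of \<open>T\<close> on a space in which \<open>H\<close> sits via the isometric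
  embedding \<open>emb\<close>. For a word \<open>\<alpha>\<close>, the operator \<open>V\<^sub>\<alpha>\<close> is \<^term>\<open>foldr V \<alpha>\<close>.
\<close>

definition wandering ::
    "'h set \<Rightarrow> ('h \<Rightarrow> 'k::complex_hilbert) \<Rightarrow> ('d \<Rightarrow> 'k \<Rightarrow> 'k) \<Rightarrow> 'k set"
  where "wandering H emb V = closed_cspan (emb ` H \<union> (\<Union>j. V j ` emb ` H)) \<ominus> emb ` H"

definition wandering_sum ::
    "'h set \<Rightarrow> ('h \<Rightarrow> 'k::complex_hilbert) \<Rightarrow> ('d \<Rightarrow> 'k \<Rightarrow> 'k) \<Rightarrow> 'k set"
  where "wandering_sum H emb V = closed_cspan (\<Union>\<alpha>. foldr V \<alpha> ` wandering H emb V)"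

definition kappa ::
    "'h::complex_hilbert set \<Rightarrow> ('d::finite \<Rightarrow> 'h \<Rightarrow> 'h) \<Rightarrow> ('h \<Rightarrow> 'k::complex_hilbert) \<Rightarrow>
     ('d \<Rightarrow> 'k \<Rightarrow> 'k) \<Rightarrow> 'h ^ 'd \<Rightarrow> 'k"
  where "kappa H T emb V = (SOME \<kappa>.
    unitary_op (defect_space H T) (wandering H emb V) \<kappa> \<and>
    (\<forall>\<xi>\<in>copies H. \<kappa> (defect_op H T \<xi>) = (\<Sum>i\<in>UNIV. V i (emb (\<xi> $ i)) - emb (T i (\<xi> $ i)))))"

definition Kappa ::
    "'h::complex_hilbert set \<Rightarrow> ('d::finite \<Rightarrow> 'h \<Rightarrow> 'h) \<Rightarrow> ('h \<Rightarrow> 'k::complex_hilbert) \<Rightarrow>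
     ('d \<Rightarrow> 'k \<Rightarrow> 'k) \<Rightarrow> ('d, 'h ^ 'd) fock \<Rightarrow> 'k"
  where "Kappa H T emb V = (SOME K.
    unitary_op (Fock (defect_space H T)) (wandering_sum H emb V) K \<and>
    (\<forall>\<alpha>. \<forall>\<delta>\<in>defect_space H T.
      K (foldr creation \<alpha> (vacuum \<otimes> \<delta>)) = foldr V \<alpha> (kappa H T emb V \<delta>)))"


section \<open>From contractive multi-analytic operators to contractive liftings\<close>

definition Delta ::
    "'a::complex_hilbert set \<Rightarrow> (('d, 'a) fock \<Rightarrow> ('d, 'b::complex_hilbert) fock) \<Rightarrow>
     ('d, 'a) fock \<Rightarrow> ('d, 'a) fock"
  where "Delta D M = sqrt_op (Fock D) (\<lambda>\<xi>. \<xi> - adj (Fock D) M (M \<xi>))"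

definition model_space ::
    "'b::complex_hilbert set \<Rightarrow> 'a::complex_hilbert set \<Rightarrow> (('d, 'a) fock \<Rightarrow> ('d, 'b) fock) \<Rightarrow>
     (('d, 'b) fock \<times> ('d, 'a) fock) set"
  where "model_space L D M = Fock L \<times> closure (Delta D M ` Fock D)"

text \<open>The defining formula determines \<open>V\<^sub>j\<close> on a dense subspace, hence on all of \<open>H\<^sub>\<Theta>\<close>.\<close>

definition model_shift ::
    "'b::complex_hilbert set \<Rightarrow> 'a::complex_hilbert set \<Rightarrow> (('d, 'a) fock \<Rightarrow> ('d, 'b) fock) \<Rightarrow>
     'd \<Rightarrow> ('d, 'b) fock \<times> ('d, 'a) fock \<Rightarrow> ('d, 'b) fock \<times> ('d, 'a) fock"
  where "model_shift L D M j = (SOME V.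
    bounded_op (model_space L D M) (model_space L D M) V \<and>
    (\<forall>\<eta>\<in>Fock L. \<forall>\<xi>\<in>Fock D. V (\<eta>, Delta D M \<xi>) = (creation j \<eta>, Delta D M (creation j \<xi>))))"

definition model_residual ::
    "'b::complex_hilbert set \<Rightarrow> 'a::complex_hilbert set \<Rightarrow> (('d, 'a) fock \<Rightarrow> ('d, 'b) fock) \<Rightarrow>
     (('d, 'b) fock \<times> ('d, 'a) fock) set"
  where "model_residual L D M = model_space L D M \<ominus> (\<lambda>\<xi>. (M \<xi>, Delta D M \<xi>)) ` Fock D"

text \<open>
  The row isometry on \<open>H\<^sub>C \<oplus> H\<^sub>\<Theta>\<close>: for \<open>h = 0\<close> it is \<^term>\<open>model_shift\<close>, since
  \<^term>\<open>min_dilation\<close> acts on the Fock space component as \<^term>\<open>creation j\<close>, and for \<open>\<zeta> = 0\<close> it is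
  \<^term>\<open>min_dilation\<close>.
\<close>

definition coupled_shift ::
    "'c::complex_hilbert set \<Rightarrow> ('d::finite \<Rightarrow> 'c \<Rightarrow> 'c) \<Rightarrow>
     'a::complex_hilbert set \<Rightarrow> (('d, 'a) fock \<Rightarrow> ('d, 'c ^ 'd) fock) \<Rightarrow>
     'd \<Rightarrow> 'c \<times> ('d, 'c ^ 'd) fock \<times> ('d, 'a) fock \<Rightarrow> 'c \<times> ('d, 'c ^ 'd) fock \<times> ('d, 'a) fock"
  where "coupled_shift HC C D M j = (\<lambda>(h, \<eta>, \<zeta>).
    let (h', \<eta>') = min_dilation HC C j (h, \<eta>)
    in (h', (\<eta>', 0) + model_shift (defect_space HC C) D M j (0, \<zeta>)))"

text \<open>
  The map \<open>\<E>\<close>: the lifting \<open>calE HC C D M\<close> lives on \<open>H\<^sub>C \<oplus> H\<^sub>A\<close> with \<open>H\<^sub>A = calE_space HC C D M\<close>.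
\<close>

definition calE_space ::
    "'c::complex_hilbert set \<Rightarrow> ('d::finite \<Rightarrow> 'c \<Rightarrow> 'c) \<Rightarrow>
     'a::complex_hilbert set \<Rightarrow> (('d, 'a) fock \<Rightarrow> ('d, 'c ^ 'd) fock) \<Rightarrow>
     (('d, 'c ^ 'd) fock \<times> ('d, 'a) fock) set"
  where "calE_space HC C D M = model_residual (defect_space HC C) D M"

definition calE ::
    "'c::complex_hilbert set \<Rightarrow> ('d::finite \<Rightarrow> 'c \<Rightarrow> 'c) \<Rightarrow>
     'a::complex_hilbert set \<Rightarrow> (('d, 'a) fock \<Rightarrow> ('d, 'c ^ 'd) fock) \<Rightarrow>
     'd \<Rightarrow> 'c \<times> ('d, 'c ^ 'd) fock \<times> ('d, 'a) fock \<Rightarrow> 'c \<times> ('d, 'c ^ 'd) fock \<times> ('d, 'a) fock"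
  where "calE HC C D M j x = proj (HC \<times> calE_space HC C D M) (coupled_shift HC C D M j x)"


section \<open>From contractive liftings to contractive multi-analytic operators\<close>

text \<open>The map \<open>\<M>\<close>; \<open>V\<close> is the minimal isometric dilation of the lifting \<open>E\<close> of \<open>C\<close>.\<close>

definition calM ::
    "'c::complex_hilbert set \<Rightarrow> ('d::finite \<Rightarrow> 'c \<Rightarrow> 'c) \<Rightarrow>
     'a::complex_hilbert set \<Rightarrow> ('d \<Rightarrow> 'c \<times> 'a \<Rightarrow> 'c \<times> 'a) \<Rightarrow>
     ('d, ('c \<times> 'a) ^ 'd) fock \<Rightarrow> ('d, 'c ^ 'd) fock"
  where "calM HC C HA E = (
    let V = min_dilation (HC \<times> HA) E;
        embE = (\<lambda>x. (x, 0));
        embC = (\<lambda>h. ((h, 0), 0));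
        KE = Kappa (HC \<times> HA) E embE V;
        KC = Kappa HC C embC V
    in (\<lambda>\<xi>. adj (Fock (defect_space HC C)) KC (proj (wandering_sum HC embC V) (KE \<xi>))))"

end

theory Submission
  imports Defs
begin

text \<open>
  A lifting and its characteristic operator are two views of one object, a \<^emph>\<open>coupling\<close>: a row
  isometry \<open>V\<close> on a space generated by copies of \<open>H\<^sub>C\<close>, \<open>\<Gamma> \<otimes> D\<^sub>C\<close> and \<open>\<Gamma> \<otimes> D\<close>, of which
  the first two form the minimal isometric dilation of \<open>C\<close> and the last one is \<open>V\<close>-invariant and
  orthogonal to \<open>H\<^sub>C\<close>. The cross Gramian of \<open>\<Gamma> \<otimes> D\<^sub>C\<close> and \<open>\<Gamma> \<otimes> D\<close> is the multi-analytic operator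
  \<open>M\<close>, and the compression of \<open>V\<close> to the orthogonal complement of \<open>\<Gamma> \<otimes> D\<close> is the lifting. The minimal
  isometric dilation of a minimal lifting \<open>E\<close> is a coupling with \<open>M = \<M>(E)\<close>, and the model space of
  \<open>M\<close> is a coupling whose compression is \<open>\<E>(M)\<close>.

  Since inner products of generators are expressed by \<open>M\<close>, the coupling is determined by \<open>M\<close> up to
  unitary equivalence, and so is its compression. Conversely, the compression determines the coupling
  if the symbol is injective: a vector of \<open>D\<close> orthogonal to all defects \<open>V\<^sub>j x - T\<^sub>j x\<close> is
  orthogonal to \<open>\<Gamma> \<otimes> D\<^sub>C\<close>, hence annihilated by the symbol, so \<open>D\<close> is the defect space of
  the compression.
\<close>

section \<open>Inner products, closed subspaces and projections\<close>

text \<open>Operators prescribed only on generators come into existence by one device: two families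
  with equal Gram matrices are related by a unitary between their closed spans. Accordingly
  \<open>defect_op\<close> and \<open>Delta\<close> enter through their Gram identities, of the form
  <x, y> - <T x, T y>. Minimality of a lifting is used twice. It makes the copies of H_C, \<Gamma>
  \<otimes> D_C and \<Gamma> \<otimes> D generate the dilation space, and it makes the symbol
  injective: if M annihilates vacuum \<otimes> \<delta>, this vector is orthogonal to H_C and to
  \<Gamma> \<otimes> D_C, hence to all V-words applied to H_C. The x in H_E all of whose V-words are
  orthogonal to it form a closed subspace containing H_C. It is invariant under E, because V_j x and
  E_j x differ by a vacuum vector, which every further letter moves off the vacuum level. So this
  subspace is H_E, and \<delta>, being orthogonal to all defects, vanishes.\<close>

lemma cinner_zero_right [simp]: "cinner x (0::'a::complex_hilbert) = 0"
  using cinner_add_right [of x 0 0] by simp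

lemma cinner_zero_left [simp]: "cinner (0::'a::complex_hilbert) x = 0"
  using cinner_add_left [of 0 0 x] by simp

lemma cinner_minus_right [simp]: "cinner x (- y) = - cinner x (y::'a::complex_hilbert)"
  using cinner_add_right [of x y "- y"] by (simp add: eq_neg_iff_add_eq_0 add.commute)

lemma cinner_minus_left [simp]: "cinner (- x) y = - cinner x (y::'a::complex_hilbert)"
  using cinner_add_left [of x "- x" y] by (simp add: eq_neg_iff_add_eq_0 add.commute)

lemma cinner_diff_right: "cinner x (y - z) = cinner x y - cinner x (z::'a::complex_hilbert)"
  using cinner_add_right [of x y "- z"] by simp

lemma cinner_diff_left: "cinner (x - y) z = cinner x z - cinner y (z::'a::complex_hilbert)"
  using cinner_add_left [of x "- y" z] by simp

lemma cinner_sum_right: "cinner x (\<Sum>i\<in>I. f i) = (\<Sum>i\<in>I. cinner x (f i :: 'a::complex_hilbert))"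
  by (induction I rule: infinite_finite_induct) (simp_all add: cinner_add_right)

lemma cinner_sum_left: "cinner (\<Sum>i\<in>I. f i) x = (\<Sum>i\<in>I. cinner (f i) (x :: 'a::complex_hilbert))"
  by (induction I rule: infinite_finite_induct) (simp_all add: cinner_add_left)

lemmas cinner_simps = cinner_add_left cinner_add_right cinner_diff_left cinner_diff_right
  cinner_scaleC_left cinner_scaleC_right

lemma cinner_scaleR_right: "cinner x (r *\<^sub>R y) = complex_of_real r * cinner x (y::'a::complex_hilbert)"
  by (metis scaleC_of_real cinner_scaleC_right)

lemma cinner_scaleR_left: "cinner (r *\<^sub>R x) y = complex_of_real r * cinner x (y::'a::complex_hilbert)"
  by (metis scaleC_of_real cinner_scaleC_left complex_cnj_complex_of_real)

lemma scaleC_one [simp]: "1 *\<^sub>C x = (x::'a::complex_hilbert)"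
  using scaleC_of_real [of 1 x] by simp

lemma scaleC_zero_left [simp]: "0 *\<^sub>C x = (0::'a::complex_hilbert)"
  using scaleC_of_real [of 0 x] by simp

lemma scaleC_zero_right [simp]: "a *\<^sub>C (0::'a::complex_hilbert) = 0"
  using scaleC_add_right [of a 0 0] by simp

lemma scaleC_minus_one: "(- 1) *\<^sub>C x = - (x::'a::complex_hilbert)"
  using scaleC_of_real [of "- 1" x] by simp

lemma scaleC_minus_right [simp]: "a *\<^sub>C (- x) = - (a *\<^sub>C (x::'a::complex_hilbert))"
  by (metis scaleC_minus_one scaleC_scaleC mult.commute)

lemma scaleC_diff_right: "a *\<^sub>C (x - y) = a *\<^sub>C x - a *\<^sub>C (y::'a::complex_hilbert)"
  using scaleC_add_right [of a x "- y"] by simp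

lemma scaleC_sum_right: "a *\<^sub>C (\<Sum>i\<in>I. f i) = (\<Sum>i\<in>I. a *\<^sub>C (f i :: 'a::complex_hilbert))"
  by (induction I rule: infinite_finite_induct) (simp_all add: scaleC_add_right)

lemma cinner_self_norm: "cinner x x = complex_of_real ((norm (x::'a::complex_hilbert))\<^sup>2)"
  by (simp add: cinner_self power2_norm_eq_inner)

lemma cinner_self_eq_0 [simp]: "cinner x x = 0 \<longleftrightarrow> (x::'a::complex_hilbert) = 0"
  by (simp add: cinner_self)

lemma cinner_eq_0_commute: "cinner x y = 0 \<longleftrightarrow> cinner y (x::'a::complex_hilbert) = 0"
  by (metis cinner_commute complex_cnj_zero)

lemma norm_eq_of_cinner:
  "cinner x x = cinner y y \<Longrightarrow> norm (x::'a::complex_hilbert) = norm (y::'b::complex_hilbert)"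
  by (metis cinner_self norm_eq_sqrt_inner of_real_eq_iff)

lemma cmod_cinner_le: "cmod (cinner x y) \<le> norm x * norm (y::'a::complex_hilbert)"
proof (cases "cinner x y = 0")
  case False
  \<comment> \<open>The unimodular phase that turns \<open>cinner x y\<close> into its modulus, so
    that the real Cauchy-Schwarz inequality applies.\<close>
  define a where "a = cnj (cinner x y) / cmod (cinner x y)"
  have "cinner x (a *\<^sub>C y) = cmod (cinner x y)"
    using False by (simp add: a_def cinner_scaleC_right mult.commute complex_norm_square [symmetric]
      power2_eq_square)
  then have "cmod (cinner x y) = inner x (a *\<^sub>C y)"
    by (metis Re_cinner Re_complex_of_real)
  also have "\<dots> \<le> norm x * norm (a *\<^sub>C y)"
    by (rule norm_cauchy_schwarz)
  also have "norm (a *\<^sub>C y) = norm y"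
    using False by (simp add: norm_scaleC a_def norm_divide)
  finally show ?thesis .
qed simp

text \<open>Antilinearity in the first argument is invisible to real scalars, so the limit and
  continuity rules for real bilinear maps become available.\<close>

lemma bounded_bilinear_cinner:
  "bounded_bilinear (cinner :: 'a::complex_hilbert \<Rightarrow> 'a \<Rightarrow> complex)"
proof
  show "\<exists>K. \<forall>a b::'a. cmod (cinner a b) \<le> norm a * norm b * K"
    by (rule exI [of _ 1]) (simp add: cmod_cinner_le)
qed (simp_all add: cinner_simps cinner_scaleR_left cinner_scaleR_right scaleR_conv_of_real)

lemmas continuous_on_cinner [continuous_intros] =
  bounded_bilinear.continuous_on [OF bounded_bilinear_cinner]

lemma bounded_linear_scaleC: "bounded_linear (\<lambda>x::'a::complex_hilbert. a *\<^sub>C x)"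
  by (rule bounded_linear_intro [of _ "cmod a"])
    (simp_all add: scaleC_add_right scaleC_of_real [symmetric] scaleC_scaleC norm_scaleC mult.commute)

section \<open>Closed subspaces and closed spans\<close>

lemma csubspaceI:
  assumes "0 \<in> X" "\<And>x y. x \<in> X \<Longrightarrow> y \<in> X \<Longrightarrow> x + y \<in> X" "\<And>a x. x \<in> X \<Longrightarrow> a *\<^sub>C x \<in> X" "closed X"
  shows "closed_csubspace X"
  using assms by (auto simp: closed_csubspace_def)

context
  fixes X :: "'a::complex_hilbert set"
  assumes X: "closed_csubspace X"
begin

lemma csubspace_0: "0 \<in> X"
  and csubspace_add: "x \<in> X \<Longrightarrow> y \<in> X \<Longrightarrow> x + y \<in> X"
  and csubspace_scaleC: "x \<in> X \<Longrightarrow> a *\<^sub>C x \<in> X"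
  and csubspace_closed: "closed X"
  using X by (auto simp: closed_csubspace_def)

lemma csubspace_scaleR: "x \<in> X \<Longrightarrow> r *\<^sub>R x \<in> X"
  by (metis csubspace_scaleC scaleC_of_real)

lemma csubspace_uminus: "x \<in> X \<Longrightarrow> - x \<in> X"
  by (metis csubspace_scaleC scaleC_minus_one)

lemma csubspace_diff: "x \<in> X \<Longrightarrow> y \<in> X \<Longrightarrow> x - y \<in> X"
  using csubspace_add [of x "- y"] csubspace_uminus by simp

lemma csubspace_sum: "(\<And>i. i \<in> I \<Longrightarrow> f i \<in> X) \<Longrightarrow> (\<Sum>i\<in>I. f i) \<in> X"
  by (induction I rule: infinite_finite_induct) (auto simp: csubspace_0 csubspace_add)

lemma closed_csubspace_ortho_diff: "closed_csubspace (X \<ominus> Y)"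
proof (rule csubspaceI)
  have "X \<ominus> Y = X \<inter> (\<Inter>y\<in>Y. {x. cinner y x = 0})"
    by (auto simp: ortho_diff_def)
  moreover have "closed {x. cinner y x = 0}" for y :: 'a
    by (intro closed_Collect_eq continuous_intros)
  ultimately show "closed (X \<ominus> Y)"
    by (auto intro!: closed_Int closed_INT csubspace_closed)
qed (auto simp: ortho_diff_def csubspace_0 csubspace_add csubspace_scaleC cinner_simps)

end

lemma closed_csubspace_INT: "(\<And>i. closed_csubspace (X i)) \<Longrightarrow> closed_csubspace (\<Inter>i. X i)"
  by (auto simp: closed_csubspace_def)

lemma closed_csubspace_cspan [simp]: "closed_csubspace (closed_cspan S)"
  by (rule hull_in) (auto simp: closed_csubspace_def intro!: closed_Inter)

lemma closed_csubspace_UNIV: "closed_csubspace UNIV"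
  by (simp add: closed_csubspace_def)

lemma closed_csubspace_Times:
  "closed_csubspace X \<Longrightarrow> closed_csubspace Y \<Longrightarrow> closed_csubspace (X \<times> Y)"
  by (auto simp: closed_csubspace_def zero_prod_def scaleC_prod_def intro!: closed_Times)

lemma closed_csubspace_singleton: "closed_csubspace {0}"
  by (auto simp: closed_csubspace_def)

lemma closed_csubspace_copies:
  fixes H :: "'a::complex_hilbert set"
  assumes "closed_csubspace H"
  shows "closed_csubspace (copies H :: ('a ^ 'd::finite) set)"
proof (rule csubspaceI)
  have "copies H = (\<Inter>i. (\<lambda>x :: 'a ^ 'd. x $ i) -` H)"
    by (auto simp: copies_def)
  moreover have "closed ((\<lambda>x :: 'a ^ 'd. x $ i) -` H)" for i
    by (intro closed_vimage csubspace_closed assms) (intro continuous_intros)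
  ultimately show "closed (copies H :: ('a ^ 'd) set)"
    by auto
qed (use assms in \<open>auto simp: copies_def scaleC_vec_def csubspace_0 csubspace_add csubspace_scaleC\<close>)

lemma cspan_subset: "S \<subseteq> X \<Longrightarrow> closed_csubspace X \<Longrightarrow> closed_cspan S \<subseteq> X"
  by (rule hull_minimal)

lemma cspan_inc: "x \<in> S \<Longrightarrow> x \<in> closed_cspan S"
  by (rule hull_inc)

text \<open>The orthogonal complement of \<open>x\<close> is a closed subspace. Mostly applied with
  y = x, to show that a vector orthogonal to generators of a space containing it vanishes.\<close>

lemma cinner_cspan_eq_0:
  assumes "\<And>s. s \<in> S \<Longrightarrow> cinner s x = 0" and "y \<in> closed_cspan S"
  shows "cinner y x = 0"
proof -
  have "closed_csubspace {y. cinner y x = 0}"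
    by (rule csubspaceI) (auto simp: cinner_simps intro!: closed_Collect_eq continuous_intros)
  then show ?thesis
    using cspan_subset [of S "{y. cinner y x = 0}"] assms by auto
qed

text \<open>A minimizing sequence is Cauchy by the parallelogram law; its limit is a nearest point,
  and minimality along each line through that point gives orthogonality.\<close>

lemma exists_orthogonal_projection:
  fixes X :: "'a::complex_hilbert set"
  assumes X: "closed_csubspace X"
  shows "\<exists>p\<in>X. \<forall>z\<in>X. cinner z (x - p) = 0"
proof -
  define m where "m = (INF y\<in>X. norm (x - y))"
  have m: "m \<le> norm (x - y)" if "y \<in> X" for y
    unfolding m_def by (rule cINF_lower [OF _ that]) (auto simp: bdd_below_def intro!: exI [of _ 0])
  have m0: "m \<ge> 0"
    unfolding m_def using csubspace_0 [OF X] by (intro cINF_greatest) auto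
  have "\<exists>y\<in>X. norm (x - y) < m + 1 / real (Suc n)" for n
  proof -
    have "(INF y\<in>X. norm (x - y)) < m + 1 / real (Suc n)"
      by (simp add: m_def)
    then show ?thesis
      using csubspace_0 [OF X] by (subst (asm) cINF_less_iff) (auto simp: bdd_below_def intro!: exI [of _ 0])
  qed
  then obtain y where yX: "\<And>n. y n \<in> X" and y: "\<And>n. norm (x - y n) < m + 1 / real (Suc n)"
    by metis
  have lim: "(\<lambda>n. norm (x - y n)) \<longlonglongrightarrow> m"
  proof (rule tendsto_sandwich [OF _ _ tendsto_const])
    have "(\<lambda>n. m + 1 / real (Suc n)) \<longlonglongrightarrow> m + 0"
      by (intro tendsto_add tendsto_const LIMSEQ_inverse_real_of_nat [unfolded inverse_eq_divide])
    then show "(\<lambda>n. m + 1 / real (Suc n)) \<longlonglongrightarrow> m"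
      by simp
  qed (use m yX y in \<open>auto intro!: always_eventually less_imp_le\<close>)
  \<comment> \<open>The midpoint of \<open>y n\<close> and \<open>y k\<close> stays in
    \<open>X\<close>, hence has distance at least \<open>m\<close> from \<open>x\<close>; the
    parallelogram law turns this into the bound.\<close>
  have par: "(norm (y n - y k))\<^sup>2 \<le> 2 * ((norm (x - y n))\<^sup>2 - m\<^sup>2) + 2 * ((norm (x - y k))\<^sup>2 - m\<^sup>2)" for n k
  proof -
    have "(1/2) *\<^sub>R (y n + y k) \<in> X"
      by (intro csubspace_scaleR csubspace_add X yX)
    then have "m\<^sup>2 \<le> (norm (x - (1/2) *\<^sub>R (y n + y k)))\<^sup>2"
      using m m0 by (intro power_mono) auto
    moreover have "(norm (y n - y k))\<^sup>2 = 2 * (norm (x - y n))\<^sup>2 + 2 * (norm (x - y k))\<^sup>2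
        - 4 * (norm (x - (1/2) *\<^sub>R (y n + y k)))\<^sup>2"
      unfolding power2_norm_eq_inner by (simp add: inner_diff inner_add inner_commute algebra_simps)
    ultimately show ?thesis by simp
  qed
  have "Cauchy y"
  proof (rule CauchyI)
    fix e :: real
    assume e: "e > 0"
    have "(\<lambda>n. (norm (x - y n))\<^sup>2 - m\<^sup>2) \<longlonglongrightarrow> m\<^sup>2 - m\<^sup>2"
      by (intro tendsto_intros lim)
    then have "\<forall>\<^sub>F n in sequentially. (norm (x - y n))\<^sup>2 - m\<^sup>2 < e\<^sup>2 / 4"
      by (rule order_tendstoD) (use e in auto)
    then obtain N where N: "\<And>n. n \<ge> N \<Longrightarrow> (norm (x - y n))\<^sup>2 - m\<^sup>2 < e\<^sup>2 / 4"
      by (auto simp: eventually_sequentially)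
    have "norm (y n - y k) < e" if "n \<ge> N" "k \<ge> N" for n k
    proof (rule power2_less_imp_less)
      show "(norm (y n - y k))\<^sup>2 < e\<^sup>2"
        using par [of n k] N [OF that(1)] N [OF that(2)] by argo
    qed (use e in simp)
    then show "\<exists>M. \<forall>m\<ge>M. \<forall>n\<ge>M. norm (y m - y n) < e"
      by blast
  qed
  then obtain p where p: "y \<longlonglongrightarrow> p"
    by (auto simp: Cauchy_convergent_iff convergent_def)
  have pX: "p \<in> X"
    using closed_sequentially [OF csubspace_closed [OF X], of y p] yX p by auto
  have "(\<lambda>n. norm (x - y n)) \<longlonglongrightarrow> norm (x - p)"
    by (intro tendsto_intros p)
  then have pm: "norm (x - p) = m"
    using lim LIMSEQ_unique by blast
  have re: "inner z (x - p) = 0" if z: "z \<in> X" for z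
  proof (cases "z = 0")
    case False
    \<comment> \<open>The real parameter at which the squared distance from \<open>x\<close> to p +
      t z is least.\<close>
    define t where "t = inner z (x - p) / inner z z"
    have "m \<le> norm (x - (p + t *\<^sub>R z))"
      by (intro m csubspace_add csubspace_scaleR X pX z)
    then have "(norm (x - p))\<^sup>2 \<le> (norm (x - (p + t *\<^sub>R z)))\<^sup>2"
      unfolding pm using m0 by (intro power_mono)
    also have "\<dots> = (norm (x - p))\<^sup>2 - 2 * t * inner z (x - p) + t * t * inner z z"
      unfolding power2_norm_eq_inner
      by (simp add: inner_diff inner_add inner_commute algebra_simps)
    also have "\<dots> = (norm (x - p))\<^sup>2 - (inner z (x - p))\<^sup>2 / inner z z"
      using False by (simp add: t_def power2_eq_square)
    finally have "(inner z (x - p))\<^sup>2 / inner z z \<le> 0"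
      by simp
    then show ?thesis
      using False by (simp add: not_less [symmetric] zero_less_divide_iff)
  qed simp
  have "cinner z (x - p) = 0" if "z \<in> X" for z
  proof -
    \<comment> \<open>Only real inner products have been tested so far; multiplying \<open>z\<close>
      by the imaginary unit supplies the imaginary part.\<close>
    have "inner (\<i> *\<^sub>C z) (x - p) = 0"
      by (intro re csubspace_scaleC X that)
    then have "Im (cinner z (x - p)) = 0"
      unfolding Re_cinner [symmetric] by (simp add: cinner_scaleC_left)
    then show ?thesis
      using re [OF that] by (simp add: complex_eq_iff Re_cinner)
  qed
  then show ?thesis
    using pX by blast
qed

text \<open>Two candidates differ by a vector of \<open>X\<close> that is orthogonal to
  \<open>X\<close>. This settles the THE in \<open>proj\<close>, and later projections are computed
  by guessing the result.\<close>

lemma proj_eqI: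
  assumes X: "closed_csubspace X" and p: "p \<in> X" "\<And>z. z \<in> X \<Longrightarrow> cinner z (x - p) = 0"
  shows "proj X x = p"
  unfolding proj_def
proof (rule the_equality)
  fix q
  assume q: "q \<in> X \<and> (\<forall>z\<in>X. cinner z (x - q) = 0)"
  then have "q - p \<in> X"
    using p csubspace_diff [OF X] by auto
  then have "cinner (q - p) (x - p) - cinner (q - p) (x - q) = 0"
    using p q by auto
  then have "cinner (q - p) (q - p) = 0"
    by (simp add: cinner_diff_right algebra_simps)
  then show "q = p"
    by simp
qed (use p in auto)

context
  fixes X :: "'a::complex_hilbert set"
  assumes X: "closed_csubspace X"
begin

lemma proj_in: "proj X x \<in> X"
  and cinner_proj_diff: "z \<in> X \<Longrightarrow> cinner z (x - proj X x) = 0"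
  using exists_orthogonal_projection [OF X, of x] proj_eqI [OF X] by auto

lemma cinner_proj_right: "z \<in> X \<Longrightarrow> cinner z (proj X x) = cinner z x"
  using cinner_proj_diff [of z x] by (simp add: cinner_diff_right)

lemma cinner_proj_left: "z \<in> X \<Longrightarrow> cinner (proj X x) z = cinner x z"
  by (metis cinner_commute cinner_proj_right)

lemma proj_ident: "x \<in> X \<Longrightarrow> proj X x = x"
  by (rule proj_eqI [OF X]) auto

lemma proj_add: "proj X (x + y) = proj X x + proj X y"
  by (rule proj_eqI [OF X])
    (auto simp: cinner_simps cinner_proj_right intro!: csubspace_add [OF X] proj_in)

lemma proj_scaleC: "proj X (a *\<^sub>C x) = a *\<^sub>C proj X x"
  by (rule proj_eqI [OF X])
    (auto simp: cinner_simps cinner_proj_right intro!: csubspace_scaleC [OF X] proj_in)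

lemma norm_proj_le: "norm (proj X x) \<le> norm x"
proof -
  have "(norm (proj X x))\<^sup>2 = Re (cinner (proj X x) (proj X x))"
    by (simp add: cinner_self_norm)
  also have "\<dots> = inner (proj X x) x"
    by (simp add: cinner_proj_right proj_in Re_cinner)
  also have "\<dots> \<le> norm (proj X x) * norm x"
    by (rule norm_cauchy_schwarz)
  finally show ?thesis
    by (cases "proj X x = 0") (auto simp: power2_eq_square)
qed

lemma bounded_op_proj: "bounded_op UNIV X (proj X)"
  by (auto simp: bounded_op_def proj_in proj_add proj_scaleC intro!: exI [of _ 1] norm_proj_le)

text \<open>A density test without limits: the remainder of \<open>x\<close> after projection to the
  span lies in \<open>X\<close> and is orthogonal to \<open>S\<close>.\<close>

lemma cspan_eqI:
  assumes "S \<subseteq> X" and "\<And>x. x \<in> X \<Longrightarrow> (\<And>s. s \<in> S \<Longrightarrow> cinner s x = 0) \<Longrightarrow> x = 0"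
  shows "closed_cspan S = X"
proof
  show sub: "closed_cspan S \<subseteq> X"
    by (rule cspan_subset [OF assms(1) X])
  show "X \<subseteq> closed_cspan S"
  proof
    fix x
    assume x: "x \<in> X"
    let ?p = "proj (closed_cspan S) x"
    have p: "?p \<in> closed_cspan S" "\<And>z. z \<in> closed_cspan S \<Longrightarrow> cinner z (x - ?p) = 0"
      using exists_orthogonal_projection [of "closed_cspan S" x]
      by (auto dest: proj_eqI [OF closed_csubspace_cspan])
    have "x - ?p = 0"
      using p sub x by (intro assms(2) csubspace_diff [OF X]) (auto intro: cspan_inc)
    then show "x \<in> closed_cspan S"
      using p by simp
  qed
qed

end

section \<open>Bounded operators and isometries\<close>

context
  fixes X :: "'a::complex_hilbert set" and Y :: "'b::complex_hilbert set" and T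
  assumes T: "bounded_op X Y T"
begin

lemma bounded_op_in: "x \<in> X \<Longrightarrow> T x \<in> Y"
  and bounded_op_add: "x \<in> X \<Longrightarrow> y \<in> X \<Longrightarrow> T (x + y) = T x + T y"
  and bounded_op_scaleC: "x \<in> X \<Longrightarrow> T (a *\<^sub>C x) = a *\<^sub>C T x"
  using T by (auto simp: bounded_op_def)

lemma bounded_op_bound: "\<exists>K\<ge>0. \<forall>x\<in>X. norm (T x) \<le> K * norm x"
proof -
  obtain K where K: "\<forall>x\<in>X. norm (T x) \<le> K * norm x"
    using T by (auto simp: bounded_op_def)
  have "norm (T x) \<le> max K 0 * norm x" if "x \<in> X" for x
    using K that by (meson max.cobounded1 mult_right_mono norm_ge_zero order_trans)
  then show ?thesis
    by (intro exI [of _ "max K 0"]) auto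
qed

lemma bounded_op_minus: "x \<in> X \<Longrightarrow> T (- x) = - T x"
  by (metis bounded_op_scaleC scaleC_minus_one)

lemma bounded_op_mono: "Y \<subseteq> Z \<Longrightarrow> bounded_op X Z T"
  using T by (auto simp: bounded_op_def)

lemma bounded_op_restrict: "W \<subseteq> X \<Longrightarrow> bounded_op W Y T"
  using T unfolding bounded_op_def by blast

context
  assumes X: "closed_csubspace X"
begin

lemma bounded_op_0: "T 0 = 0"
  using bounded_op_scaleC [OF csubspace_0 [OF X], of 0] by simp

lemma bounded_op_diff: "x \<in> X \<Longrightarrow> y \<in> X \<Longrightarrow> T (x - y) = T x - T y"
  using bounded_op_add [of x "- y"] by (simp add: csubspace_uminus [OF X] bounded_op_minus)

lemma bounded_op_sum: "(\<And>i. i \<in> I \<Longrightarrow> f i \<in> X) \<Longrightarrow> T (\<Sum>i\<in>I. f i) = (\<Sum>i\<in>I. T (f i))"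
  by (induction I rule: infinite_finite_induct)
    (simp_all add: bounded_op_0 bounded_op_add csubspace_sum [OF X])

lemma bounded_op_continuous: "continuous_on X T"
proof -
  obtain K where K: "K \<ge> 0" "\<And>x. x \<in> X \<Longrightarrow> norm (T x) \<le> K * norm x"
    using bounded_op_bound by auto
  have "K-lipschitz_on X T"
  proof (rule lipschitz_onI)
    show "dist (T x) (T y) \<le> K * dist x y" if "x \<in> X" "y \<in> X" for x y
      using K(2) [of "x - y"] that by (simp add: dist_norm bounded_op_diff csubspace_diff [OF X])
  qed (rule K)
  then show ?thesis
    by (rule lipschitz_on_continuous_on)
qed

end

end

lemma bounded_op_comp:
  assumes T: "bounded_op X Y T" and S: "bounded_op Y Z S"
  shows "bounded_op X Z (\<lambda>x. S (T x))"
proof -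
  obtain K where K: "\<And>x. x \<in> X \<Longrightarrow> norm (T x) \<le> K * norm x"
    using bounded_op_bound [OF T] by blast
  obtain L where L: "L \<ge> 0" "\<And>y. y \<in> Y \<Longrightarrow> norm (S y) \<le> L * norm y"
    using bounded_op_bound [OF S] by blast
  have "norm (S (T x)) \<le> (L * K) * norm x" if "x \<in> X" for x
    using L(2) [OF bounded_op_in [OF T that]] mult_left_mono [OF K [OF that] L(1)]
    by (simp add: mult.assoc)
  then show ?thesis
    using S T unfolding bounded_op_def by auto
qed

text \<open>With one variable fixed, the other ranges over a closed subspace. The two sides may take
  values in different spaces, which lets Gram matrices be compared across types.\<close>

lemma cinner_eq_on_cspan:
  fixes f :: "'a::complex_hilbert \<Rightarrow> 'x::complex_hilbert" and g :: "'b::complex_hilbert \<Rightarrow> 'x"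
    and p :: "'a \<Rightarrow> 'y::complex_hilbert" and q :: "'b \<Rightarrow> 'y"
  assumes f: "bounded_op X F f" and p: "bounded_op X P p" and X: "closed_csubspace X" "S \<subseteq> X"
    and g: "bounded_op Y G g" and q: "bounded_op Y Q q" and Y: "closed_csubspace Y" "T \<subseteq> Y"
    and eq: "\<And>s t. s \<in> S \<Longrightarrow> t \<in> T \<Longrightarrow> cinner (f s) (g t) = cinner (p s) (q t)"
    and x: "x \<in> closed_cspan S" and y: "y \<in> closed_cspan T"
  shows "cinner (f x) (g y) = cinner (p x) (q y)"
proof -
  note cf = bounded_op_continuous [OF f X(1)] and cg = bounded_op_continuous [OF g Y(1)]
    and cp = bounded_op_continuous [OF p X(1)] and cq = bounded_op_continuous [OF q Y(1)]
  have 1: "closed_csubspace {y \<in> Y. cinner u (g y) = cinner v (q y)}" for u v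
  proof (rule csubspaceI)
    have "closed (Y \<inter> (\<lambda>y. cinner u (g y) - cinner v (q y)) -` {0})"
      by (rule continuous_closed_preimage)
        (auto intro!: csubspace_closed [OF Y(1)] continuous_intros cg cq)
    also have "Y \<inter> (\<lambda>y. cinner u (g y) - cinner v (q y)) -` {0}
        = {y \<in> Y. cinner u (g y) = cinner v (q y)}"
      by auto
    finally show "closed {y \<in> Y. cinner u (g y) = cinner v (q y)}" .
  qed (auto simp: csubspace_0 [OF Y(1)] csubspace_add [OF Y(1)] csubspace_scaleC [OF Y(1)]
      bounded_op_0 [OF g Y(1)] bounded_op_0 [OF q Y(1)] bounded_op_add [OF g] bounded_op_add [OF q]
      bounded_op_scaleC [OF g] bounded_op_scaleC [OF q] cinner_simps)
  have 2: "closed_csubspace {x \<in> X. cinner (f x) u = cinner (p x) v}" for u v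
  proof (rule csubspaceI)
    have "closed (X \<inter> (\<lambda>x. cinner (f x) u - cinner (p x) v) -` {0})"
      by (rule continuous_closed_preimage)
        (auto intro!: csubspace_closed [OF X(1)] continuous_intros cf cp)
    also have "X \<inter> (\<lambda>x. cinner (f x) u - cinner (p x) v) -` {0}
        = {x \<in> X. cinner (f x) u = cinner (p x) v}"
      by auto
    finally show "closed {x \<in> X. cinner (f x) u = cinner (p x) v}" .
  qed (auto simp: csubspace_0 [OF X(1)] csubspace_add [OF X(1)] csubspace_scaleC [OF X(1)]
      bounded_op_0 [OF f X(1)] bounded_op_0 [OF p X(1)] bounded_op_add [OF f] bounded_op_add [OF p]
      bounded_op_scaleC [OF f] bounded_op_scaleC [OF p] cinner_simps)
  have "cinner (f s) (g y) = cinner (p s) (q y)" if "s \<in> S" for s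
    using cspan_subset [OF _ 1 [of "f s" "p s"], of T] eq [OF that] Y y by auto
  then show ?thesis
    using cspan_subset [OF _ 2 [of "g y" "q y"], of S] X x by auto
qed

lemma closed_csubspace_vimage:
  assumes f: "bounded_op X Y f" and X: "closed_csubspace X" and Z: "closed_csubspace Z"
  shows "closed_csubspace {x \<in> X. f x \<in> Z}"
proof (rule csubspaceI)
  have "closed (X \<inter> f -` Z)"
    by (intro continuous_closed_preimage bounded_op_continuous [OF f X] csubspace_closed X Z)
  also have "X \<inter> f -` Z = {x \<in> X. f x \<in> Z}"
    by auto
  finally show "closed {x \<in> X. f x \<in> Z}" .
qed (auto simp: csubspace_0 [OF X] csubspace_add [OF X] csubspace_scaleC [OF X] csubspace_0 [OF Z]
      csubspace_add [OF Z] csubspace_scaleC [OF Z] bounded_op_0 [OF f X] bounded_op_add [OF f]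
      bounded_op_scaleC [OF f])

lemma bounded_op_maps_cspan:
  assumes f: "bounded_op X Y f" and X: "closed_csubspace X" "S \<subseteq> X" and Z: "closed_csubspace Z"
    and "\<And>s. s \<in> S \<Longrightarrow> f s \<in> Z" and "x \<in> closed_cspan S"
  shows "f x \<in> Z"
  using cspan_subset [OF _ closed_csubspace_vimage [OF f X(1) Z], of S] assms by auto

lemma bounded_op_eq_on_cspan:
  assumes f: "bounded_op X F f" and g: "bounded_op X G g" and X: "closed_csubspace X" "S \<subseteq> X"
    and eq: "\<And>s. s \<in> S \<Longrightarrow> f s = g s" and x: "x \<in> closed_cspan S"
  shows "f x = g x"
proof -
  have id: "bounded_op UNIV UNIV (\<lambda>x. x)"
    by (auto simp: bounded_op_def intro!: exI [of _ 1])
  have "cinner (f x) z = cinner (g x) z" for z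
    by (rule cinner_eq_on_cspan [OF f g X id id closed_csubspace_UNIV, of UNIV])
      (use eq x in \<open>auto simp: hull_UNIV\<close>)
  then have "cinner (f x - g x) (f x - g x) = 0"
    by (simp add: cinner_diff_left)
  then show ?thesis
    by simp
qed

text \<open>Riesz representation of z |-> <T z, y>: the functional is carried by a single vector
  \<open>w\<close> orthogonal to its kernel \<open>N\<close>.\<close>

lemma adjoint_exists:
  assumes T: "bounded_op X Y T" and X: "closed_csubspace X"
  shows "\<exists>x\<in>X. \<forall>z\<in>X. cinner z x = cinner (T z) y"
proof -
  define N where "N = {z \<in> X. cinner (T z) y = 0}"
  have zero: "bounded_op X {0} (\<lambda>z. 0)"
    by (auto simp: bounded_op_def intro!: exI [of _ 0])
  have N: "closed_csubspace N"
  proof -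
    have "N = {z \<in> X. T z \<in> UNIV \<ominus> {y}}"
      by (auto simp: N_def ortho_diff_def cinner_eq_0_commute [of y])
    then show ?thesis
      using closed_csubspace_vimage [OF T X]
      by (simp add: closed_csubspace_ortho_diff closed_csubspace_UNIV)
  qed
  show ?thesis
  proof (cases "N = X")
    case True
    then show ?thesis
      by (intro bexI [of _ 0]) (auto simp: N_def csubspace_0 [OF X])
  next
    case False
    then obtain x where x: "x \<in> X" "x \<notin> N"
      by (auto simp: N_def)
    define w where "w = x - proj N x"
    have pX: "proj N x \<in> X"
      using proj_in [OF N] by (simp add: N_def)
    have wX: "w \<in> X"
      unfolding w_def by (intro csubspace_diff X x pX)
    have w0: "w \<noteq> 0"
      using x proj_in [OF N, of x] by (auto simp: w_def)
    have orth: "cinner z w = 0" if "z \<in> N" for z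
      using cinner_proj_diff [OF N that] by (simp add: w_def)
    have Tw: "cinner (T w) y \<noteq> 0"
    proof
      assume "cinner (T w) y = 0"
      then have "w \<in> N"
        using wX by (simp add: N_def)
      then show False
        using orth w0 by force
    qed
    \<comment> \<open>Chosen so that both sides agree at z = w.\<close>
    define a where "a = cinner (T w) y / cinner w w"
    have "cinner z (a *\<^sub>C w) = cinner (T z) y" if z: "z \<in> X" for z
    proof -
      \<comment> \<open>Subtracting this multiple of \<open>w\<close> moves \<open>z\<close> into
        the kernel; the conjugate is due to antilinearity in the first argument.\<close>
      define b where "b = cnj (cinner (T z) y / cinner (T w) y)"
      have "z - b *\<^sub>C w \<in> N"
        using Tw z wX by (simp add: N_def csubspace_diff X csubspace_scaleC bounded_op_diff [OF T X]
            bounded_op_scaleC [OF T] cinner_simps b_def)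
      then have "cinner (z - b *\<^sub>C w) w = 0"
        by (rule orth)
      then have "cinner z w = cnj b * cinner w w"
        by (simp add: cinner_simps)
      then show ?thesis
        using Tw w0 by (simp add: cinner_simps a_def b_def)
    qed
    then show ?thesis
      using csubspace_scaleC [OF X wX] by blast
  qed
qed

lemma adj_eqI:
  assumes X: "closed_csubspace X" and x: "x \<in> X" "\<And>z. z \<in> X \<Longrightarrow> cinner z x = cinner (T z) y"
  shows "adj X T y = x"
  unfolding adj_def
proof (rule the_equality)
  fix w
  assume w: "w \<in> X \<and> (\<forall>z\<in>X. cinner z w = cinner (T z) y)"
  then have "w - x \<in> X"
    using x csubspace_diff [OF X] by auto
  then have "cinner (w - x) (w - x) = 0"
    using w x by (subst cinner_diff_right) auto
  then show "w = x"
    by simp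
qed (use x in auto)

context
  fixes X :: "'a::complex_hilbert set" and Y :: "'b::complex_hilbert set" and T
  assumes T: "bounded_op X Y T" and X: "closed_csubspace X"
begin

lemma adj_in: "adj X T y \<in> X"
  and cinner_adj_right: "z \<in> X \<Longrightarrow> cinner z (adj X T y) = cinner (T z) y"
  using adjoint_exists [OF T X, of y] adj_eqI [OF X] by auto

lemma cinner_adj_left: "z \<in> X \<Longrightarrow> cinner (adj X T y) z = cinner y (T z)"
  by (metis cinner_commute cinner_adj_right)

text \<open>Linearity follows from uniqueness of the representing vector. The domain is the whole
  type because \<open>adj\<close> does not refer to a codomain.\<close>

lemma bounded_op_adj: "bounded_op UNIV X (adj X T)"
proof -
  obtain K where K: "K \<ge> 0" "\<And>x. x \<in> X \<Longrightarrow> norm (T x) \<le> K * norm x"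
    using bounded_op_bound [OF T] by auto
  have "norm (adj X T y) \<le> K * norm y" for y
  proof -
    let ?a = "adj X T y"
    have "(norm ?a)\<^sup>2 = Re (cinner ?a ?a)"
      by (simp add: cinner_self_norm)
    also have "\<dots> = inner (T ?a) y"
      by (simp add: cinner_adj_right adj_in Re_cinner)
    also have "\<dots> \<le> norm (T ?a) * norm y"
      by (rule norm_cauchy_schwarz)
    also have "\<dots> \<le> K * norm ?a * norm y"
      by (intro mult_right_mono K adj_in) auto
    finally show ?thesis
      using K by (cases "?a = 0") (auto simp: power2_eq_square)
  qed
  then show ?thesis
    by (auto simp: bounded_op_def adj_in intro!: exI [of _ K] adj_eqI [OF X] csubspace_add [OF X]
        csubspace_scaleC [OF X] simp: cinner_simps cinner_adj_right)
qed

end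

section \<open>Isometries, and unitaries from Gram matrices\<close>

definition isom :: "'a::complex_hilbert set \<Rightarrow> ('a \<Rightarrow> 'b::complex_hilbert) \<Rightarrow> bool"
  where "isom X f \<longleftrightarrow> (\<forall>x\<in>X. \<forall>y\<in>X. cinner (f x) (f y) = cinner x y)"

lemma isomD: "isom X f \<Longrightarrow> x \<in> X \<Longrightarrow> y \<in> X \<Longrightarrow> cinner (f x) (f y) = cinner x y"
  by (simp add: isom_def)

lemma isom_norm: "isom X f \<Longrightarrow> x \<in> X \<Longrightarrow> norm (f x) = norm x"
  by (rule norm_eq_of_cinner) (simp add: isomD)

text \<open>Linearity is automatic: the norms of \<open>f (x + y) - f x - f y\<close> and \<open>f (a x) - a f x\<close> expand into
  inner products.\<close>

lemma isom_bounded_op: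
  assumes X: "closed_csubspace X" and f: "isom X f" and Y: "\<And>x. x \<in> X \<Longrightarrow> f x \<in> Y"
  shows "bounded_op X Y f"
proof -
  note cl = csubspace_add [OF X] csubspace_scaleC [OF X]
  have "f (x + y) = f x + f y" if xy: "x \<in> X" "y \<in> X" for x y
  proof -
    have "cinner (f (x + y) - f x - f y) (f (x + y) - f x - f y) = 0"
      using xy by (simp add: cinner_simps isomD [OF f] cl)
    then show ?thesis
      by (simp add: algebra_simps)
  qed
  moreover have "f (a *\<^sub>C x) = a *\<^sub>C f x" if x: "x \<in> X" for a x
  proof -
    have "cinner (f (a *\<^sub>C x) - a *\<^sub>C f x) (f (a *\<^sub>C x) - a *\<^sub>C f x) = 0"
      using x by (simp add: cinner_simps isomD [OF f] cl)
    then show ?thesis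
      by simp
  qed
  ultimately show ?thesis
    unfolding bounded_op_def by (auto simp: Y isom_norm [OF f] intro!: exI [of _ 1])
qed

text \<open>Preimages of a convergent sequence have the same mutual distances, hence form a Cauchy
  sequence, with limit in \<open>X\<close>.\<close>

lemma closed_csubspace_isom_image:
  assumes X: "closed_csubspace X" and f: "isom X f"
  shows "closed_csubspace (f ` X)"
proof (rule csubspaceI)
  have b: "bounded_op X UNIV f"
    by (rule isom_bounded_op [OF X f]) simp
  show "0 \<in> f ` X"
    using imageI [OF csubspace_0 [OF X], of f] bounded_op_0 [OF b X] by simp
  show "x + y \<in> f ` X" if "x \<in> f ` X" "y \<in> f ` X" for x y
    using that by (auto simp: bounded_op_add [OF b, symmetric] csubspace_add [OF X])
  show "a *\<^sub>C x \<in> f ` X" if "x \<in> f ` X" for a x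
    using that by (auto simp: bounded_op_scaleC [OF b, symmetric] csubspace_scaleC [OF X])
  show "closed (f ` X)"
    unfolding closed_sequential_limits
  proof (intro allI impI)
    fix y l
    assume "(\<forall>n. y n \<in> f ` X) \<and> y \<longlonglongrightarrow> l"
    then obtain x where x: "\<And>n. x n \<in> X" "\<And>n. y n = f (x n)" and l: "y \<longlonglongrightarrow> l"
      unfolding image_iff Bex_def by metis
    have d: "dist (x m) (x n) = dist (y m) (y n)" for m n
      by (simp add: dist_norm x bounded_op_diff [OF b X, symmetric] isom_norm [OF f] csubspace_diff [OF X])
    have "Cauchy x"
      using LIMSEQ_imp_Cauchy [OF l] by (simp add: Cauchy_def d)
    then obtain z where z: "x \<longlonglongrightarrow> z"
      by (auto simp: Cauchy_convergent_iff convergent_def)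
    have zX: "z \<in> X"
      using closed_sequentially [OF csubspace_closed [OF X] _ z] x by auto
    have "(\<lambda>n. f (x n)) \<longlonglongrightarrow> f z"
      using continuous_on_tendsto_compose [OF bounded_op_continuous [OF b X] z zX] x by auto
    moreover have "(\<lambda>n. f (x n)) = y"
      by (simp add: fun_eq_iff x)
    ultimately have "l = f z"
      using LIMSEQ_unique [OF l] by simp
    then show "l \<in> f ` X"
      using zX by simp
  qed
qed

lemma unitary_opI:
  assumes "closed_csubspace X" "isom X u" "u ` X = Y"
  shows "unitary_op X Y u"
  using assms isom_bounded_op [OF assms(1,2), of Y] by (auto simp: unitary_op_def isom_def)

lemma unitary_opD:
  assumes "unitary_op X Y u"
  shows "isom X u" "u ` X = Y" "bounded_op X Y u" "\<And>x. x \<in> X \<Longrightarrow> u x \<in> Y"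
  using assms by (auto simp: unitary_op_def isom_def)

lemma isom_eq_iff:
  assumes X: "closed_csubspace X" and f: "isom X f" and xy: "x \<in> X" "y \<in> X"
  shows "f x = f y \<longleftrightarrow> x = y"
proof -
  have "bounded_op X UNIV f"
    by (rule isom_bounded_op [OF X f]) simp
  then have "norm (f x - f y) = norm (x - y)"
    using xy by (simp add: bounded_op_diff [OF _ X, symmetric] isom_norm [OF f] csubspace_diff [OF X])
  then show ?thesis
    by (metis eq_iff_diff_eq_0 norm_eq_zero)
qed

lemma unitary_op_inverse:
  assumes X: "closed_csubspace X" and u: "unitary_op X Y u"
  obtains w where "unitary_op Y X w" "\<And>x. x \<in> X \<Longrightarrow> w (u x) = x" "\<And>y. y \<in> Y \<Longrightarrow> u (w y) = y"
proof -
  note u = unitary_opD [OF u]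
  define w where "w = inv_into X u"
  have inj: "inj_on u X"
    by (auto simp: inj_on_def isom_eq_iff [OF X u(1)])
  have wu: "w (u x) = x" if "x \<in> X" for x
    by (simp add: w_def inj that)
  have uw: "u (w y) = y" "w y \<in> X" if "y \<in> Y" for y
    using that u(2) by (auto simp: w_def f_inv_into_f inv_into_into)
  have "closed_csubspace Y"
    using closed_csubspace_isom_image [OF X u(1)] u(2) by simp
  moreover have "isom Y w"
    unfolding isom_def using uw isomD [OF u(1)] by metis
  moreover have "w ` Y = X"
    using wu uw u(4) by force
  ultimately have "unitary_op Y X w"
    by (rule unitary_opI)
  then show thesis
    using that wu uw by blast
qed

text \<open>The closed span of the pairs \<open>(f i, g i)\<close> is the graph of the required unitary.\<close>

lemma gram_unitary:
  fixes f :: "'i \<Rightarrow> 'a::complex_hilbert" and g :: "'i \<Rightarrow> 'b::complex_hilbert"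
  assumes gram: "\<And>i j. i \<in> I \<Longrightarrow> j \<in> I \<Longrightarrow> cinner (f i) (f j) = cinner (g i) (g j)"
  obtains u where "unitary_op (closed_cspan (f ` I)) (closed_cspan (g ` I)) u"
    "\<And>i. i \<in> I \<Longrightarrow> u (f i) = g i"
proof -
  define S where "S = (\<lambda>i. (f i, g i)) ` I"
  define G where "G = closed_cspan S"
  have G: "closed_csubspace G"
    by (simp add: G_def)
  have bfst: "bounded_op (UNIV :: ('a \<times> 'b) set) UNIV fst"
    by (auto simp: bounded_op_def scaleC_prod_def norm_fst_le intro!: exI [of _ 1])
  have bsnd: "bounded_op (UNIV :: ('a \<times> 'b) set) UNIV snd"
    by (auto simp: bounded_op_def scaleC_prod_def norm_snd_le intro!: exI [of _ 1])
  have eq: "cinner (fst p) (fst q) = cinner (snd p) (snd q)" if "p \<in> G" "q \<in> G" for p q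
    by (rule cinner_eq_on_cspan [OF bfst bsnd closed_csubspace_UNIV _ bfst bsnd closed_csubspace_UNIV])
      (use that gram in \<open>auto simp: G_def S_def\<close>)
  \<comment> \<open>On \<open>G\<close> both components have equal norm, each carrying half of the
    squared norm of the pair. The factor sqrt 2 makes the coordinate maps isometries, so their
    images are closed.\<close>
  have half: "isom G (\<lambda>p. complex_of_real (sqrt 2) *\<^sub>C fst p)" "isom G (\<lambda>p. complex_of_real (sqrt 2) *\<^sub>C snd p)"
    unfolding isom_def cinner_prod_def cinner_scaleC_left cinner_scaleC_right mult.assoc [symmetric]
      complex_cnj_complex_of_real of_real_mult [symmetric] by (simp_all add: eq)
  have img: "closed_csubspace (h ` G)" if "isom G (\<lambda>p. complex_of_real (sqrt 2) *\<^sub>C h p)"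
    and h: "\<And>a p. h (a *\<^sub>C p) = a *\<^sub>C h p"
    for h :: "'a \<times> 'b \<Rightarrow> 'z::complex_hilbert"
  proof -
    have "(\<lambda>p. complex_of_real (sqrt 2) *\<^sub>C h p) ` G = h ` G"
    proof (intro equalityI image_subsetI)
      fix p assume p: "p \<in> G"
      show "complex_of_real (sqrt 2) *\<^sub>C h p \<in> h ` G"
        using csubspace_scaleC [OF G p] by (metis h imageI)
      have "h p = complex_of_real (sqrt 2) *\<^sub>C h ((1 / complex_of_real (sqrt 2)) *\<^sub>C p)"
        by (simp add: h scaleC_scaleC)
      then show "h p \<in> (\<lambda>p. complex_of_real (sqrt 2) *\<^sub>C h p) ` G"
        using csubspace_scaleC [OF G p] by (metis (mono_tags, lifting) imageI)
    qed
    then show ?thesis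
      using closed_csubspace_isom_image [OF G that(1)] by simp
  qed
  have span: "h ` G = closed_cspan (q ` I)"
    if h: "bounded_op UNIV UNIV h" "closed_csubspace (h ` G)" and q: "\<And>i. h (f i, g i) = q i"
    for h :: "'a \<times> 'b \<Rightarrow> 'z::complex_hilbert" and q
  proof
    show "closed_cspan (q ` I) \<subseteq> h ` G"
    proof (rule cspan_subset [OF _ h(2)], rule image_subsetI)
      fix i assume "i \<in> I"
      then have "(f i, g i) \<in> G"
        unfolding G_def S_def by (intro cspan_inc) auto
      then show "q i \<in> h ` G"
        using q [of i] by force
    qed
    show "h ` G \<subseteq> closed_cspan (q ` I)"
    proof (rule image_subsetI)
      fix p assume "p \<in> G"
      then show "h p \<in> closed_cspan (q ` I)"
        unfolding G_def
        by (rule bounded_op_maps_cspan [OF h(1) closed_csubspace_UNIV, rotated -1])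
          (auto simp: S_def q intro: cspan_inc)
    qed
  qed
  have cF: "closed_csubspace (fst ` G)" and cS: "closed_csubspace (snd ` G)"
    using img [OF half(1)] img [OF half(2)] by (simp_all add: scaleC_prod_def)
  have F: "fst ` G = closed_cspan (f ` I)" and Sn: "snd ` G = closed_cspan (g ` I)"
    using span [OF bfst cF] span [OF bsnd cS] by simp_all
  \<comment> \<open>A pair in \<open>G\<close> with vanishing first component has vanishing second
    component, so \<open>G\<close> is the graph of a map.\<close>
  have single: "snd p = snd q" if "p \<in> G" "q \<in> G" "fst p = fst q" for p q
  proof -
    have "p - q \<in> G"
      by (intro csubspace_diff G that)
    then have "cinner (snd (p - q)) (snd (p - q)) = 0"
      using eq [of "p - q" "p - q"] that by simp
    then show ?thesis
      by simp
  qed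
  define u where "u x = snd (SOME p. p \<in> G \<and> fst p = x)" for x
  have u: "u (fst p) = snd p" if p: "p \<in> G" for p
  proof -
    have "(SOME q. q \<in> G \<and> fst q = fst p) \<in> G \<and> fst (SOME q. q \<in> G \<and> fst q = fst p) = fst p"
      by (rule someI [of _ p]) (simp add: p)
    then show ?thesis
      unfolding u_def using single p by blast
  qed
  have "unitary_op (fst ` G) (snd ` G) u"
  proof (rule unitary_opI [OF cF])
    show "isom (fst ` G) u"
      by (auto simp: isom_def u eq simp del: split_paired_All)
    show "u ` fst ` G = snd ` G"
      by (simp add: image_image u cong: image_cong)
  qed
  moreover have "u (f i) = g i" if "i \<in> I" for i
  proof -
    have "(f i, g i) \<in> G"
      unfolding G_def S_def by (intro cspan_inc imageI that)
    then show ?thesis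
      using u by force
  qed
  ultimately show thesis
    using that by (simp add: F Sn)
qed

section \<open>Positive square roots\<close>

text \<open>Polarization: reality of <z, S z> at z = x + y gives the imaginary part of the claim,
  and at z = x + i y the real part.\<close>

lemma positive_op_selfadjoint:
  assumes X: "closed_csubspace X" and S: "positive_op X S" and xy: "x \<in> X" "y \<in> X"
  shows "cinner x (S y) = cinner (S x) y"
proof -
  have b: "bounded_op X X S"
    using S by (simp add: positive_op_def)
  have im: "Im (cinner z (S z)) = 0" if "z \<in> X" for z
    using S that by (auto simp: positive_op_def complex_nonneg_Reals_iff)
  have "Im (cinner x (S y) + cinner y (S x)) = 0"
    using im [of "x + y"] im [of x] im [of y] xy
    by (simp add: csubspace_add [OF X] bounded_op_add [OF b] cinner_simps)
  moreover have "Im (\<i> * cinner x (S y) - \<i> * cinner y (S x)) = 0"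
    using im [of "x + \<i> *\<^sub>C y"] im [of x] im [of y] xy
    by (simp add: csubspace_add [OF X] csubspace_scaleC [OF X] bounded_op_add [OF b]
        bounded_op_scaleC [OF b] cinner_simps)
  ultimately have "cinner x (S y) = cnj (cinner y (S x))"
    by (simp add: complex_eq_iff)
  then show ?thesis
    by (metis cinner_commute)
qed

text \<open>The iteration \<open>Y\<^sub>0 = 0\<close>, \<open>Y\<^sub>n\<^sub>+\<^sub>1 = (B + Y\<^sub>n\<^sup>2) / 2\<close> is dominated in norm by the same iteration for the
  scalar \<open>1\<close>, hence converges to a solution \<open>Y\<close> of \<open>(I - Y)\<^sup>2 = I - B\<close>.\<close>

lemma positive_sqrt_exists:
  assumes X: "closed_csubspace X" and B: "bounded_op X X B"
    and contr: "\<And>x. x \<in> X \<Longrightarrow> norm (B x) \<le> norm x"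
    and sa: "\<And>x y. x \<in> X \<Longrightarrow> y \<in> X \<Longrightarrow> cinner (B x) y = cinner x (B y)"
  shows "\<exists>S. positive_op X S \<and> (\<forall>x\<in>X. S (S x) = x - B x)"
proof -
  note cl = csubspace_add [OF X] csubspace_scaleC [OF X] csubspace_scaleR [OF X] csubspace_diff [OF X]
  define Y where "Y = rec_nat (\<lambda>_. 0) (\<lambda>_ Z x. (1/2) *\<^sub>R (B x + Z (Z x)))"
  define t where "t = rec_nat 0 (\<lambda>_ s. (1 + s\<^sup>2) / (2::real))"
  have Y0: "Y 0 x = 0" and YS: "Y (Suc n) x = (1/2) *\<^sub>R (B x + Y n (Y n x))" for n x
    by (simp_all add: Y_def)
  have t0: "t 0 = 0" and tS: "t (Suc n) = (1 + (t n)\<^sup>2) / 2" for n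
    by (simp_all add: t_def)
  have t01: "0 \<le> t n \<and> t n \<le> 1" for n
  proof (induction n)
    case (Suc n)
    then have "(t n)\<^sup>2 \<le> 1"
      by (simp add: power_le_one)
    then show ?case
      by (simp add: tS)
  qed (simp add: t0)
  have tmono: "t n \<le> t (Suc n)" for n
    using zero_le_power2 [of "1 - t n"] by (simp add: tS power2_diff)
  have YX: "Y n x \<in> X" if "x \<in> X" for n x
    using that by (induction n arbitrary: x)
      (auto simp: Y0 YS csubspace_0 [OF X] intro!: cl bounded_op_in [OF B])
  have Yadd: "Y n (x + y) = Y n x + Y n y" if "x \<in> X" "y \<in> X" for n x y
    using that by (induction n arbitrary: x y)
      (simp_all add: Y0 YS bounded_op_add [OF B] YX algebra_simps scaleR_add_right)
  have Ysc: "Y n (a *\<^sub>C x) = a *\<^sub>C Y n x" if "x \<in> X" for n a x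
    using that by (induction n arbitrary: x)
      (simp_all add: Y0 YS bounded_op_scaleC [OF B] YX scaleC_add_right scaleC_scaleC mult.commute
        flip: scaleC_of_real)
  have Ydiff: "Y n (x - y) = Y n x - Y n y" if "x \<in> X" "y \<in> X" for n x y
    using Yadd [of "x - y" y n] that by (simp add: cl)
  have YscR: "Y n (r *\<^sub>R x) = r *\<^sub>R Y n x" if "x \<in> X" for n r x
    using Ysc [OF that, of n "complex_of_real r"] by (simp add: scaleC_of_real)
  have Ynorm: "norm (Y n x) \<le> t n * norm x" if "x \<in> X" for n x
    using that
  proof (induction n arbitrary: x)
    case (Suc n)
    have "norm (Y n (Y n x)) \<le> t n * norm (Y n x)"
      using Suc by (simp add: YX)
    also have "\<dots> \<le> t n * (t n * norm x)"
      using Suc t01 by (intro mult_left_mono) auto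
    finally have "norm (Y n (Y n x)) \<le> (t n)\<^sup>2 * norm x"
      by (simp add: power2_eq_square mult.assoc)
    then have "norm (B x + Y n (Y n x)) \<le> norm x + (t n)\<^sup>2 * norm x"
      using contr [OF Suc.prems] by (meson add_mono norm_triangle_le)
    then show ?case
      by (simp add: YS tS distrib_right)
  qed (simp add: Y0 t0)
  have Ysa: "cinner (Y n x) y = cinner x (Y n y)" if "x \<in> X" "y \<in> X" for n x y
    using that by (induction n arbitrary: x y)
      (simp_all add: Y0 YS YX sa cinner_simps cinner_scaleR_left cinner_scaleR_right)
  have BY: "B (Y n x) = Y n (B x)" if "x \<in> X" for n x
    using that
  proof (induction n arbitrary: x)
    case 0
    then show ?case by (simp add: Y0 bounded_op_0 [OF B X])
  next
    case (Suc n)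
    then have "B (Y n (Y n x)) = Y n (Y n (B x))"
      by (simp add: YX bounded_op_in [OF B])
    then show ?case
      using Suc.prems by (simp add: YS bounded_op_scaleC [OF B] bounded_op_add [OF B] cl YX bounded_op_in [OF B]
          flip: scaleC_of_real)
  qed
  \<comment> \<open>The iterates are polynomials in \<open>B\<close>; that they commute permits
    factoring the difference of squares in \<open>Ystep\<close>.\<close>
  have comm: "Y m (Y n x) = Y n (Y m x)" if "x \<in> X" for m n x
    using that
  proof (induction m arbitrary: x)
    case 0
    then show ?case using Ydiff [of 0 0 n] by (simp add: Y0 csubspace_0 [OF X])
  next
    case (Suc m)
    then have "Y m (Y m (Y n x)) = Y n (Y m (Y m x))"
      by (simp add: YX)
    then show ?case
      using Suc.prems by (simp add: YS YscR Yadd cl YX bounded_op_in [OF B] BY)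
  qed
  have Ystep: "norm (Y (Suc n) x - Y n x) \<le> (t (Suc n) - t n) * norm x" if "x \<in> X" for n x
    using that
  proof (induction n arbitrary: x)
    case 0
    then show ?case
      using contr [of x] by (simp add: Y0 YS t0 tS)
  next
    case (Suc n)
    \<comment> \<open>The difference of the squares of consecutive iterates at \<open>x\<close>
      equals the difference of the iterates at \<open>z\<close>, so the induction hypothesis is used
      at \<open>z\<close>.\<close>
    define z where "z = Y (Suc n) x + Y n x"
    have z: "z \<in> X"
      unfolding z_def by (intro cl YX Suc.prems)
    have "Y (Suc (Suc n)) x - Y (Suc n) x
        = (1/2) *\<^sub>R (Y (Suc n) (Y (Suc n) x) - Y n (Y n x))"
      by (simp only: YS [of "Suc n"] YS [of n x]) (simp add: algebra_simps scaleR_diff_right)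
    also have "Y (Suc n) (Y (Suc n) x) - Y n (Y n x) = Y (Suc n) z - Y n z"
      using comm [OF Suc.prems, of "Suc n" n] by (simp add: z_def Yadd YX Suc.prems)
    finally have eq: "Y (Suc (Suc n)) x - Y (Suc n) x = (1/2) *\<^sub>R (Y (Suc n) z - Y n z)" .
    have "norm z \<le> (t (Suc n) + t n) * norm x"
      unfolding z_def distrib_right
      by (intro norm_triangle_le add_mono Ynorm Suc.prems)
    then have le: "norm (Y (Suc n) z - Y n z) \<le> (t (Suc n) - t n) * ((t (Suc n) + t n) * norm x)"
      using Suc.IH [OF z] tmono [of n] by (meson diff_ge_0_iff_ge mult_left_mono order_trans)
    have tt: "t (Suc (Suc n)) - t (Suc n) = (t (Suc n) - t n) * (t (Suc n) + t n) / 2"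
      by (simp only: tS [of "Suc n"] tS [of n]) (simp add: power2_eq_square field_simps)
    show ?case
      unfolding eq tt using le by simp
  qed
  have Ydist: "norm (Y (n + k) x - Y n x) \<le> (t (n + k) - t n) * norm x" if "x \<in> X" for n k x
  proof (induction k)
    case (Suc k)
    have "norm (Y (n + Suc k) x - Y n x) \<le> norm (Y (Suc (n + k)) x - Y (n + k) x) + norm (Y (n + k) x - Y n x)"
      using norm_triangle_ineq [of "Y (Suc (n + k)) x - Y (n + k) x" "Y (n + k) x - Y n x"] by simp
    also have "\<dots> \<le> (t (n + Suc k) - t n) * norm x"
      using Ystep [OF that, of "n + k"] Suc by (simp add: algebra_simps)
    finally show ?case .
  qed simp
  have "incseq t"
    using tmono by (simp add: incseq_Suc_iff)
  moreover have "bdd_above (range t)"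
    using t01 by (auto simp: bdd_above_def)
  ultimately have "convergent t"
    by (metis LIMSEQ_incseq_SUP convergentI)
  then have tC: "Cauchy t"
    by (rule convergent_Cauchy)
  have "\<exists>l. (\<lambda>n. Y n x) \<longlonglongrightarrow> l" if x: "x \<in> X" for x
  proof -
    have "Cauchy (\<lambda>n. Y n x)"
    proof (rule CauchyI')
      fix e :: real
      assume e: "e > 0"
      then have "e / (norm x + 1) > 0"
        by (simp add: add_nonneg_pos)
      then obtain N where N: "\<And>m n. m \<ge> N \<Longrightarrow> n \<ge> N \<Longrightarrow> norm (t m - t n) < e / (norm x + 1)"
        using tC unfolding Cauchy_iff by blast
      have "dist (Y m x) (Y n x) < e" if "m \<ge> N" "n > m" for m n
      proof -
        have "norm (Y (m + (n - m)) x - Y m x) \<le> (t (m + (n - m)) - t m) * norm x"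
          by (rule Ydist [OF x])
        also have "\<dots> \<le> norm (t n - t m) * (norm x + 1)"
          using that by (intro mult_mono) auto
        also have "\<dots> < e"
          using N [of n m] that by (simp add: pos_less_divide_eq add_nonneg_pos)
        finally show ?thesis
          using that by (simp add: dist_norm norm_minus_commute)
      qed
      then show "\<exists>M. \<forall>m\<ge>M. \<forall>n>m. dist (Y m x) (Y n x) < e"
        by blast
    qed
    then show ?thesis
      by (simp add: Cauchy_convergent_iff convergent_def)
  qed
  then obtain L where L: "\<And>x. x \<in> X \<Longrightarrow> (\<lambda>n. Y n x) \<longlonglongrightarrow> L x"
    by metis
  have LX: "L x \<in> X" if "x \<in> X" for x
    using closed_sequentially [OF csubspace_closed [OF X] _ L [OF that]] YX [OF that] by auto
  have Yle: "norm (Y n x) \<le> norm x" if "x \<in> X" for n x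
    using Ynorm [OF that, of n] t01 [of n] mult_right_mono [of "t n" 1 "norm x"] by simp
  have Lnorm: "norm (L x) \<le> norm x" if "x \<in> X" for x
    by (rule tendsto_upperbound [OF tendsto_norm [OF L [OF that]]]) (simp_all add: Yle [OF that])
  have Ladd: "L (x + y) = L x + L y" if "x \<in> X" "y \<in> X" for x y
    using tendsto_add [OF L [OF that(1)] L [OF that(2)]] L [of "x + y"] that
    by (simp add: Yadd cl LIMSEQ_unique)
  have Lsc: "L (a *\<^sub>C x) = a *\<^sub>C L x" if "x \<in> X" for a x
    using bounded_linear.tendsto [OF bounded_linear_scaleC L [OF that], of a] L [of "a *\<^sub>C x"] that
    by (simp add: Ysc cl LIMSEQ_unique)
  have Lsa: "cinner (L x) y = cinner x (L y)" if "x \<in> X" "y \<in> X" for x y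
    using bounded_bilinear.tendsto [OF bounded_bilinear_cinner L [OF that(1)] tendsto_const [of y]]
      bounded_bilinear.tendsto [OF bounded_bilinear_cinner tendsto_const [of x] L [OF that(2)]]
    by (simp add: Ysa that LIMSEQ_unique)
  have LL: "2 *\<^sub>R L x = B x + L (L x)" if x: "x \<in> X" for x
  proof -
    \<comment> \<open>The iterates are contractions, so replacing the inner \<open>Y n x\<close> by
      its limit costs nothing in the limit, and \<open>Y n (Y n x)\<close> tends to
      \<open>L (L x)\<close>.\<close>
    have "(\<lambda>n. Y n (Y n x - L x)) \<longlonglongrightarrow> 0"
    proof (rule tendsto_0_le [of "\<lambda>n. Y n x - L x" _ _ 1])
      show "(\<lambda>n. Y n x - L x) \<longlonglongrightarrow> 0"
        using L [OF x] by (simp add: LIM_zero)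
      show "\<forall>\<^sub>F n in sequentially. norm (Y n (Y n x - L x)) \<le> norm (Y n x - L x) * 1"
        using x by (simp add: Yle cl YX LX)
    qed
    from tendsto_add [OF this L [OF LX [OF x]]] have "(\<lambda>n. Y n (Y n x)) \<longlonglongrightarrow> L (L x)"
      using x by (simp add: Ydiff YX LX)
    then have "(\<lambda>n. B x + Y n (Y n x)) \<longlonglongrightarrow> B x + L (L x)"
      by (intro tendsto_intros)
    moreover have "(\<lambda>n. 2 *\<^sub>R Y (Suc n) x) \<longlonglongrightarrow> 2 *\<^sub>R L x"
      by (intro tendsto_intros LIMSEQ_Suc L x)
    ultimately show ?thesis
      by (simp add: YS LIMSEQ_unique)
  qed
  \<comment> \<open>By \<open>LL\<close> the square of I - L is I - 2 L + L L = I - B; positivity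
    holds because \<open>L\<close> is a self-adjoint contraction.\<close>
  define S where "S x = x - L x" for x
  have "S (S x) = x - B x" if x: "x \<in> X" for x
  proof -
    have "L (x - L x) = L x - L (L x)"
      using Ladd [of "x - L x" "L x"] x by (simp add: cl LX eq_diff_eq)
    then have "S (S x) = x - 2 *\<^sub>R L x + L (L x)"
      by (simp add: S_def scaleR_2)
    then show ?thesis
      by (simp add: LL x)
  qed
  moreover have "positive_op X S"
    unfolding positive_op_def
  proof
    have "norm (S x) \<le> 2 * norm x" if "x \<in> X" for x
      using norm_triangle_ineq4 [of x "L x"] Lnorm [OF that] by (simp add: S_def)
    then show "bounded_op X X S"
      unfolding bounded_op_def
      by (auto simp: S_def cl LX Ladd Lsc scaleC_diff_right)
    show "\<forall>x\<in>X. cinner x (S x) \<in> \<real>\<^sub>\<ge>\<^sub>0"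
    proof
      fix x assume x: "x \<in> X"
      have "Im (cinner x (L x)) = 0"
        using arg_cong [OF cinner_commute [of x "L x"], of Im] Lsa [OF x x] by simp
      moreover have "Re (cinner x (L x)) \<le> (norm x)\<^sup>2"
      proof -
        have "inner x (L x) \<le> norm x * norm (L x)"
          by (rule norm_cauchy_schwarz)
        also have "\<dots> \<le> norm x * norm x"
          by (intro mult_left_mono Lnorm x) simp
        finally show ?thesis
          by (simp add: Re_cinner power2_eq_square)
      qed
      ultimately show "cinner x (S x) \<in> \<real>\<^sub>\<ge>\<^sub>0"
        by (simp add: S_def cinner_diff_right cinner_self_norm complex_nonneg_Reals_iff)
    qed
  qed
  ultimately show ?thesis
    by blast
qed

text \<open>The hypotheses say Q = I - T* T in weak form. Boundedness and this Gram identity are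
  what is used later of the square roots in \<open>defect_op\<close> and
  \<open>Delta\<close>.\<close>

lemma sqrt_op_gram:
  assumes X: "closed_csubspace X" and T: "bounded_op X Y T"
    and contr: "\<And>x. x \<in> X \<Longrightarrow> norm (T x) \<le> norm x" and QX: "\<And>x. x \<in> X \<Longrightarrow> Q x \<in> X"
    and Q: "\<And>x y. x \<in> X \<Longrightarrow> y \<in> X \<Longrightarrow> cinner x (Q y) = cinner x y - cinner (T x) (T y)"
  shows "bounded_op X X (sqrt_op X Q)"
    and "\<And>x y. x \<in> X \<Longrightarrow> y \<in> X \<Longrightarrow>
      cinner (sqrt_op X Q x) (sqrt_op X Q y) = cinner x y - cinner (T x) (T y)"
proof -
  note cl = csubspace_add [OF X] csubspace_scaleC [OF X] csubspace_diff [OF X]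
  define B where "B y = y - Q y" for y
  have BX: "B x \<in> X" if "x \<in> X" for x
    unfolding B_def by (intro cl QX that)
  have B: "cinner x (B y) = cinner (T x) (T y)" if "x \<in> X" "y \<in> X" for x y
    using that by (simp add: B_def cinner_diff_right Q)
  \<comment> \<open>\<open>Q\<close> is known only through its inner products, so equations for
    \<open>B\<close> are verified by testing against all \<open>z\<close> in
    \<open>X\<close>.\<close>
  have eqI: "x = y" if "x \<in> X" "y \<in> X" "\<And>z. z \<in> X \<Longrightarrow> cinner z x = cinner z y" for x y
    using that(3) [of "x - y"] that(1,2) cinner_diff_right [of "x - y" x y] by (simp add: cl)
  have Bnorm: "norm (B x) \<le> norm x" if x: "x \<in> X" for x
  proof -
    have "(norm (B x))\<^sup>2 = Re (cinner (B x) (B x))"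
      by (simp add: cinner_self_norm)
    also have "\<dots> = inner (T (B x)) (T x)"
      by (simp add: B BX x Re_cinner)
    also have "\<dots> \<le> norm (T (B x)) * norm (T x)"
      by (rule norm_cauchy_schwarz)
    also have "\<dots> \<le> norm (B x) * norm x"
      by (intro mult_mono contr BX x) auto
    finally show ?thesis
      by (cases "B x = 0") (auto simp: power2_eq_square)
  qed
  have bB: "bounded_op X X B"
    unfolding bounded_op_def
  proof (intro conjI ballI allI)
    show "B (x + y) = B x + B y" if "x \<in> X" "y \<in> X" for x y
      using that by (intro eqI)
        (simp_all add: B BX cl cinner_add_right bounded_op_add [OF T])
    show "B (a *\<^sub>C x) = a *\<^sub>C B x" if "x \<in> X" for a x
      using that by (intro eqI)
        (simp_all add: B BX cl cinner_scaleC_right bounded_op_scaleC [OF T])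
    show "\<exists>K. \<forall>x\<in>X. norm (B x) \<le> K * norm x"
      by (rule exI [of _ 1]) (simp add: Bnorm)
  qed (rule BX)
  have sa: "cinner (B x) y = cinner x (B y)" if "x \<in> X" "y \<in> X" for x y
    unfolding B [OF that] cinner_commute [of "B x" y] B [OF that(2,1)]
    by (rule cinner_commute [symmetric])
  have "\<exists>S. positive_op X S \<and> (\<forall>x\<in>X. S (S x) = x - B x)"
    by (rule positive_sqrt_exists [OF X bB Bnorm sa])
  then have "\<exists>S. positive_op X S \<and> (\<forall>x\<in>X. S (S x) = Q x)"
    by (simp add: B_def)
  then have "positive_op X (sqrt_op X Q) \<and> (\<forall>x\<in>X. sqrt_op X Q (sqrt_op X Q x) = Q x)"
    unfolding sqrt_op_def by (rule someI_ex)
  then have S: "positive_op X (sqrt_op X Q)" "\<And>x. x \<in> X \<Longrightarrow> sqrt_op X Q (sqrt_op X Q x) = Q x"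
    by auto
  show b: "bounded_op X X (sqrt_op X Q)"
    using S by (simp add: positive_op_def)
  show "cinner (sqrt_op X Q x) (sqrt_op X Q y) = cinner x y - cinner (T x) (T y)"
    if xy: "x \<in> X" "y \<in> X" for x y
    using positive_op_selfadjoint [OF X S(1) xy(1) bounded_op_in [OF b xy(2)]] xy S(2)
    by (simp add: Q)
qed

text \<open>The image is already a linear subspace. This turns the closures in
  \<open>defect_space\<close> and \<open>model_space\<close> into closed spans, where it suffices to
  argue on generators.\<close>

lemma closure_image_eq_cspan:
  assumes X: "closed_csubspace X" and f: "bounded_op X Y f"
  shows "closure (f ` X) = closed_cspan (f ` X)"
proof
  show "closure (f ` X) \<subseteq> closed_cspan (f ` X)"
    by (intro closure_minimal hull_subset csubspace_closed) simp
  show "closed_cspan (f ` X) \<subseteq> closure (f ` X)"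
  proof (rule cspan_subset [OF closure_subset], rule csubspaceI)
    show "0 \<in> closure (f ` X)"
      using subsetD [OF closure_subset imageI [OF csubspace_0 [OF X], of f]]
      by (simp add: bounded_op_0 [OF f X])
    show "x + y \<in> closure (f ` X)" if xy: "x \<in> closure (f ` X)" "y \<in> closure (f ` X)" for x y
    proof -
      obtain p q where p: "\<forall>n. p n \<in> f ` X" "p \<longlonglongrightarrow> x" and q: "\<forall>n. q n \<in> f ` X" "q \<longlonglongrightarrow> y"
        using xy [THEN closure_sequential [THEN iffD1]] by auto
      have "p n + q n \<in> f ` X" for n
      proof -
        obtain u v where "p n = f u" "q n = f v" "u \<in> X" "v \<in> X"
          using p(1) [rule_format, of n] q(1) [rule_format, of n] by (auto simp: image_iff)
        then show ?thesis
          using imageI [OF csubspace_add [OF X], of u v f] by (simp add: bounded_op_add [OF f])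
      qed
      then show ?thesis
        using tendsto_add [OF p(2) q(2)] unfolding closure_sequential
        by (intro exI [of _ "\<lambda>n. p n + q n"]) simp
    qed
    show "a *\<^sub>C x \<in> closure (f ` X)" if x: "x \<in> closure (f ` X)" for a x
    proof -
      obtain p where p: "\<forall>n. p n \<in> f ` X" "p \<longlonglongrightarrow> x"
        using x [THEN closure_sequential [THEN iffD1]] by auto
      have "a *\<^sub>C p n \<in> f ` X" for n
      proof -
        obtain u where "p n = f u" "u \<in> X"
          using p(1) [rule_format, of n] by (auto simp: image_iff)
        then show ?thesis
          using imageI [OF csubspace_scaleC [OF X], of u f a] by (simp add: bounded_op_scaleC [OF f])
      qed
      then show ?thesis
        using bounded_linear.tendsto [OF bounded_linear_scaleC p(2), of a] unfolding closure_sequential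
        by (intro exI [of _ "\<lambda>n. a *\<^sub>C p n"]) simp
    qed
  qed simp
qed

section \<open>Row isometries and the full Fock space\<close>

lemmas coord_simps = zero_ell2.rep_eq plus_ell2.rep_eq minus_ell2.rep_eq uminus_ell2.rep_eq
  scaleC_ell2.rep_eq

lemma coord_basis_tensor: "coord (basis_vec w \<otimes> \<delta>) v = (if v = w then \<delta> else 0)"
  by (simp add: tensor.rep_eq basis_vec.rep_eq)

text \<open>Coordinates are inner products with elementary tensors, since only the summand at
  \<open>w\<close> survives.\<close>

lemma cinner_basis_tensor_left: "cinner (basis_vec w \<otimes> \<delta>) \<eta> = cinner \<delta> (coord \<eta> w)"
proof -
  have "cinner (basis_vec w \<otimes> \<delta>) \<eta> = (\<Sum>\<^sub>\<infinity>v\<in>{w}. cinner \<delta> (coord \<eta> v))"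
    unfolding cinner_ell2_def by (rule infsum_cong_neutral) (auto simp: coord_basis_tensor)
  then show ?thesis
    by simp
qed

lemma creation_zero: "creation j 0 = 0"
  by (rule ell2_eqI) (auto simp: creation.rep_eq zero_ell2.rep_eq split: list.splits)

lemma cinner_Pair: "cinner (x, y) (x', y') = cinner x x' + cinner y y'"
  unfolding cinner_prod_def by simp

lemma tensor_zero_right: "x \<otimes> 0 = 0"
  by (rule ell2_eqI) (simp add: tensor.rep_eq zero_ell2.rep_eq)

lemma axis_zero: "axis j 0 = 0"
  by (simp add: axis_def vec_eq_iff)

lemma bounded_op_basis_tensor: "bounded_op UNIV UNIV (\<lambda>\<delta>. basis_vec w \<otimes> \<delta>)"
  by (rule isom_bounded_op [OF closed_csubspace_UNIV])
    (auto simp: isom_def cinner_basis_tensor_left coord_basis_tensor)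

lemma creation_basis_tensor: "creation j (basis_vec w \<otimes> \<delta>) = basis_vec (j # w) \<otimes> \<delta>"
  by (simp add: creation_tensor creation_basis_vec)

lemma foldr_creation: "foldr creation \<alpha> (vacuum \<otimes> \<delta>) = basis_vec \<alpha> \<otimes> \<delta>"
  by (induction \<alpha>) (simp_all add: vacuum_def creation_basis_tensor)

lemma basis_tensor_in_Fock: "closed_csubspace D \<Longrightarrow> \<delta> \<in> D \<Longrightarrow> basis_vec w \<otimes> \<delta> \<in> Fock D"
  by (simp add: Fock_def coord_basis_tensor csubspace_0)

lemma vacuum_tensor_in_Fock: "closed_csubspace D \<Longrightarrow> \<delta> \<in> D \<Longrightarrow> vacuum \<otimes> \<delta> \<in> Fock D"
  by (simp add: vacuum_def basis_tensor_in_Fock)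

lemma creation_in_Fock: "closed_csubspace D \<Longrightarrow> \<xi> \<in> Fock D \<Longrightarrow> creation j \<xi> \<in> Fock D"
  by (auto simp: Fock_def creation.rep_eq csubspace_0 split: list.splits)

text \<open>These generators are the words of creation operators applied to vacuum tensors, exactly
  the vectors at which \<open>Kappa\<close> is prescribed; a vector orthogonal to them has vanishing
  coordinates.\<close>

lemma Fock_eq_cspan_basis:
  assumes D: "closed_csubspace D"
  shows "closed_cspan ((\<lambda>(w, \<delta>). basis_vec w \<otimes> \<delta>) ` (UNIV \<times> D)) = Fock D"
proof (rule cspan_eqI [OF closed_csubspace_Fock [OF D]])
  fix x :: "('d, 'a) fock"
  assume x: "x \<in> Fock D" and 0: "\<And>s. s \<in> (\<lambda>(w, \<delta>). basis_vec w \<otimes> \<delta>) ` (UNIV \<times> D) \<Longrightarrow> cinner s x = 0"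
  have "cinner (basis_vec w \<otimes> coord x w) x = 0" for w
    by (rule 0) (use x in \<open>auto simp: Fock_def\<close>)
  then show "x = 0"
    by (intro ell2_eqI) (simp add: cinner_basis_tensor_left coord_simps)
qed (auto simp: basis_tensor_in_Fock D)

lemma bounded_op_maps_Fock:
  assumes f: "bounded_op (Fock D) Y f" and D: "closed_csubspace D" and Z: "closed_csubspace Z"
    and gen: "\<And>\<alpha> \<delta>. \<delta> \<in> D \<Longrightarrow> f (basis_vec \<alpha> \<otimes> \<delta>) \<in> Z" and \<xi>: "\<xi> \<in> Fock D"
  shows "f \<xi> \<in> Z"
  by (rule bounded_op_maps_cspan [OF f closed_csubspace_Fock [OF D] _ Z, OF _ _ \<xi> [folded Fock_eq_cspan_basis [OF D]]])
    (auto simp: basis_tensor_in_Fock [OF D] gen)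

lemma bounded_op_eq_on_Fock:
  assumes f: "bounded_op (Fock D) F f" and g: "bounded_op (Fock D) G g" and D: "closed_csubspace D"
    and gen: "\<And>\<alpha> \<delta>. \<delta> \<in> D \<Longrightarrow> f (basis_vec \<alpha> \<otimes> \<delta>) = g (basis_vec \<alpha> \<otimes> \<delta>)" and \<xi>: "\<xi> \<in> Fock D"
  shows "f \<xi> = g \<xi>"
  by (rule bounded_op_eq_on_cspan [OF f g closed_csubspace_Fock [OF D], OF _ _ \<xi> [folded Fock_eq_cspan_basis [OF D]]])
    (auto simp: basis_tensor_in_Fock [OF D] gen)

lemma cinner_creation: "cinner (creation i \<xi>) (creation j \<eta>) = (if i = j then cinner \<xi> \<eta> else 0)"
proof (cases "i = j")
  case True
  have "cinner (creation i \<xi>) (creation i \<eta>)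
      = (\<Sum>\<^sub>\<infinity>w\<in>range (Cons i). cinner (coord \<xi> (tl w)) (coord \<eta> (tl w)))"
    unfolding cinner_ell2_def
    by (rule infsum_cong_neutral) (auto simp: creation.rep_eq split: list.splits)
  also have "\<dots> = cinner \<xi> \<eta>"
    unfolding cinner_ell2_def by (subst infsum_reindex) (auto simp: o_def)
  finally show ?thesis
    using True by simp
next
  case False
  have "cinner (coord (creation i \<xi>) w) (coord (creation j \<eta>) w) = 0" for w
    using False by (auto simp: creation.rep_eq split: list.splits)
  then show ?thesis
    using False by (simp add: cinner_ell2_def)
qed

lemma cinner_vacuum_creation: "cinner (vacuum \<otimes> \<delta>) (creation j \<eta>) = 0"
  by (simp add: vacuum_def cinner_basis_tensor_left creation.rep_eq)

lemma cinner_creation_vacuum: "cinner (creation j \<eta>) (vacuum \<otimes> \<delta>) = 0"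
  using cinner_vacuum_creation by (simp add: cinner_eq_0_commute [of "creation _ _"])

lemma cinner_vacuum_tensor: "cinner (vacuum \<otimes> \<delta>) (vacuum \<otimes> \<epsilon>) = cinner \<delta> \<epsilon>"
  by (simp add: vacuum_def cinner_basis_tensor_left coord_basis_tensor)

text \<open>A coordinate at a nonempty word is an inner product with a vector in the range of a
  creation operator, so only the vacuum coordinate can survive.\<close>

lemma Fock_orthogonal_creation:
  assumes D: "closed_csubspace D" and \<xi>: "\<xi> \<in> Fock D"
    and 0: "\<And>j \<eta>. \<eta> \<in> Fock D \<Longrightarrow> cinner (creation j \<eta>) \<xi> = 0"
  shows "\<xi> = vacuum \<otimes> coord \<xi> []"
proof (rule ell2_eqI)
  have "coord \<xi> (j # w) = 0" for j w
  proof -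
    have "coord \<xi> (j # w) \<in> D"
      using \<xi> by (simp add: Fock_def)
    then have "cinner (creation j (basis_vec w \<otimes> coord \<xi> (j # w))) \<xi> = 0"
      by (intro 0 basis_tensor_in_Fock D)
    then show ?thesis
      by (simp add: creation_basis_tensor cinner_basis_tensor_left)
  qed
  then show "coord \<xi> v = coord (vacuum \<otimes> coord \<xi> []) v" for v
    by (cases v) (simp_all add: vacuum_def coord_basis_tensor)
qed

text \<open>Linearity is not demanded: on a closed subspace it follows from preservation of inner
  products, see \<open>row_isometry_bounded_op\<close>.\<close>

definition row_isometry :: "'k::complex_hilbert set \<Rightarrow> ('d \<Rightarrow> 'k \<Rightarrow> 'k) \<Rightarrow> bool"
  where "row_isometry K V \<longleftrightarrow> (\<forall>j. \<forall>x\<in>K. V j x \<in> K) \<and>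
    (\<forall>i j. \<forall>x\<in>K. \<forall>y\<in>K. cinner (V i x) (V j y) = (if i = j then cinner x y else 0))"

lemma row_isometry_in: "row_isometry K V \<Longrightarrow> x \<in> K \<Longrightarrow> V j x \<in> K"
  and cinner_row_isometry: "row_isometry K V \<Longrightarrow> x \<in> K \<Longrightarrow> y \<in> K \<Longrightarrow>
    cinner (V i x) (V j y) = (if i = j then cinner x y else 0)"
  by (simp_all add: row_isometry_def)

lemma row_isometry_bounded_op: "row_isometry K V \<Longrightarrow> closed_csubspace K \<Longrightarrow> bounded_op K K (V j)"
  by (rule isom_bounded_op) (simp_all add: row_isometry_def isom_def)

lemma row_isometry_word_in: "row_isometry K V \<Longrightarrow> x \<in> K \<Longrightarrow> foldr V \<alpha> x \<in> K"
  by (induction \<alpha>) (auto intro: row_isometry_in)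

lemma row_isometry_creation: "closed_csubspace D \<Longrightarrow> row_isometry (Fock D) creation"
  by (simp add: row_isometry_def creation_in_Fock cinner_creation)

text \<open>Common first letters cancel and distinct first letters give orthogonal ranges; once one
  of the words is exhausted, the wandering hypothesis decides.\<close>

lemma cinner_wandering_words:
  assumes V: "row_isometry K V" and L: "L \<subseteq> K"
    and w: "\<And>l l' j \<beta>. l \<in> L \<Longrightarrow> l' \<in> L \<Longrightarrow> cinner l (V j (foldr V \<beta> l')) = 0"
    and l: "l \<in> L" "l' \<in> L"
  shows "cinner (foldr V \<alpha> l) (foldr V \<beta> l') = (if \<alpha> = \<beta> then cinner l l' else 0)"
proof (induction \<alpha> arbitrary: \<beta>)
  case Nil
  show ?case
    using w l by (cases \<beta>) auto
next
  case (Cons i \<alpha>)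
  show ?case
  proof (cases \<beta>)
    case Nil
    then show ?thesis
      using w [OF l(2,1), of i \<alpha>] by (simp add: cinner_eq_0_commute)
  next
    case (Cons j \<gamma>)
    have mem: "foldr V \<alpha> l \<in> K" "foldr V \<gamma> l' \<in> K"
      using row_isometry_word_in [OF V] l L by auto
    show ?thesis
      by (simp only: Cons foldr.simps o_apply cinner_row_isometry [OF V mem] Cons.IH) auto
  qed
qed

text \<open>The translates of a wandering copy of \<open>D\<close> have the Gram matrix of the
  elementary tensors, so they span a copy of \<Gamma> \<otimes> D. This provides both the unitary
  behind \<open>Kappa\<close> and the ampliation of a unitary.\<close>

lemma fock_unitary:
  fixes \<kappa> :: "'a::complex_hilbert \<Rightarrow> 'k::complex_hilbert" and V :: "'d \<Rightarrow> 'k \<Rightarrow> 'k"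
  assumes V: "row_isometry K V" and D: "closed_csubspace D"
    and \<kappa>: "isom D \<kappa>" "\<And>\<delta>. \<delta> \<in> D \<Longrightarrow> \<kappa> \<delta> \<in> K"
    and w: "\<And>\<delta> \<delta>' j \<beta>. \<delta> \<in> D \<Longrightarrow> \<delta>' \<in> D \<Longrightarrow> cinner (\<kappa> \<delta>) (V j (foldr V \<beta> (\<kappa> \<delta>'))) = 0"
  obtains U where "unitary_op (Fock D) (closed_cspan (\<Union>\<alpha>. foldr V \<alpha> ` \<kappa> ` D)) U"
    "\<And>\<alpha> \<delta>. \<delta> \<in> D \<Longrightarrow> U (basis_vec \<alpha> \<otimes> \<delta>) = foldr V \<alpha> (\<kappa> \<delta>)"
proof -
  define f where "f = (\<lambda>(\<alpha> :: 'd list, \<delta>). basis_vec \<alpha> \<otimes> \<delta> :: ('d, 'a) fock)"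
  define g where "g = (\<lambda>(\<alpha>, \<delta>). foldr V \<alpha> (\<kappa> \<delta>))"
  have gram: "cinner (f p) (f q) = cinner (g p) (g q)" if pq: "p \<in> UNIV \<times> D" "q \<in> UNIV \<times> D" for p q
  proof -
    obtain \<alpha> \<delta> \<beta> \<epsilon> where [simp]: "p = (\<alpha>, \<delta>)" "q = (\<beta>, \<epsilon>)" and d: "\<delta> \<in> D" "\<epsilon> \<in> D"
      using pq by (cases p; cases q) auto
    have "cinner (foldr V \<alpha> (\<kappa> \<delta>)) (foldr V \<beta> (\<kappa> \<epsilon>)) = (if \<alpha> = \<beta> then cinner (\<kappa> \<delta>) (\<kappa> \<epsilon>) else 0)"
      by (rule cinner_wandering_words [OF V, of "\<kappa> ` D"]) (use \<kappa>(2) w d in auto)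
    then show ?thesis
      using d by (simp add: f_def g_def cinner_basis_tensor_left coord_basis_tensor isomD [OF \<kappa>(1)])
  qed
  obtain U where U: "unitary_op (closed_cspan (f ` (UNIV \<times> D))) (closed_cspan (g ` (UNIV \<times> D))) U"
    "\<And>p. p \<in> UNIV \<times> D \<Longrightarrow> U (f p) = g p"
    using gram_unitary [of "UNIV \<times> D" f g] gram by blast
  have "g ` (UNIV \<times> D) = (\<Union>\<alpha>. foldr V \<alpha> ` \<kappa> ` D)"
    by (force simp: g_def)
  moreover have "U (basis_vec \<alpha> \<otimes> \<delta>) = foldr V \<alpha> (\<kappa> \<delta>)" if "\<delta> \<in> D" for \<alpha> \<delta>
    using U(2) [of "(\<alpha>, \<delta>)"] that by (simp add: f_def g_def)
  ultimately show thesis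
    using that U(1) by (simp add: f_def Fock_eq_cspan_basis [OF D])
qed

lemma fock_intertwine:
  assumes V: "row_isometry K V" and K: "closed_csubspace K" and D: "closed_csubspace D"
    and U: "bounded_op (Fock D) K U"
    and gen: "\<And>\<alpha> \<delta>. \<delta> \<in> D \<Longrightarrow> U (basis_vec \<alpha> \<otimes> \<delta>) = foldr V \<alpha> (\<kappa> \<delta>)"
    and \<xi>: "\<xi> \<in> Fock D"
  shows "U (creation j \<xi>) = V j (U \<xi>)"
proof (rule bounded_op_eq_on_Fock [OF bounded_op_comp [OF _ U]
        bounded_op_comp [OF U row_isometry_bounded_op [OF V K]] D])
  show "bounded_op (Fock D) (Fock D) (creation j)"
    by (intro row_isometry_bounded_op row_isometry_creation closed_csubspace_Fock D)
qed (use \<xi> in \<open>auto simp: creation_basis_tensor gen\<close>)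

section \<open>Row contractions and their defects\<close>

lemma cinner_vec_sum: "cinner x y = (\<Sum>i\<in>UNIV. cinner (x $ i) (y $ i))"
  for x y :: "'a::complex_hilbert ^ 'd::finite"
  by (simp add: cinner_vec_def)

lemma axis_in_copies: "closed_csubspace H \<Longrightarrow> x \<in> H \<Longrightarrow> axis j x \<in> copies H"
  by (simp add: copies_def axis_def csubspace_0)

lemma copies_eq_sum_axis: "x = (\<Sum>j\<in>UNIV. axis j (x $ j))" for x :: "'a::complex_hilbert ^ 'd::finite"
  by (simp add: vec_eq_iff axis_def)

text \<open>A row and its adjoint column have the same norm. The definition speaks of T T*, whereas
  contractivity of a compression is visible on the row itself.\<close>

lemma row_contractionI:
  fixes T :: "'d::finite \<Rightarrow> 'h::complex_hilbert \<Rightarrow> 'h"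
  assumes H: "closed_csubspace H" and T: "\<And>j. bounded_op H H (T j)"
    and contr: "\<And>x. x \<in> copies H \<Longrightarrow> norm (\<Sum>j\<in>UNIV. T j (x $ j)) \<le> norm x"
  shows "row_contraction H T"
proof -
  \<comment> \<open>The adjoint of the row operator, written as a column.\<close>
  define y where "y x = (\<chi> j. adj H (T j) x)" for x
  have yH: "y x \<in> copies H" for x
    by (simp add: y_def copies_def adj_in [OF T H])
  have cy: "cinner x (\<Sum>j\<in>UNIV. T j (adj H (T j) x)) = cinner (y x) (y x)" for x
    by (simp add: cinner_vec_sum y_def cinner_sum_right cinner_adj_left [OF T H] adj_in [OF T H])
  have ynorm: "norm (y x) \<le> norm x" for x
  proof -
    have "(norm (y x))\<^sup>2 = inner x (\<Sum>j\<in>UNIV. T j (adj H (T j) x))"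
      using cy [of x] by (metis Re_cinner power2_norm_eq_inner)
    also have "\<dots> \<le> norm x * norm (\<Sum>j\<in>UNIV. T j (adj H (T j) x))"
      by (rule norm_cauchy_schwarz)
    also have "\<dots> \<le> norm x * norm (y x)"
      using contr [OF yH [of x]] by (intro mult_left_mono) (simp_all add: y_def)
    finally show ?thesis
      by (cases "y x = 0") (auto simp: power2_eq_square)
  qed
  have "positive_op H (\<lambda>x. x - (\<Sum>j\<in>UNIV. T j (adj H (T j) x)))"
    unfolding positive_op_def
  proof
    have "norm (x - (\<Sum>j\<in>UNIV. T j (adj H (T j) x))) \<le> 2 * norm x" for x
      using norm_triangle_ineq4 [of x "\<Sum>j\<in>UNIV. T j (adj H (T j) x)"] contr [OF yH [of x]] ynorm [of x]
      by (simp add: y_def)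
    moreover have "x - (\<Sum>j\<in>UNIV. T j (adj H (T j) x)) \<in> H" if "x \<in> H" for x
      by (intro csubspace_diff H that csubspace_sum bounded_op_in [OF T] adj_in [OF T H])
    ultimately show "bounded_op H H (\<lambda>x. x - (\<Sum>j\<in>UNIV. T j (adj H (T j) x)))"
      unfolding bounded_op_def
      by (auto simp: bounded_op_add [OF bounded_op_adj [OF T H]] bounded_op_add [OF T] sum.distrib
          bounded_op_scaleC [OF bounded_op_adj [OF T H]] bounded_op_scaleC [OF T] adj_in [OF T H]
          scaleC_diff_right scaleC_sum_right)
    show "\<forall>x\<in>H. cinner x (x - (\<Sum>j\<in>UNIV. T j (adj H (T j) x))) \<in> \<real>\<^sub>\<ge>\<^sub>0"
      using ynorm by (auto simp: cinner_diff_right cy cinner_self_norm complex_nonneg_Reals_iff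
          simp flip: of_real_diff intro: power_mono)
  qed
  then show ?thesis
    using T by (simp add: row_contraction_def)
qed

context
  fixes H :: "'h::complex_hilbert set" and T :: "'d::finite \<Rightarrow> 'h \<Rightarrow> 'h"
  assumes H: "closed_csubspace H" and T: "row_contraction H T"
begin

lemma row_contraction_bounded_op: "bounded_op H H (T j)"
  using T by (simp add: row_contraction_def)

text \<open>The way back from the column to the row: for z = T x the squared norm of
  \<open>z\<close> is <x, T* z>, and the hypothesis bounds T* z by \<open>z\<close>.\<close>

lemma row_contraction_norm_le:
  assumes x: "x \<in> copies H"
  shows "norm (\<Sum>j\<in>UNIV. T j (x $ j)) \<le> norm x"
proof -
  note b = row_contraction_bounded_op
  define z where "z = (\<Sum>j\<in>UNIV. T j (x $ j))"
  define y where "y = (\<chi> j. adj H (T j) z)"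
  have xH: "x $ j \<in> H" for j
    using x by (simp add: copies_def)
  have zH: "z \<in> H"
    unfolding z_def by (intro csubspace_sum H bounded_op_in [OF b] xH)
  have "cinner z (\<Sum>j\<in>UNIV. T j (adj H (T j) z)) = cinner y y"
    by (simp add: cinner_vec_sum y_def cinner_sum_right cinner_adj_left [OF b H] adj_in [OF b H])
  moreover have "cinner z (z - (\<Sum>j\<in>UNIV. T j (adj H (T j) z))) \<in> \<real>\<^sub>\<ge>\<^sub>0"
    using T zH by (auto simp: row_contraction_def positive_op_def)
  ultimately have "(norm y)\<^sup>2 \<le> (norm z)\<^sup>2"
    by (simp add: cinner_diff_right cinner_self_norm complex_nonneg_Reals_iff)
  then have yz: "norm y \<le> norm z"
    by simp
  have "cinner x y = cinner z z"
    by (simp add: cinner_vec_sum y_def cinner_adj_right [OF b H] xH flip: cinner_sum_left z_def)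
  then have "(norm z)\<^sup>2 = inner x y"
    by (metis Re_cinner power2_norm_eq_inner)
  also have "\<dots> \<le> norm x * norm y"
    by (rule norm_cauchy_schwarz)
  also have "\<dots> \<le> norm x * norm z"
    by (intro mult_left_mono yz) simp
  finally show ?thesis
    unfolding z_def [symmetric] by (cases "z = 0") (auto simp: power2_eq_square)
qed

lemma bounded_op_row: "bounded_op (copies H) H (\<lambda>x. \<Sum>j\<in>UNIV. T j (x $ j))"
  unfolding bounded_op_def
proof (intro conjI ballI allI)
  note b = row_contraction_bounded_op
  show "\<exists>K. \<forall>x\<in>copies H. norm (\<Sum>j\<in>UNIV. T j (x $ j)) \<le> K * norm x"
    by (rule exI [of _ 1]) (simp add: row_contraction_norm_le)
qed (auto simp: copies_def scaleC_vec_def sum.distrib scaleC_sum_right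
      bounded_op_add [OF row_contraction_bounded_op] bounded_op_scaleC [OF row_contraction_bounded_op]
      intro!: csubspace_sum [OF H] bounded_op_in [OF row_contraction_bounded_op])

text \<open>The block matrix in \<open>defect_op\<close> is I - T* T for the row T from
  \<open>copies H\<close> to \<open>H\<close>, so \<open>sqrt_op_gram\<close> applies.\<close>

lemma bounded_op_defect_op: "bounded_op (copies H) (copies H) (defect_op H T)"
  and cinner_defect_op: "\<And>x y. x \<in> copies H \<Longrightarrow> y \<in> copies H \<Longrightarrow>
    cinner (defect_op H T x) (defect_op H T y)
      = cinner x y - cinner (\<Sum>j\<in>UNIV. T j (x $ j)) (\<Sum>j\<in>UNIV. T j (y $ j))"
proof -
  note b = row_contraction_bounded_op
  let ?Q = "\<lambda>x :: 'h ^ 'd. \<chi> i. \<Sum>j\<in>UNIV. (if i = j then x $ j else 0) - adj H (T i) (T j (x $ j))"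
  have QX: "?Q x \<in> copies H" if "x \<in> copies H" for x
    unfolding copies_def
    using that by (auto simp: copies_def adj_in [OF b H] csubspace_0 [OF H]
      intro!: csubspace_sum [OF H] csubspace_diff [OF H])
  have Q: "cinner x (?Q y) = cinner x y - cinner (\<Sum>j\<in>UNIV. T j (x $ j)) (\<Sum>j\<in>UNIV. T j (y $ j))"
    if "x \<in> copies H" "y \<in> copies H" for x y
  proof -
    have "x $ i \<in> H" for i
      using that by (simp add: copies_def)
    then show ?thesis
      by (simp add: cinner_vec_sum sum_subtractf cinner_diff_right cinner_sum_right cinner_sum_left
        cinner_adj_right [OF b H]) (rule sum.swap)
  qed
  show "bounded_op (copies H) (copies H) (defect_op H T)"
    unfolding defect_op_def
    by (rule sqrt_op_gram(1) [OF closed_csubspace_copies [OF H] bounded_op_row]) 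
      (simp_all only: row_contraction_norm_le QX Q)
  show "cinner (defect_op H T x) (defect_op H T y)
      = cinner x y - cinner (\<Sum>j\<in>UNIV. T j (x $ j)) (\<Sum>j\<in>UNIV. T j (y $ j))"
    if "x \<in> copies H" "y \<in> copies H" for x y
    unfolding defect_op_def
    by (rule sqrt_op_gram(2) [OF closed_csubspace_copies [OF H] bounded_op_row])
      (simp_all only: row_contraction_norm_le QX Q that)
qed

text \<open>The Gram matrix of the generators of the defect space. Whatever reproduces this formula,
  as \<open>wander\<close> and \<open>coupling.d\<close> do, spans an isometric copy of the defect
  space.\<close>

lemma cinner_defect_op_axis:
  assumes "x \<in> H" "y \<in> H"
  shows "cinner (defect_op H T (axis i x)) (defect_op H T (axis j y))
    = (if i = j then cinner x y else 0) - cinner (T i x) (T j y)"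
proof -
  have "(\<Sum>k\<in>UNIV. T k (axis i z $ k)) = T i z" for i z
  proof -
    have "(\<Sum>k\<in>UNIV. T k (axis i z $ k)) = (\<Sum>k\<in>UNIV. if k = i then T i z else 0)"
      by (rule sum.cong) (auto simp: axis_def bounded_op_0 [OF row_contraction_bounded_op H])
    then show ?thesis
      by simp
  qed
  moreover have "cinner (axis i x) (axis j y) = (if i = j then cinner x y else 0)"
  proof -
    have "cinner (axis i x) (axis j y) = (\<Sum>k\<in>UNIV. if k = i then (if i = j then cinner x y else 0) else 0)"
      unfolding cinner_vec_sum by (rule sum.cong) (auto simp: axis_def)
    then show ?thesis
      by simp
  qed
  ultimately show ?thesis
    using assms by (simp add: cinner_defect_op axis_in_copies [OF H])
qed

lemma closed_csubspace_defect_space: "closed_csubspace (defect_space H T)"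
  using closure_image_eq_cspan [OF closed_csubspace_copies [OF H] bounded_op_defect_op]
  by (simp add: defect_space_def)

lemma defect_op_in: "x \<in> copies H \<Longrightarrow> defect_op H T x \<in> defect_space H T"
  unfolding defect_space_def by (rule subsetD [OF closure_subset imageI])

lemma defect_space_eq_cspan_axis:
  "closed_cspan ((\<lambda>(j, x). defect_op H T (axis j x)) ` (UNIV \<times> H)) = defect_space H T"
proof
  let ?S = "(\<lambda>(j, x). defect_op H T (axis j x)) ` (UNIV \<times> H)"
  show "closed_cspan ?S \<subseteq> defect_space H T"
    by (rule cspan_subset [OF _ closed_csubspace_defect_space])
      (auto intro!: defect_op_in axis_in_copies H)
  have "defect_op H T x \<in> closed_cspan ?S" if x: "x \<in> copies H" for x
  proof -
    have a: "axis j (x $ j) \<in> copies H" for j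
      by (rule axis_in_copies [OF H]) (use x in \<open>simp add: copies_def\<close>)
    have "defect_op H T x = (\<Sum>j\<in>UNIV. defect_op H T (axis j (x $ j)))"
      by (subst copies_eq_sum_axis)
        (simp add: bounded_op_sum [OF bounded_op_defect_op closed_csubspace_copies [OF H]] a)
    also have "\<dots> \<in> closed_cspan ?S"
      by (rule csubspace_sum [OF closed_csubspace_cspan], rule cspan_inc)
        (use x in \<open>auto simp: copies_def\<close>)
    finally show ?thesis .
  qed
  then show "defect_space H T \<subseteq> closed_cspan ?S"
    unfolding defect_space_def
    by (intro closure_minimal image_subsetI csubspace_closed closed_csubspace_cspan)
qed

lemma bounded_op_maps_defect_space:
  assumes f: "bounded_op (defect_space H T) Y f" and Z: "closed_csubspace Z"
    and gen: "\<And>j x. x \<in> H \<Longrightarrow> f (defect_op H T (axis j x)) \<in> Z" and \<delta>: "\<delta> \<in> defect_space H T"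
  shows "f \<delta> \<in> Z"
  by (rule bounded_op_maps_cspan [OF f closed_csubspace_defect_space _ Z, OF _ _ \<delta> [folded defect_space_eq_cspan_axis]])
    (auto simp: defect_op_in axis_in_copies [OF H] gen)

lemma bounded_op_eq_on_defect_space:
  assumes f: "bounded_op (defect_space H T) F f" and g: "bounded_op (defect_space H T) G g"
    and gen: "\<And>j x. x \<in> H \<Longrightarrow> f (defect_op H T (axis j x)) = g (defect_op H T (axis j x))"
    and \<delta>: "\<delta> \<in> defect_space H T"
  shows "f \<delta> = g \<delta>"
  by (rule bounded_op_eq_on_cspan [OF f g closed_csubspace_defect_space, OF _ _ \<delta> [folded defect_space_eq_cspan_axis]])
    (auto simp: defect_op_in axis_in_copies [OF H] gen)

end

section \<open>Isometric dilations\<close>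

text \<open>By \<open>coinvariant\<close> the adjoint of V_j acts on the copy of \<open>H\<close> as
  the adjoint of T_j; iterated, this contains the compression formula for all words. The embedding
  is general because \<open>C\<close> is also dilated inside the dilation space of a
  lifting.\<close>

locale dilation =
  fixes H :: "'h::complex_hilbert set" and T :: "'d::finite \<Rightarrow> 'h \<Rightarrow> 'h"
    and K :: "'k::complex_hilbert set" and V :: "'d \<Rightarrow> 'k \<Rightarrow> 'k" and emb :: "'h \<Rightarrow> 'k"
  assumes H: "closed_csubspace H" and T: "row_contraction H T"
    and K: "closed_csubspace K" and V: "row_isometry K V"
    and emb: "isom H emb" and emb_in: "\<And>h. h \<in> H \<Longrightarrow> emb h \<in> K"
    and coinvariant: "\<And>j h x. h \<in> H \<Longrightarrow> x \<in> K \<Longrightarrow>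
      cinner (emb h) (V j x) = cinner (emb (adj H (T j) h)) x"
begin

text \<open>The component of \<open>V j (emb x)\<close> orthogonal to the copy of \<open>H\<close>,
  and the value that \<open>kappa\<close> must take at
  \<open>defect_op H T (axis j x)\<close>.\<close>

definition wander :: "'d \<Rightarrow> 'h \<Rightarrow> 'k"
  where "wander j x = V j (emb x) - emb (T j x)"

lemma T_op: "bounded_op H H (T j)"
  by (rule row_contraction_bounded_op [OF H T])

lemma T_in: "x \<in> H \<Longrightarrow> T j x \<in> H"
  by (rule bounded_op_in [OF T_op])

lemma adj_T_in: "adj H (T j) x \<in> H"
  by (rule adj_in [OF T_op H])

lemma V_emb_in: "x \<in> H \<Longrightarrow> V j (emb x) \<in> K"
  by (rule row_isometry_in [OF V emb_in])

lemma wander_in: "x \<in> H \<Longrightarrow> wander j x \<in> K"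
  unfolding wander_def by (rule csubspace_diff [OF K V_emb_in emb_in [OF T_in]])

lemma cinner_emb_V_emb:
  assumes "g \<in> H" "x \<in> H"
  shows "cinner (emb g) (V j (emb x)) = cinner g (T j x)"
  using assms by (simp add: coinvariant emb_in isomD [OF emb] adj_T_in cinner_adj_left [OF T_op H])

lemma cinner_emb_wander: "g \<in> H \<Longrightarrow> x \<in> H \<Longrightarrow> cinner (emb g) (wander j x) = 0"
  by (simp add: wander_def cinner_diff_right cinner_emb_V_emb isomD [OF emb] T_in)

lemma cinner_wander:
  assumes x: "x \<in> H" and y: "y \<in> H"
  shows "cinner (wander i x) (wander j y)
    = cinner (defect_op H T (axis i x)) (defect_op H T (axis j y))"
proof -
  have "cinner (wander i x) (wander j y) = cinner (V i (emb x)) (wander j y)"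
    unfolding wander_def [of i x] using x y by (simp add: cinner_diff_left cinner_emb_wander T_in)
  also have "\<dots> = (if i = j then cinner x y else 0) - cinner (V i (emb x)) (emb (T j y))"
    using x y by (simp add: wander_def cinner_diff_right cinner_row_isometry [OF V] emb_in isomD [OF emb])
  also have "cinner (V i (emb x)) (emb (T j y)) = cinner (T i x) (T j y)"
    using cinner_emb_V_emb [OF T_in [OF y, of j] x, of i] by (metis cinner_commute)
  finally show ?thesis
    using x y by (simp add: cinner_defect_op_axis [OF H T])
qed

text \<open>A vector of the wandering subspace that is orthogonal to all \<open>wander j x\<close>
  is orthogonal to the copy of \<open>H\<close> too, hence to all \<open>V j (emb x)\<close>, hence
  to itself.\<close>

lemma wandering_eq: "wandering H emb V = closed_cspan ((\<lambda>(j, x). wander j x) ` (UNIV \<times> H))"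
proof -
  let ?S = "emb ` H \<union> (\<Union>j. V j ` emb ` H)" and ?W = "(\<lambda>(j, x). wander j x) ` (UNIV \<times> H)"
  have W: "?W \<subseteq> wandering H emb V"
  proof clarify
    fix j x assume x: "x \<in> H"
    have "V j (emb x) \<in> closed_cspan ?S" "emb (T j x) \<in> closed_cspan ?S"
      by (intro cspan_inc; use x T_in in blast)+
    then have "wander j x \<in> closed_cspan ?S"
      unfolding wander_def by (rule csubspace_diff [OF closed_csubspace_cspan])
    then show "wander j x \<in> wandering H emb V"
      using x by (auto simp: wandering_def ortho_diff_def cinner_emb_wander)
  qed
  have cl: "closed_csubspace (wandering H emb V)"
    unfolding wandering_def by (intro closed_csubspace_ortho_diff closed_csubspace_cspan)
  show ?thesis
  proof (rule cspan_eqI [OF cl W, symmetric])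
    fix z assume z: "z \<in> wandering H emb V" and 0: "\<And>s. s \<in> ?W \<Longrightarrow> cinner s z = 0"
    have e: "cinner (emb x) z = 0" if "x \<in> H" for x
      using z that by (simp add: wandering_def ortho_diff_def)
    have v: "cinner (V j (emb x)) z = 0" if "x \<in> H" for j x
    proof -
      have "cinner (wander j x) z = 0"
        using that by (intro 0) auto
      then show ?thesis
        using e [OF T_in [OF that]] by (simp add: wander_def cinner_diff_left)
    qed
    have "cinner z z = 0"
    proof (rule cinner_cspan_eq_0)
      show "z \<in> closed_cspan ?S"
        using z by (simp add: wandering_def ortho_diff_def)
    qed (use e v in auto)
    then show "z = 0"
      by simp
  qed
qed

lemma wandering_subset: "wandering H emb V \<subseteq> K"
  unfolding wandering_eq by (rule cspan_subset [OF _ K]) (auto simp: wander_in)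

text \<open>Settles the choice in \<open>kappa\<close>: by \<open>cinner_wander\<close> the defects
  and the vectors \<open>wander j x\<close> have the same Gram matrix.\<close>

lemma kappa_props:
  "unitary_op (defect_space H T) (wandering H emb V) (kappa H T emb V) \<and>
    (\<forall>\<xi>\<in>copies H. kappa H T emb V (defect_op H T \<xi>)
      = (\<Sum>i\<in>UNIV. V i (emb (\<xi> $ i)) - emb (T i (\<xi> $ i))))"
proof -
  obtain \<kappa> where \<kappa>: "unitary_op (defect_space H T) (wandering H emb V) \<kappa>"
    and eq: "\<And>j x. x \<in> H \<Longrightarrow> \<kappa> (defect_op H T (axis j x)) = wander j x"
  proof -
    let ?f = "\<lambda>(j, x). defect_op H T (axis j x)" and ?g = "\<lambda>(j, x). wander j x"
    obtain u where "unitary_op (closed_cspan (?f ` (UNIV \<times> H))) (closed_cspan (?g ` (UNIV \<times> H))) u"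
      "\<And>p. p \<in> UNIV \<times> H \<Longrightarrow> u (?f p) = ?g p"
      by (rule gram_unitary [of "UNIV \<times> H" ?f ?g]) (auto simp: cinner_wander)
    then show thesis
      by (intro that [of u]) (auto simp: wandering_eq defect_space_eq_cspan_axis [OF H T])
  qed
  have "\<kappa> (defect_op H T \<xi>) = (\<Sum>i\<in>UNIV. V i (emb (\<xi> $ i)) - emb (T i (\<xi> $ i)))"
    if \<xi>: "\<xi> \<in> copies H" for \<xi>
  proof -
    have a: "axis j (\<xi> $ j) \<in> copies H" and \<xi>j: "\<xi> $ j \<in> H" for j
      using \<xi> axis_in_copies [OF H] by (auto simp: copies_def)
    have "\<kappa> (defect_op H T \<xi>) = \<kappa> (defect_op H T (\<Sum>j\<in>UNIV. axis j (\<xi> $ j)))"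
      by (simp flip: copies_eq_sum_axis)
    also have "\<dots> = \<kappa> (\<Sum>j\<in>UNIV. defect_op H T (axis j (\<xi> $ j)))"
      by (simp add: bounded_op_sum [OF bounded_op_defect_op [OF H T] closed_csubspace_copies [OF H]] a)
    also have "\<dots> = (\<Sum>j\<in>UNIV. wander j (\<xi> $ j))"
      by (subst bounded_op_sum [OF unitary_opD(3) [OF \<kappa>] closed_csubspace_defect_space [OF H T]])
        (simp_all add: defect_op_in [OF H T] a eq \<xi>j)
    finally show ?thesis
      by (simp add: wander_def)
  qed
  with \<kappa> have "\<exists>\<kappa>. unitary_op (defect_space H T) (wandering H emb V) \<kappa> \<and>
    (\<forall>\<xi>\<in>copies H. \<kappa> (defect_op H T \<xi>) = (\<Sum>i\<in>UNIV. V i (emb (\<xi> $ i)) - emb (T i (\<xi> $ i))))"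
    by blast
  then show ?thesis
    unfolding kappa_def by (rule someI_ex)
qed

abbreviation "\<kappa> \<equiv> kappa H T emb V"
abbreviation "\<K> \<equiv> Kappa H T emb V"
abbreviation "\<L> \<equiv> defect_space H T"

lemma closed_csubspace_L: "closed_csubspace \<L>"
  by (rule closed_csubspace_defect_space [OF H T])

lemma kappa_isom: "isom \<L> \<kappa>"
  and kappa_image: "\<kappa> ` \<L> = wandering H emb V"
  and kappa_in_wandering: "\<delta> \<in> \<L> \<Longrightarrow> \<kappa> \<delta> \<in> wandering H emb V"
  and kappa_in: "\<delta> \<in> \<L> \<Longrightarrow> \<kappa> \<delta> \<in> K"
  using kappa_props wandering_subset unitary_opD by blast+

lemma kappa_axis:
  assumes "x \<in> H"
  shows "\<kappa> (defect_op H T (axis j x)) = wander j x"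
proof -
  have "\<kappa> (defect_op H T (axis j x)) = (\<Sum>i\<in>UNIV. V i (emb (axis j x $ i)) - emb (T i (axis j x $ i)))"
    using kappa_props axis_in_copies [OF H assms] by blast
  also have "\<dots> = (\<Sum>i\<in>UNIV. if i = j then wander j x else 0)"
  proof (rule sum.cong [OF refl])
    fix i
    have "bounded_op H K emb"
      by (rule isom_bounded_op [OF H emb emb_in])
    then have "emb 0 = 0" "V i 0 = 0" "T i 0 = 0"
      using bounded_op_0 H K T_op row_isometry_bounded_op [OF V K] by blast+
    then show "V i (emb (axis j x $ i)) - emb (T i (axis j x $ i)) = (if i = j then wander j x else 0)"
      by (simp add: axis_def wander_def)
  qed
  finally show ?thesis
    by simp
qed

text \<open>By coinvariance each letter of the word moves onto \<open>h\<close> as an adjoint, until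
  only a vector of the wandering subspace is left.\<close>

lemma cinner_emb_word:
  assumes "h \<in> H" "\<delta> \<in> \<L>"
  shows "cinner (emb h) (foldr V \<beta> (\<kappa> \<delta>)) = 0"
  using assms(1)
proof (induction \<beta> arbitrary: h)
  case Nil
  then show ?case
    using kappa_in_wandering [OF assms(2)] by (simp add: wandering_def ortho_diff_def)
next
  case (Cons j \<beta>)
  then show ?case
    by (simp add: coinvariant row_isometry_word_in [OF V kappa_in [OF assms(2)]] adj_T_in)
qed

text \<open>It suffices to test \<open>wander i x\<close>. The row isometry strips a letter from its
  first term and coinvariance from its second, and both reduce to
  \<open>cinner_emb_word\<close>.\<close>

lemma cinner_kappa_word:
  assumes \<delta>: "\<delta> \<in> \<L>" and \<delta>': "\<delta>' \<in> \<L>"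
  shows "cinner (\<kappa> \<delta>) (V j (foldr V \<beta> (\<kappa> \<delta>'))) = 0"
proof (rule cinner_cspan_eq_0)
  let ?w = "foldr V \<beta> (\<kappa> \<delta>')"
  show "\<kappa> \<delta> \<in> closed_cspan ((\<lambda>(j, x). wander j x) ` (UNIV \<times> H))"
    using kappa_in_wandering [OF \<delta>] by (simp add: wandering_eq)
  have w: "?w \<in> K"
    by (rule row_isometry_word_in [OF V kappa_in [OF \<delta>']])
  have "cinner (wander i x) (V j ?w) = 0" if "x \<in> H" for i x
    using that w by (simp add: wander_def cinner_diff_left cinner_row_isometry [OF V] emb_in
        cinner_emb_word \<delta>' coinvariant T_in adj_T_in)
  then show "\<And>s. s \<in> (\<lambda>(j, x). wander j x) ` (UNIV \<times> H) \<Longrightarrow> cinner s (V j ?w) = 0"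
    by auto
qed

lemma Kappa_props:
  "unitary_op (Fock \<L>) (wandering_sum H emb V) \<K> \<and>
    (\<forall>\<alpha>. \<forall>\<delta>\<in>\<L>. \<K> (foldr creation \<alpha> (vacuum \<otimes> \<delta>)) = foldr V \<alpha> (\<kappa> \<delta>))"
proof -
  obtain U where "unitary_op (Fock \<L>) (closed_cspan (\<Union>\<alpha>. foldr V \<alpha> ` \<kappa> ` \<L>)) U"
    "\<And>\<alpha> \<delta>. \<delta> \<in> \<L> \<Longrightarrow> U (basis_vec \<alpha> \<otimes> \<delta>) = foldr V \<alpha> (\<kappa> \<delta>)"
    by (rule fock_unitary [OF V closed_csubspace_L kappa_isom kappa_in cinner_kappa_word])
      (blast intro: that)+
  then have "\<exists>K. unitary_op (Fock \<L>) (wandering_sum H emb V) K \<and>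
      (\<forall>\<alpha>. \<forall>\<delta>\<in>\<L>. K (foldr creation \<alpha> (vacuum \<otimes> \<delta>)) = foldr V \<alpha> (\<kappa> \<delta>))"
    by (intro exI [of _ U]) (simp add: wandering_sum_def kappa_image foldr_creation)
  then show ?thesis
    unfolding Kappa_def by (rule someI_ex)
qed

lemma Kappa_unitary: "unitary_op (Fock \<L>) (wandering_sum H emb V) \<K>"
  and Kappa_basis: "\<delta> \<in> \<L> \<Longrightarrow> \<K> (basis_vec \<alpha> \<otimes> \<delta>) = foldr V \<alpha> (\<kappa> \<delta>)"
  using Kappa_props by (auto simp: foldr_creation)

lemma wandering_sum_subset: "wandering_sum H emb V \<subseteq> K"
  unfolding wandering_sum_def
  by (rule cspan_subset [OF _ K]) (use row_isometry_word_in [OF V] wandering_subset in blast)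

lemma Kappa_isom: "isom (Fock \<L>) \<K>"
  and Kappa_in: "\<xi> \<in> Fock \<L> \<Longrightarrow> \<K> \<xi> \<in> K"
  using unitary_opD [OF Kappa_unitary] wandering_sum_subset by auto

lemma Kappa_op: "bounded_op (Fock \<L>) K \<K>"
  by (rule isom_bounded_op [OF closed_csubspace_Fock [OF closed_csubspace_L] Kappa_isom Kappa_in])

lemma Kappa_creation: "\<xi> \<in> Fock \<L> \<Longrightarrow> \<K> (creation j \<xi>) = V j (\<K> \<xi>)"
  by (rule fock_intertwine [OF V K closed_csubspace_L Kappa_op Kappa_basis])

text \<open>Inside every such dilation, \<open>emb\<close> and \<open>\<K>\<close> form a copy of
  the minimal isometric dilation of \<open>T\<close>. This is its defining formula, which a coupling
  demands as \<open>V_e\<close>.\<close>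

lemma V_emb:
  assumes "h \<in> H"
  shows "V j (emb h) = emb (T j h) + \<K> (vacuum \<otimes> defect_op H T (axis j h))"
proof -
  have "defect_op H T (axis j h) \<in> \<L>"
    by (rule defect_op_in [OF H T axis_in_copies [OF H assms]])
  then show ?thesis
    using Kappa_basis [of _ "[]"] assms by (simp add: vacuum_def kappa_axis wander_def)
qed

lemma cinner_emb_Kappa:
  assumes h: "h \<in> H" and \<xi>: "\<xi> \<in> Fock \<L>"
  shows "cinner (emb h) (\<K> \<xi>) = 0"
proof -
  have "cinner (\<K> \<xi>) (emb h) = 0"
  proof (rule cinner_cspan_eq_0)
    show "\<K> \<xi> \<in> closed_cspan (\<Union>\<alpha>. foldr V \<alpha> ` wandering H emb V)"
      using unitary_opD(4) [OF Kappa_unitary \<xi>] by (simp add: wandering_sum_def)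
    show "cinner s (emb h) = 0" if "s \<in> (\<Union>\<alpha>. foldr V \<alpha> ` wandering H emb V)" for s
      using that cinner_emb_word [OF h] by (auto simp flip: kappa_image simp: cinner_eq_0_commute)
  qed
  then show ?thesis
    by (simp add: cinner_eq_0_commute)
qed

end

section \<open>Couplings\<close>

text \<open>Linearity, contractivity and the intertwining property of \<open>M\<close> are not
  assumed: \<open>c_k\<close> makes it the compression c* k of one isometry by another, from which
  they follow. The copies of \<Gamma> \<otimes> D_C and \<Gamma> \<otimes> D may stand at any angle,
  measured by \<open>M\<close>, while H_C is orthogonal to both.\<close>

locale coupling =
  fixes HC :: "'c::complex_hilbert set" and C :: "'d::finite \<Rightarrow> 'c \<Rightarrow> 'c"
    and D :: "'x::complex_hilbert set" and M :: "('d, 'x) fock \<Rightarrow> ('d, 'c ^ 'd) fock"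
    and K :: "'k::complex_hilbert set" and V :: "'d \<Rightarrow> 'k \<Rightarrow> 'k"
    and e :: "'c \<Rightarrow> 'k" and c :: "('d, 'c ^ 'd) fock \<Rightarrow> 'k" and k :: "('d, 'x) fock \<Rightarrow> 'k"
  assumes HC: "closed_csubspace HC" and C: "row_contraction HC C" and D: "closed_csubspace D"
    and K: "closed_csubspace K" and V: "row_isometry K V"
    and e: "isom HC e" "\<And>h. h \<in> HC \<Longrightarrow> e h \<in> K"
    and c: "isom (Fock (defect_space HC C)) c" "\<And>\<eta>. \<eta> \<in> Fock (defect_space HC C) \<Longrightarrow> c \<eta> \<in> K"
    and k: "isom (Fock D) k" "\<And>\<xi>. \<xi> \<in> Fock D \<Longrightarrow> k \<xi> \<in> K"
    and e_c: "\<And>h \<eta>. h \<in> HC \<Longrightarrow> \<eta> \<in> Fock (defect_space HC C) \<Longrightarrow> cinner (e h) (c \<eta>) = 0"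
    and e_k: "\<And>h \<xi>. h \<in> HC \<Longrightarrow> \<xi> \<in> Fock D \<Longrightarrow> cinner (e h) (k \<xi>) = 0"
    and M_in: "\<And>\<xi>. \<xi> \<in> Fock D \<Longrightarrow> M \<xi> \<in> Fock (defect_space HC C)"
    and c_k: "\<And>\<eta> \<xi>. \<eta> \<in> Fock (defect_space HC C) \<Longrightarrow> \<xi> \<in> Fock D \<Longrightarrow>
      cinner (c \<eta>) (k \<xi>) = cinner \<eta> (M \<xi>)"
    and V_e: "\<And>j h. h \<in> HC \<Longrightarrow> V j (e h) = e (C j h) + c (vacuum \<otimes> defect_op HC C (axis j h))"
    and V_c: "\<And>j \<eta>. \<eta> \<in> Fock (defect_space HC C) \<Longrightarrow> V j (c \<eta>) = c (creation j \<eta>)"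
    and V_k: "\<And>j \<xi>. \<xi> \<in> Fock D \<Longrightarrow> V j (k \<xi>) = k (creation j \<xi>)"
    and generate: "closed_cspan (e ` HC \<union> c ` Fock (defect_space HC C) \<union> k ` Fock D) = K"
begin

abbreviation L :: "('c ^ 'd) set" where "L \<equiv> defect_space HC C"

abbreviation R :: "'k set" where "R \<equiv> K \<ominus> k ` Fock D"

definition T :: "'d \<Rightarrow> 'k \<Rightarrow> 'k" where "T j x = proj R (V j x)"

section \<open>The residual space and the compressed row\<close>

lemma L: "closed_csubspace L"
  by (rule closed_csubspace_defect_space [OF HC C])

lemma FL: "closed_csubspace (Fock L :: ('d, 'c ^ 'd) fock set)"
  by (rule closed_csubspace_Fock [OF L])

lemma FD: "closed_csubspace (Fock D :: ('d, 'x) fock set)"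
  by (rule closed_csubspace_Fock [OF D])

lemma R: "closed_csubspace R"
  by (rule closed_csubspace_ortho_diff [OF K])

lemma W: "closed_csubspace (k ` Fock D)"
  by (rule closed_csubspace_isom_image [OF FD k(1)])

lemma T_in: "T j x \<in> R"
  by (simp add: T_def proj_in [OF R])

lemma R_sub: "x \<in> R \<Longrightarrow> x \<in> K"
  by (simp add: ortho_diff_def)

lemma V_in: "x \<in> K \<Longrightarrow> V j x \<in> K"
  by (rule row_isometry_in [OF V])

lemma V_op: "bounded_op K K (V j)"
  by (rule row_isometry_bounded_op [OF V K])

lemma C_in: "h \<in> HC \<Longrightarrow> C j h \<in> HC"
  by (rule bounded_op_in [OF row_contraction_bounded_op [OF HC C]])

lemma defect_axis_in: "h \<in> HC \<Longrightarrow> defect_op HC C (axis j h) \<in> L"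
  by (rule defect_op_in [OF HC C axis_in_copies [OF HC]])

lemma vac_defect_in: "h \<in> HC \<Longrightarrow> vacuum \<otimes> defect_op HC C (axis j h) \<in> Fock L"
  by (rule vacuum_tensor_in_Fock [OF L defect_axis_in])

lemma e_op: "bounded_op HC K e" and c_op: "bounded_op (Fock L) K c" and k_op: "bounded_op (Fock D) K k"
  using isom_bounded_op [OF HC e] isom_bounded_op [OF FL c] isom_bounded_op [OF FD k] by auto

lemma e_in_R: "h \<in> HC \<Longrightarrow> e h \<in> R"
  by (auto simp: ortho_diff_def e(2) e_k cinner_eq_0_commute)

lemma cinner_R_k: "x \<in> R \<Longrightarrow> \<xi> \<in> Fock D \<Longrightarrow> cinner (k \<xi>) x = 0"
  by (auto simp: ortho_diff_def)

lemma cinner_k_R: "x \<in> R \<Longrightarrow> \<xi> \<in> Fock D \<Longrightarrow> cinner x (k \<xi>) = 0"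
  using cinner_R_k by (simp add: cinner_eq_0_commute [of x])

lemma proj_R_diff:
  assumes x: "x \<in> K"
  shows "x - proj R x \<in> k ` Fock D"
proof -
  let ?p = "proj (k ` Fock D) x"
  have p: "?p \<in> k ` Fock D" "?p \<in> K"
    using proj_in [OF W, of x] k(2) by auto
  have "proj R x = x - ?p"
  proof (rule proj_eqI [OF R])
    show "x - ?p \<in> R"
      using cinner_proj_diff [OF W] csubspace_diff [OF K x p(2)] by (simp add: ortho_diff_def)
    show "cinner z (x - (x - ?p)) = 0" if "z \<in> R" for z
      using that p(1) by (auto simp: cinner_k_R)
  qed
  then show ?thesis
    using p by simp
qed

lemma proj_R_k: "\<xi> \<in> Fock D \<Longrightarrow> proj R (k \<xi>) = 0"
  by (rule proj_eqI [OF R]) (simp_all add: csubspace_0 [OF R] cinner_k_R)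

lemma decompose:
  assumes "x \<in> K"
  obtains y \<xi> where "y \<in> R" "\<xi> \<in> Fock D" "x = y + k \<xi>" "proj R x = y"
proof -
  obtain \<xi> where "\<xi> \<in> Fock D" "x - proj R x = k \<xi>"
    using proj_R_diff [OF assms] by blast
  then show thesis
    using that [of "proj R x" \<xi>] proj_in [OF R, of x] by (metis add.commute diff_add_cancel)
qed

text \<open>The image of \<open>k\<close> is invariant under V, hence its complement
  \<open>R\<close> is coinvariant; this makes compression compatible with products, see
  \<open>T_word\<close>.\<close>

lemma proj_R_V:
  assumes "x \<in> K"
  shows "proj R (V j x) = T j (proj R x)"
proof -
  obtain y \<xi> where x: "y \<in> R" "\<xi> \<in> Fock D" "x = y + k \<xi>" "proj R x = y"
    using decompose [OF assms] .
  have "V j x = V j y + k (creation j \<xi>)"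
    using x R_sub k(2) by (simp add: bounded_op_add [OF V_op] V_k)
  then show ?thesis
    unfolding x(4) using x(2) by (simp add: T_def proj_add [OF R] proj_R_k creation_in_Fock [OF D])
qed

text \<open>For \<open>x\<close> in \<open>R\<close> the vector V_j x is orthogonal to every V_i k
  \<eta>, that is, to k of each creation range. What remains of it along \<open>k\<close> is
  therefore a vacuum vector.\<close>

lemma V_split:
  assumes x: "x \<in> R"
  shows "\<exists>\<delta>\<in>D. V j x = T j x + k (vacuum \<otimes> \<delta>)"
proof -
  obtain \<xi> where \<xi>: "\<xi> \<in> Fock D" "V j x = T j x + k \<xi>"
    using decompose [OF V_in [OF R_sub [OF x]], of j] by (metis T_def)
  have "cinner (creation i \<eta>) \<xi> = 0" if \<eta>: "\<eta> \<in> Fock D" for i \<eta>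
  proof -
    have "cinner (creation i \<eta>) \<xi> = cinner (k (creation i \<eta>)) (k \<xi>)"
      by (simp add: isomD [OF k(1)] creation_in_Fock [OF D] \<eta> \<xi>)
    also have "k \<xi> = V j x - T j x"
      by (simp add: \<xi>)
    also have "cinner (k (creation i \<eta>)) (V j x - T j x) = cinner (V i (k \<eta>)) (V j x)"
      by (simp add: cinner_diff_right V_k [OF \<eta>] cinner_R_k [OF T_in] creation_in_Fock [OF D] \<eta>)
    also have "\<dots> = 0"
      by (simp add: cinner_row_isometry [OF V] k(2) \<eta> R_sub x cinner_R_k)
    finally show ?thesis .
  qed
  then have "\<xi> = vacuum \<otimes> coord \<xi> []"
    by (intro Fock_orthogonal_creation [OF D \<xi>(1)])
  moreover have "coord \<xi> [] \<in> D"
    using \<xi>(1) by (simp add: Fock_def)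
  ultimately show ?thesis
    using \<xi>(2) by metis
qed

text \<open>The part of V_j x that the compression discards, in the role of the defect operator at
  \<open>axis j x\<close>. It is unique, because \<open>k\<close> and the vacuum embedding are
  isometric.\<close>

definition d :: "'d \<Rightarrow> 'k \<Rightarrow> 'x"
  where "d j x = (SOME \<delta>. \<delta> \<in> D \<and> V j x = T j x + k (vacuum \<otimes> \<delta>))"

lemma d_in: "x \<in> R \<Longrightarrow> d j x \<in> D"
  and V_R: "x \<in> R \<Longrightarrow> V j x = T j x + k (vacuum \<otimes> d j x)"
  using someI_ex [OF V_split [unfolded Bex_def], of x j] by (auto simp: d_def)

lemma vac_in: "\<delta> \<in> D \<Longrightarrow> vacuum \<otimes> \<delta> \<in> Fock D"
  by (rule vacuum_tensor_in_Fock [OF D])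

lemma cinner_d:
  assumes x: "x \<in> R" and y: "y \<in> R"
  shows "cinner (d i x) (d j y) = (if i = j then cinner x y else 0) - cinner (T i x) (T j y)"
proof -
  have "cinner (V i x) (V j y) = cinner (T i x) (T j y) + cinner (d i x) (d j y)"
    using x y by (simp add: V_R cinner_add_left cinner_add_right cinner_R_k T_in vac_in d_in
        cinner_k_R isomD [OF k(1)] cinner_vacuum_tensor)
  then show ?thesis
    using x y by (simp add: cinner_row_isometry [OF V] R_sub)
qed

section \<open>Words, and minimality of the compression\<close>

lemma V_word_op: "bounded_op K K (foldr V \<alpha>)"
proof (induction \<alpha>)
  case Nil
  then show ?case by (auto simp: bounded_op_def intro!: exI [of _ 1])
next
  case (Cons a \<alpha>)
  then show ?case using bounded_op_comp [OF Cons V_op] by (simp add: o_def)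
qed

lemma basis_op: "bounded_op L (Fock L) (\<lambda>\<delta>. basis_vec \<alpha> \<otimes> \<delta>)"
  using bounded_op_basis_tensor [of \<alpha>] basis_tensor_in_Fock [OF L] by (auto simp: bounded_op_def)

lemma c_basis_in:
  assumes Z: "closed_csubspace Z"
    and gen: "\<And>j h. h \<in> HC \<Longrightarrow> c (basis_vec \<alpha> \<otimes> defect_op HC C (axis j h)) \<in> Z"
    and \<delta>: "\<delta> \<in> L"
  shows "c (basis_vec \<alpha> \<otimes> \<delta>) \<in> Z"
  by (rule bounded_op_maps_defect_space [OF HC C bounded_op_comp [OF basis_op c_op] Z gen \<delta>])

text \<open>By \<open>V_e\<close>, c of a vacuum defect vector is V_j e h - e C_j h, so the image of
  \<open>c\<close> lies in the V-invariant closed subspace generated by the image of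
  \<open>e\<close>.\<close>

lemma e_c_in_cspan:
  assumes Z: "closed_csubspace Z" and sub: "\<And>h \<alpha>. h \<in> HC \<Longrightarrow> foldr V \<alpha> (e h) \<in> Z"
    and \<eta>: "\<eta> \<in> Fock L"
  shows "c \<eta> \<in> Z"
proof -
  have word: "c (basis_vec \<alpha> \<otimes> \<delta>) = foldr V \<alpha> (c (vacuum \<otimes> \<delta>))" if "\<delta> \<in> L" for \<alpha> \<delta>
  proof (induction \<alpha>)
    case (Cons i \<alpha>)
    have "c (creation i (basis_vec \<alpha> \<otimes> \<delta>)) = V i (c (basis_vec \<alpha> \<otimes> \<delta>))"
      by (simp add: V_c basis_tensor_in_Fock [OF L that])
    then show ?case
      by (simp add: Cons creation_basis_tensor)
  qed (simp add: vacuum_def)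
  have gen: "c (basis_vec \<alpha> \<otimes> defect_op HC C (axis j h)) \<in> Z" if h: "h \<in> HC" for \<alpha> j h
  proof -
    have "c (vacuum \<otimes> defect_op HC C (axis j h)) = V j (e h) - e (C j h)"
      by (simp add: V_e h)
    \<comment> \<open>The letter \<open>j\<close> is appended on the right because
      \<open>foldr\<close> applies the last letter first.\<close>
    then have "c (basis_vec \<alpha> \<otimes> defect_op HC C (axis j h)) = foldr V (\<alpha> @ [j]) (e h) - foldr V \<alpha> (e (C j h))"
      by (simp add: word defect_axis_in h bounded_op_diff [OF V_word_op K] V_in e(2) C_in)
    then show ?thesis
      using sub [OF h] sub [OF C_in [OF h]] csubspace_diff [OF Z] by metis
  qed
  note basis = c_basis_in [OF Z gen]
  show ?thesis
    by (rule bounded_op_maps_Fock [OF c_op L Z basis \<eta>])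
qed

lemma V_word_in: "x \<in> K \<Longrightarrow> foldr V \<alpha> x \<in> K"
  by (rule row_isometry_word_in [OF V])

lemma T_word: "x \<in> R \<Longrightarrow> foldr T \<alpha> x = proj R (foldr V \<alpha> x)"
proof (induction \<alpha>)
  case (Cons j \<alpha>)
  then show ?case
    using proj_R_V [OF V_word_in [OF R_sub], of x j \<alpha>] by simp
qed (simp add: proj_ident [OF R])

text \<open>A vector of \<open>R\<close> orthogonal to \<open>Z\<close> is orthogonal to all V-words
  of H_C, since these project to T-words, which lie in \<open>Z\<close>. So it is orthogonal to the
  images of \<open>e\<close> and \<open>c\<close>, and to that of \<open>k\<close> by membership in
  \<open>R\<close>.\<close>

lemma minimal: 
  assumes Z: "closed_csubspace Z" "Z \<subseteq> R" and eZ: "\<And>h. h \<in> HC \<Longrightarrow> e h \<in> Z"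
    and inv: "\<And>j z. z \<in> Z \<Longrightarrow> T j z \<in> Z"
  shows "Z = R"
proof -
  have "closed_cspan Z = R"
  proof (rule cspan_eqI [OF R Z(2)])
    fix x assume x: "x \<in> R" and 0: "\<And>s. s \<in> Z \<Longrightarrow> cinner s x = 0"
    let ?Z = "{y \<in> K. cinner x y = 0}"
    have cl: "closed_csubspace ?Z"
      using closed_csubspace_ortho_diff [OF K, of "{x}"] by (simp add: ortho_diff_def)
    have words: "foldr V \<alpha> (e h) \<in> ?Z" if h: "h \<in> HC" for \<alpha> h
    proof -
      have "foldr T \<alpha> (e h) \<in> Z"
        by (induction \<alpha>) (simp_all add: eZ h inv)
      then have "cinner (proj R (foldr V \<alpha> (e h))) x = 0"
        using 0 T_word [OF e_in_R [OF h]] by simp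
      then have "cinner (foldr V \<alpha> (e h)) x = 0"
        by (simp add: cinner_proj_left [OF R x])
      then show ?thesis
        using V_word_in [OF e(2) [OF h]] by (simp add: cinner_eq_0_commute)
    qed
    have "cinner x x = 0"
    proof (rule cinner_cspan_eq_0)
      show "x \<in> closed_cspan (e ` HC \<union> c ` Fock L \<union> k ` Fock D)"
        using x by (simp add: generate R_sub)
      show "cinner s x = 0" if "s \<in> e ` HC \<union> c ` Fock L \<union> k ` Fock D" for s
        using that e_c_in_cspan [OF cl words] words [of _ "[]"] cinner_R_k [OF x]
        by (auto simp: cinner_eq_0_commute [of _ x])
    qed
    then show "x = 0"
      by simp
  qed
  then show ?thesis
    using hull_same [of closed_csubspace, OF Z(1)] by simp
qed

text \<open>Merges the three generating families into one family of sums, because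
  \<open>gram_unitary\<close> compares two families over a common index set.\<close>

lemma generate_sum:
  "closed_cspan ((\<lambda>(h, \<eta>, \<xi>). e h + c \<eta> + k \<xi>) ` (HC \<times> Fock L \<times> Fock D)) = K"
  (is "closed_cspan (?f ` ?I) = K")
proof
  show "closed_cspan (?f ` ?I) \<subseteq> K"
    by (rule cspan_subset [OF _ K]) (auto intro!: csubspace_add [OF K] e(2) c(2) k(2))
  note z = bounded_op_0 [OF e_op HC] bounded_op_0 [OF c_op FL] bounded_op_0 [OF k_op FD]
    csubspace_0 [OF HC] csubspace_0 [OF FL] csubspace_0 [OF FD]
  have "e h \<in> ?f ` ?I" if "h \<in> HC" for h
    by (rule image_eqI [of _ _ "(h, 0, 0)"]) (simp_all add: z that)
  moreover have "c \<eta> \<in> ?f ` ?I" if "\<eta> \<in> Fock L" for \<eta>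
    by (rule image_eqI [of _ _ "(0, \<eta>, 0)"]) (simp_all add: z that)
  moreover have "k \<xi> \<in> ?f ` ?I" if "\<xi> \<in> Fock D" for \<xi>
    by (rule image_eqI [of _ _ "(0, 0, \<xi>)"]) (simp_all add: z that)
  ultimately have "e ` HC \<union> c ` Fock L \<union> k ` Fock D \<subseteq> ?f ` ?I"
    by blast
  then show "K \<subseteq> closed_cspan (?f ` ?I)"
    using hull_mono [of _ _ closed_csubspace] generate by metis
qed

section \<open>The cross Gramian as a contractive multi-analytic operator\<close>

lemma c_e: "h \<in> HC \<Longrightarrow> \<eta> \<in> Fock L \<Longrightarrow> cinner (c \<eta>) (e h) = 0"
  and k_e: "h \<in> HC \<Longrightarrow> \<xi> \<in> Fock D \<Longrightarrow> cinner (k \<xi>) (e h) = 0"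
  by (simp_all add: cinner_eq_0_commute [of _ "e h"] e_c e_k)

lemma k_c: "\<eta> \<in> Fock L \<Longrightarrow> \<xi> \<in> Fock D \<Longrightarrow> cinner (k \<xi>) (c \<eta>) = cinner (M \<xi>) \<eta>"
  using c_k [of \<eta> \<xi>] by (metis cinner_commute)

lemma M_eqI:
  fixes x y :: "('d, 'c ^ 'd) fock"
  assumes "x \<in> Fock L" "y \<in> Fock L" "\<And>\<eta>. \<eta> \<in> Fock L \<Longrightarrow> cinner \<eta> x = cinner \<eta> y"
  shows "x = y"
  using assms(3) [OF csubspace_diff [OF FL assms(1,2)]] cinner_diff_right [of "x - y" x y] by simp

text \<open>Everything is read off from M = c* k: linearity by testing against \<Gamma> \<otimes>
  D_C, contractivity because both embeddings are isometric.\<close>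

lemma M_op: "bounded_op (Fock D) (Fock L) M"
  and M_norm: "\<xi> \<in> Fock D \<Longrightarrow> norm (M \<xi>) \<le> norm \<xi>"
proof -
  show n: "norm (M \<xi>) \<le> norm \<xi>" if \<xi>: "\<xi> \<in> Fock D" for \<xi>
  proof -
    have "(norm (M \<xi>))\<^sup>2 = Re (cinner (M \<xi>) (M \<xi>))"
      by (simp add: cinner_self_norm)
    also have "\<dots> = inner (c (M \<xi>)) (k \<xi>)"
      by (simp add: Re_cinner [symmetric] c_k M_in \<xi>)
    also have "\<dots> \<le> norm (c (M \<xi>)) * norm (k \<xi>)"
      by (rule norm_cauchy_schwarz)
    also have "\<dots> = norm (M \<xi>) * norm \<xi>"
      by (simp add: isom_norm [OF c(1)] isom_norm [OF k(1)] M_in \<xi>)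
    finally show ?thesis
      by (cases "M \<xi> = 0") (auto simp: power2_eq_square)
  qed
  have "M (x + y) = M x + M y" if "x \<in> Fock D" "y \<in> Fock D" for x y
    using that by (intro M_eqI) (simp_all add: M_in csubspace_add [OF FD] csubspace_add [OF FL]
        cinner_add_right bounded_op_add [OF k_op] flip: c_k)
  moreover have "M (a *\<^sub>C x) = a *\<^sub>C M x" if "x \<in> Fock D" for a x
    using that by (intro M_eqI) (simp_all add: M_in csubspace_scaleC [OF FD] csubspace_scaleC [OF FL]
        cinner_scaleC_right bounded_op_scaleC [OF k_op] flip: c_k)
  ultimately show "bounded_op (Fock D) (Fock L) M"
    unfolding bounded_op_def by (auto simp: M_in intro!: exI [of _ 1] n)
qed

text \<open>The source of multi-analyticity: V_i e h and V_j k \<xi> are orthogonal even for i = j,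
  because \<open>e\<close> and \<open>k\<close> have orthogonal images.\<close>

lemma cinner_c_V_k:
  assumes "h \<in> HC" "\<xi> \<in> Fock D"
  shows "cinner (c (vacuum \<otimes> defect_op HC C (axis i h))) (V j (k \<xi>)) = 0"
proof -
  have "c (vacuum \<otimes> defect_op HC C (axis i h)) = V i (e h) - e (C i h)"
    by (simp add: V_e assms)
  then show ?thesis
    using assms e_k [OF C_in [OF assms(1)] creation_in_Fock [OF D assms(2)], of i j]
    by (simp add: cinner_diff_left cinner_row_isometry [OF V] e(2) k(2) e_k flip: V_k)
qed

lemma M_creation:
  assumes \<xi>: "\<xi> \<in> Fock D"
  shows "M (creation j \<xi>) = creation j (M \<xi>)"
proof (rule M_eqI)
  show "M (creation j \<xi>) \<in> Fock L" "creation j (M \<xi>) \<in> Fock L"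
    by (simp_all add: M_in creation_in_Fock [OF D] creation_in_Fock [OF L] \<xi>)
next
  let ?u = "V j (k \<xi>)" and ?w = "creation j (M \<xi>)"
  \<comment> \<open>The vector c* V_j k \<xi>, which represents M at the created vector. It is
    compared with \<open>?w\<close> on elementary tensors, by \<open>cinner_c_V_k\<close> at the
    empty word and by the row isometry at the others.\<close>
  define a where "a = adj (Fock L) c ?u"
  have a: "a \<in> Fock L" "\<And>\<eta>. \<eta> \<in> Fock L \<Longrightarrow> cinner \<eta> a = cinner (c \<eta>) ?u"
    by (simp_all add: a_def adj_in [OF c_op FL] cinner_adj_right [OF c_op FL])
  have w: "?w \<in> Fock L"
    by (simp add: M_in creation_in_Fock [OF L] \<xi>)
  have "cinner (a - ?w) (a - ?w) = 0"
  proof (rule cinner_cspan_eq_0)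
    show "a - ?w \<in> closed_cspan ((\<lambda>(w, \<delta>). basis_vec w \<otimes> \<delta>) ` (UNIV \<times> L))"
      by (simp add: Fock_eq_cspan_basis [OF L] csubspace_diff [OF FL] a w)
    fix s :: "('d, 'c ^ 'd) fock"
    assume "s \<in> (\<lambda>(w, \<delta>). basis_vec w \<otimes> \<delta>) ` (UNIV \<times> L)"
    then obtain \<alpha> \<delta> where s: "s = basis_vec \<alpha> \<otimes> \<delta>" and \<delta>: "\<delta> \<in> L"
      by auto
    have "cinner (c s) ?u = cinner s ?w"
    proof (cases \<alpha>)
      case Nil
      have "c (basis_vec [] \<otimes> \<delta>) \<in> UNIV \<ominus> {?u}"
        by (rule c_basis_in [OF closed_csubspace_ortho_diff [OF closed_csubspace_UNIV] _ \<delta>])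
          (auto simp: ortho_diff_def cinner_eq_0_commute [of ?u] cinner_c_V_k \<xi> simp flip: vacuum_def)
      then show ?thesis
        using cinner_vacuum_creation [of \<delta> j "M \<xi>"]
        by (simp add: s Nil ortho_diff_def cinner_eq_0_commute [of ?u] vacuum_def)
    next
      case (Cons i \<beta>)
      have b: "basis_vec \<beta> \<otimes> \<delta> \<in> Fock L"
        by (rule basis_tensor_in_Fock [OF L \<delta>])
      have "c s = V i (c (basis_vec \<beta> \<otimes> \<delta>))" "s = creation i (basis_vec \<beta> \<otimes> \<delta>)"
        by (simp_all add: s Cons V_c b creation_basis_tensor)
      then show ?thesis
        by (simp add: cinner_row_isometry [OF V] c(2) k(2) b \<xi> c_k cinner_creation)
    qed
    then show "cinner s (a - ?w) = 0"
      using a(2) [OF basis_tensor_in_Fock [OF L \<delta>], of \<alpha>] by (simp add: cinner_diff_right s)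
  qed
  then have aw: "a = ?w"
    by simp
  show "cinner \<eta> (M (creation j \<xi>)) = cinner \<eta> ?w" if "\<eta> \<in> Fock L" for \<eta>
    using a(2) [OF that] that \<xi> by (simp add: aw V_k c_k creation_in_Fock [OF D])
qed

lemma contractive_multi_analytic: "contractive_multi_analytic D L M"
  by (simp add: contractive_multi_analytic_def multi_analytic_def M_op M_norm M_creation)

lemma defect_dense:
  assumes inj: "inj_on (symbol M) D"
  shows "closed_cspan ((\<lambda>(j, x). d j x) ` (UNIV \<times> R)) = D"
proof (rule cspan_eqI [OF D])
  show "(\<lambda>(j, x). d j x) ` (UNIV \<times> R) \<subseteq> D"
    by (auto simp: d_in)
  fix \<delta> assume \<delta>: "\<delta> \<in> D" and 0: "\<And>s. s \<in> (\<lambda>(j, x). d j x) ` (UNIV \<times> R) \<Longrightarrow> cinner s \<delta> = 0"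
  let ?y = "k (vacuum \<otimes> \<delta>)"
  \<comment> \<open>\<open>?y\<close> is orthogonal to the whole range of V: on \<open>R\<close>
    because \<delta> is orthogonal to the defects, on the image of \<open>k\<close> because
    \<open>?y\<close> comes from the vacuum.\<close>
  have VK: "cinner (V j x) ?y = 0" if x: "x \<in> K" for j x
  proof -
    obtain z \<xi> where z: "z \<in> R" "\<xi> \<in> Fock D" "x = z + k \<xi>" "proj R x = z"
      using decompose [OF x] .
    have "cinner (d j z) \<delta> = 0"
      by (rule 0) (use z in auto)
    then have "cinner (k (vacuum \<otimes> d j z)) ?y = 0"
      using z \<delta> by (simp add: isomD [OF k(1)] vac_in d_in cinner_vacuum_tensor)
    moreover have "cinner (T j z) ?y = 0"
      using cinner_R_k [OF T_in vac_in [OF \<delta>]] by (simp add: cinner_eq_0_commute)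
    ultimately have "cinner (V j z) ?y = 0"
      using z by (subst V_R) (simp_all add: cinner_add_left)
    moreover have "cinner (V j (k \<xi>)) ?y = 0"
      using z \<delta> cinner_vacuum_creation [of \<delta> j \<xi>]
      by (simp add: V_k isomD [OF k(1)] vac_in creation_in_Fock [OF D] cinner_eq_0_commute)
    ultimately show ?thesis
      using z by (simp add: bounded_op_add [OF V_op] R_sub k(2) cinner_add_left)
  qed
  have cl: "closed_csubspace {x \<in> K. cinner ?y x = 0}"
    using closed_csubspace_ortho_diff [OF K, of "{?y}"] by (simp add: ortho_diff_def)
  \<comment> \<open>Nonempty words fall under \<open>VK\<close>; the empty word is covered by
    orthogonality of the images of \<open>e\<close> and \<open>k\<close>.\<close>
  have words: "foldr V \<alpha> (e h) \<in> {x \<in> K. cinner ?y x = 0}" if h: "h \<in> HC" for \<alpha> h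
    using VK [OF V_word_in [OF e(2) [OF h]]] V_word_in [OF e(2) [OF h]] e_k [OF h vac_in [OF \<delta>]]
    by (cases \<alpha>) (auto simp: cinner_eq_0_commute [of ?y] V_in e(2) h)
  have "cinner \<eta> (M (vacuum \<otimes> \<delta>)) = 0" if \<eta>: "\<eta> \<in> Fock L" for \<eta>
    using e_c_in_cspan [OF cl words \<eta>] \<eta>
    by (simp add: cinner_eq_0_commute [of ?y] c_k vac_in \<delta>)
  then have "cinner (M (vacuum \<otimes> \<delta>)) (M (vacuum \<otimes> \<delta>)) = 0"
    by (simp add: M_in vac_in \<delta>)
  then have "symbol M \<delta> = 0"
    by (simp add: symbol_def)
  moreover have "symbol M 0 = 0"
    by (simp add: symbol_def tensor_zero_right bounded_op_0 [OF M_op FD])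
  ultimately show "\<delta> = 0"
    using inj_onD [OF inj, of \<delta> 0] \<delta> csubspace_0 [OF D] by simp
qed

end

text \<open>V preserves the norms of columns and the projection does not increase them.\<close>

lemma (in coupling) row_contraction_T: "row_contraction R T"
proof (rule row_contractionI [OF R])
  have "bounded_op R K (V j)" for j
    by (rule bounded_op_restrict [OF V_op]) (auto simp: ortho_diff_def)
  then show "bounded_op R R (T j)" for j
    unfolding T_def using bounded_op_restrict [OF bounded_op_proj [OF R], of K] by (auto intro: bounded_op_comp)
  show "norm (\<Sum>j\<in>UNIV. T j (x $ j)) \<le> norm x" if x: "x \<in> copies R" for x
  proof -
    have xK: "x $ j \<in> K" for j
      using x by (auto simp: copies_def ortho_diff_def)
    have "(\<Sum>j\<in>UNIV. T j (x $ j)) = proj R (\<Sum>j\<in>UNIV. V j (x $ j))"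
      by (simp add: T_def bounded_op_sum [OF bounded_op_proj [OF R] closed_csubspace_UNIV])
    then have "norm (\<Sum>j\<in>UNIV. T j (x $ j)) \<le> norm (\<Sum>j\<in>UNIV. V j (x $ j))"
      by (simp add: norm_proj_le [OF R])
    also have "\<dots> = norm x"
      by (rule norm_eq_of_cinner)
        (simp add: cinner_sum_left cinner_sum_right cinner_row_isometry [OF V] xK cinner_vec_sum)
    finally show ?thesis .
  qed
qed

text \<open>The operator I \<otimes> v, obtained from \<open>fock_unitary\<close> with the vacuum
  copy of \<open>D'\<close> as wandering subspace.\<close>

lemma ampliation:
  fixes v :: "'x::complex_hilbert \<Rightarrow> 'y::complex_hilbert"
  assumes D: "closed_csubspace D" and v: "unitary_op D D' v"
  obtains F :: "('d, 'x) fock \<Rightarrow> ('d, 'y) fock" where "unitary_op (Fock D) (Fock D') F"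
    "\<And>\<alpha> \<delta>. \<delta> \<in> D \<Longrightarrow> F (basis_vec \<alpha> \<otimes> \<delta>) = basis_vec \<alpha> \<otimes> v \<delta>"
    "\<And>j \<xi>. \<xi> \<in> Fock D \<Longrightarrow> F (creation j \<xi>) = creation j (F \<xi>)"
proof -
  note v = unitary_opD [OF v]
  have D': "closed_csubspace D'"
    using closed_csubspace_isom_image [OF D v(1)] v(2) by simp
  let ?\<kappa> = "\<lambda>\<delta>. vacuum \<otimes> v \<delta> :: ('d, 'y) fock"
  have row: "row_isometry (Fock D' :: ('d, 'y) fock set) creation"
    by (rule row_isometry_creation [OF D'])
  have \<kappa>: "isom D ?\<kappa>" "\<And>\<delta>. \<delta> \<in> D \<Longrightarrow> ?\<kappa> \<delta> \<in> Fock D'"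
    using v by (auto simp: isom_def cinner_vacuum_tensor vacuum_tensor_in_Fock [OF D'])
  obtain F where F: "unitary_op (Fock D) (closed_cspan (\<Union>\<alpha>. foldr creation \<alpha> ` ?\<kappa> ` D)) F"
    "\<And>\<alpha> \<delta>. \<delta> \<in> D \<Longrightarrow> F (basis_vec \<alpha> \<otimes> \<delta>) = foldr creation \<alpha> (?\<kappa> \<delta>)"
    by (rule fock_unitary [OF row D \<kappa> cinner_vacuum_creation]) (blast intro: that)+
  have "(\<Union>\<alpha>. foldr creation \<alpha> ` ?\<kappa> ` D) = (\<lambda>(w, \<delta>). basis_vec w \<otimes> \<delta>) ` (UNIV \<times> D')"
    unfolding v(2) [symmetric] by (force simp: foldr_creation)
  then have "closed_cspan (\<Union>\<alpha>. foldr creation \<alpha> ` ?\<kappa> ` D) = Fock D'"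
    by (simp add: Fock_eq_cspan_basis [OF D'])
  then have U: "unitary_op (Fock D) (Fock D') F"
    using F(1) by simp
  show thesis
  proof (rule that [OF U])
    show "F (basis_vec \<alpha> \<otimes> \<delta>) = basis_vec \<alpha> \<otimes> v \<delta>" if "\<delta> \<in> D" for \<alpha> \<delta>
      by (simp add: F(2) that foldr_creation)
    show "F (creation j \<xi>) = creation j (F \<xi>)" if "\<xi> \<in> Fock D" for j \<xi>
      by (rule fock_intertwine [OF row closed_csubspace_Fock [OF D'] D unitary_opD(3) [OF U] F(2) that])
  qed
qed

lemma unitary_op_comp:
  assumes u: "unitary_op X Y u" and w: "unitary_op Y Z w"
  shows "unitary_op X Z (\<lambda>x. w (u x))"
  using assms bounded_op_comp [of X Y u Z w] by (force simp: unitary_op_def)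

text \<open>Liftings live on a product with first factor H_C, residual spaces inside
  \<open>K\<close>. The map \<open>\<iota>\<close> mediates: it is the identity for the model space
  and x |-> (x, 0) for the dilation of a lifting.\<close>

definition (in coupling) compresses_to :: "'a::complex_hilbert set \<Rightarrow> ('d \<Rightarrow> 'c \<times> 'a \<Rightarrow> 'c \<times> 'a) \<Rightarrow> ('c \<times> 'a \<Rightarrow> 'k) \<Rightarrow> bool"
  where "compresses_to HA E \<iota> \<longleftrightarrow> unitary_op (HC \<times> HA) R \<iota> \<and>
    (\<forall>j. \<forall>x\<in>HC \<times> HA. E j x \<in> HC \<times> HA \<and> \<iota> (E j x) = T j (\<iota> x)) \<and> (\<forall>h\<in>HC. \<iota> (h, 0) = e h)"

lemma (in coupling) compresses_toD:
  assumes "compresses_to HA E \<iota>" and x: "x \<in> HC \<times> HA"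
  shows "E j x \<in> HC \<times> HA" and "\<iota> (E j x) = T j (\<iota> x)"
  using assms(1) [unfolded compresses_to_def, THEN conjunct2, THEN conjunct1, rule_format, OF x] by auto

section \<open>Comparison of two couplings over the same row contraction\<close>

locale coupling_pair =
  A: coupling HC C D M K V e c k + B: coupling HC C D' M' K' V' e' c' k'
  for HC :: "'c::complex_hilbert set" and C :: "'d::finite \<Rightarrow> 'c \<Rightarrow> 'c"
    and D :: "'x::complex_hilbert set" and M :: "('d, 'x) fock \<Rightarrow> ('d, 'c ^ 'd) fock"
    and K :: "'k::complex_hilbert set" and V :: "'d \<Rightarrow> 'k \<Rightarrow> 'k"
    and e :: "'c \<Rightarrow> 'k" and c :: "('d, 'c ^ 'd) fock \<Rightarrow> 'k" and k :: "('d, 'x) fock \<Rightarrow> 'k"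
    and D' :: "'y::complex_hilbert set" and M' :: "('d, 'y) fock \<Rightarrow> ('d, 'c ^ 'd) fock"
    and K' :: "'l::complex_hilbert set" and V' :: "'d \<Rightarrow> 'l \<Rightarrow> 'l"
    and e' :: "'c \<Rightarrow> 'l" and c' :: "('d, 'c ^ 'd) fock \<Rightarrow> 'l" and k' :: "('d, 'y) fock \<Rightarrow> 'l"
begin

text \<open>The vectors c \<eta> are obtained from H_C by V alone, so they follow as soon as
  \<open>U\<close> intertwines and matches \<open>e\<close>.\<close>

lemma intertwine_c:
  assumes U: "bounded_op K K' U" and UV: "\<And>j x. x \<in> K \<Longrightarrow> U (V j x) = V' j (U x)"
    and Ue: "\<And>h. h \<in> HC \<Longrightarrow> U (e h) = e' h" and \<eta>: "\<eta> \<in> Fock A.L"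
  shows "U (c \<eta>) = c' \<eta>"
proof -
  have vac: "U (c (basis_vec [] \<otimes> \<delta>)) = c' (basis_vec [] \<otimes> \<delta>)" if \<delta>: "\<delta> \<in> A.L" for \<delta>
  proof (rule bounded_op_eq_on_defect_space [OF A.HC A.C bounded_op_comp [OF bounded_op_comp [OF A.basis_op A.c_op] U]
        bounded_op_comp [OF A.basis_op B.c_op] _ \<delta>])
    fix j h assume h: "h \<in> HC"
    let ?s = "defect_op HC C (axis j h)"
    have "c (vacuum \<otimes> ?s) = V j (e h) - e (C j h)" "c' (vacuum \<otimes> ?s) = V' j (e' h) - e' (C j h)"
      by (simp_all add: A.V_e B.V_e h)
    then show "U (c (basis_vec [] \<otimes> ?s)) = c' (basis_vec [] \<otimes> ?s)"
      by (simp add: vacuum_def bounded_op_diff [OF U A.K] A.V_in A.e(2) A.C_in h UV Ue)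
  qed
  have basis: "U (c (basis_vec \<alpha> \<otimes> \<delta>)) = c' (basis_vec \<alpha> \<otimes> \<delta>)" if \<delta>: "\<delta> \<in> A.L" for \<alpha> \<delta>
  proof (induction \<alpha>)
    case (Cons i \<alpha>)
    have b: "basis_vec \<alpha> \<otimes> \<delta> \<in> Fock A.L"
      by (rule basis_tensor_in_Fock [OF A.L \<delta>])
    have "c (basis_vec (i # \<alpha>) \<otimes> \<delta>) = V i (c (basis_vec \<alpha> \<otimes> \<delta>))"
      "c' (basis_vec (i # \<alpha>) \<otimes> \<delta>) = V' i (c' (basis_vec \<alpha> \<otimes> \<delta>))"
      by (simp_all add: A.V_c B.V_c b creation_basis_tensor)
    then show ?case
      using Cons by (simp add: UV A.c(2) b)
  qed (rule vac [OF \<delta>])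
  show ?thesis
    by (rule bounded_op_eq_on_Fock [OF bounded_op_comp [OF A.c_op U] B.c_op A.L basis \<eta>])
qed

text \<open>\<open>u\<close> carries defects to defects, which yields \<open>v\<close>; then
  \<open>u\<close> and I \<otimes> v together extend to an intertwining isometry of the coupling
  spaces. It matches the copies of \<Gamma> \<otimes> D_C as well, so the cross Gramians
  correspond.\<close>

lemma symbols_of_compressions:
  assumes inj: "inj_on (symbol M) D" "inj_on (symbol M') D'"
    and u: "unitary_op A.R B.R u" and uT: "\<And>j x. x \<in> A.R \<Longrightarrow> u (A.T j x) = B.T j (u x)"
    and ue: "\<And>h. h \<in> HC \<Longrightarrow> u (e h) = e' h"
  shows "\<exists>v. unitary_op D D' v \<and> (\<forall>\<delta>\<in>D. symbol M' (v \<delta>) = symbol M \<delta>)"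
proof -
  note u = unitary_opD [OF u]
  obtain v where v: "unitary_op D D' v" and vd: "\<And>j x. x \<in> A.R \<Longrightarrow> v (A.d j x) = B.d j (u x)"
  proof -
    let ?f = "\<lambda>(j, x). A.d j x" and ?g = "\<lambda>(j, x). B.d j (u x)"
    obtain w where w: "unitary_op (closed_cspan (?f ` (UNIV \<times> A.R))) (closed_cspan (?g ` (UNIV \<times> A.R))) w"
      "\<And>p. p \<in> UNIV \<times> A.R \<Longrightarrow> w (?f p) = ?g p"
      by (rule gram_unitary [of "UNIV \<times> A.R" ?f ?g])
        (auto simp: A.cinner_d B.cinner_d u isomD [OF u(1)] A.T_in simp flip: uT)
    \<comment> \<open>Since \<open>u\<close> is onto, the defects of the second coupling can be
      indexed by the residual space of the first; injectivity of the symbols makes both families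
      generate.\<close>
    have "?g ` (UNIV \<times> A.R) = (\<lambda>(j, x). B.d j x) ` (UNIV \<times> B.R)"
      unfolding u(2) [symmetric] by force
    then show thesis
      using w(2) by (intro that [of w]) (use w A.defect_dense [OF inj(1)] B.defect_dense [OF inj(2)] in auto)
  qed
  note v' = unitary_opD [OF v]
  obtain F :: "('d, 'x) fock \<Rightarrow> ('d, 'y) fock" where F: "unitary_op (Fock D) (Fock D') F"
    "\<And>\<alpha> \<delta>. \<delta> \<in> D \<Longrightarrow> F (basis_vec \<alpha> \<otimes> \<delta>) = basis_vec \<alpha> \<otimes> v \<delta>"
    "\<And>j \<xi>. \<xi> \<in> Fock D \<Longrightarrow> F (creation j \<xi>) = creation j (F \<xi>)"
    using ampliation [OF A.D v] by blast
  note F1 = unitary_opD [OF F(1)]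
  have Fvac: "F (vacuum \<otimes> \<delta>) = vacuum \<otimes> v \<delta>" if "\<delta> \<in> D" for \<delta>
    using F(2) [OF that] by (simp add: vacuum_def)
  \<comment> \<open>Indexed by the orthogonal decomposition into residual space and \<Gamma>
    \<otimes> D. Inner products with \<open>c\<close> are not known to match at this stage; they are
    recovered through \<open>intertwine_c\<close>.\<close>
  let ?f = "\<lambda>(x, \<xi>). x + k \<xi>" and ?g = "\<lambda>(x, \<xi>). u x + k' (F \<xi>)"
  have gram: "cinner (?f p) (?f q) = cinner (?g p) (?g q)"
    if "p \<in> A.R \<times> Fock D" "q \<in> A.R \<times> Fock D" for p q
    using that by (auto simp: cinner_add_left cinner_add_right A.cinner_R_k A.cinner_k_R B.cinner_R_k
        B.cinner_k_R isomD [OF A.k(1)] isomD [OF B.k(1)] isomD [OF u(1)] isomD [OF F1(1)] u(4) F1(4))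
  obtain U where U0: "unitary_op (closed_cspan (?f ` (A.R \<times> Fock D))) (closed_cspan (?g ` (A.R \<times> Fock D))) U"
    and U: "\<And>p. p \<in> A.R \<times> Fock D \<Longrightarrow> U (?f p) = ?g p"
    using gram_unitary [of "A.R \<times> Fock D" ?f ?g] gram by blast
  have dom: "closed_cspan (?f ` (A.R \<times> Fock D)) = K"
  proof
    show "closed_cspan (?f ` (A.R \<times> Fock D)) \<subseteq> K"
      by (rule cspan_subset [OF _ A.K]) (auto simp: csubspace_add [OF A.K] A.R_sub A.k(2))
    show "K \<subseteq> closed_cspan (?f ` (A.R \<times> Fock D))"
    proof
      fix x assume "x \<in> K"
      then obtain y \<xi> where "y \<in> A.R" "\<xi> \<in> Fock D" "x = y + k \<xi>"
        using A.decompose by metis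
      then show "x \<in> closed_cspan (?f ` (A.R \<times> Fock D))"
        by (intro cspan_inc) (auto intro!: image_eqI [of _ _ "(y, \<xi>)"])
    qed
  qed
  have ran: "closed_cspan (?g ` (A.R \<times> Fock D)) \<subseteq> K'"
    by (rule cspan_subset [OF _ B.K])
      (auto simp: csubspace_add [OF B.K] B.R_sub B.k(2) u(4) F1(4))
  have Uop: "bounded_op K K' U" and Uiso: "isom K U"
    using unitary_opD [OF U0] ran dom by (auto intro: bounded_op_mono)
  have Uxk: "U (x + k \<xi>) = u x + k' (F \<xi>)" if "x \<in> A.R" "\<xi> \<in> Fock D" for x \<xi>
    using U [of "(x, \<xi>)"] that by simp
  have k0: "k 0 = 0" "k' 0 = 0" "F 0 = 0" "u 0 = 0"
    using bounded_op_0 [OF A.k_op A.FD] bounded_op_0 [OF B.k_op B.FD] bounded_op_0 [OF F1(3) A.FD]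
      bounded_op_0 [OF u(3) A.R] by auto
  have Ux: "U x = u x" if "x \<in> A.R" for x
    using Uxk [OF that csubspace_0 [OF A.FD]] k0 by simp
  have Uk: "U (k \<xi>) = k' (F \<xi>)" if "\<xi> \<in> Fock D" for \<xi>
    using Uxk [OF csubspace_0 [OF A.R] that] k0 by simp
  \<comment> \<open>Along x = y + k \<xi> the operator V splits into compression, defect and
    creation, and \<open>U\<close> respects each of the three.\<close>
  have UV: "U (V j x) = V' j (U x)" if x: "x \<in> K" for j x
  proof -
    obtain y \<xi> where y: "y \<in> A.R" and \<xi>: "\<xi> \<in> Fock D" and xy: "x = y + k \<xi>"
      using A.decompose [OF x] by metis
    note in_D = A.vac_in [OF A.d_in [OF y]] creation_in_Fock [OF A.D \<xi>]
    have "V j x = A.T j y + k (vacuum \<otimes> A.d j y + creation j \<xi>)"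
      by (simp add: xy bounded_op_add [OF A.V_op] A.R_sub y A.k(2) \<xi> A.V_R [OF y] A.V_k
          bounded_op_add [OF A.k_op] in_D)
    then have "U (V j x) = u (A.T j y) + k' (F (vacuum \<otimes> A.d j y + creation j \<xi>))"
      using Uxk [OF A.T_in csubspace_add [OF A.FD in_D]] by simp
    also have "F (vacuum \<otimes> A.d j y + creation j \<xi>) = vacuum \<otimes> B.d j (u y) + creation j (F \<xi>)"
      by (simp add: bounded_op_add [OF F1(3)] in_D Fvac A.d_in y vd F(3) \<xi>)
    also have "u (A.T j y) + k' (vacuum \<otimes> B.d j (u y) + creation j (F \<xi>)) = V' j (u y) + V' j (k' (F \<xi>))"
      by (simp add: uT y B.V_R [OF u(4) [OF y]] B.V_k F1(4) \<xi> bounded_op_add [OF B.k_op]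
          B.vac_in B.d_in u(4) creation_in_Fock [OF B.D])
    also have "\<dots> = V' j (U x)"
      by (simp add: xy Uxk y \<xi> bounded_op_add [OF B.V_op] B.R_sub u(4) B.k(2) F1(4))
    finally show ?thesis .
  qed
  have Uc: "U (c \<eta>) = c' \<eta>" if "\<eta> \<in> Fock A.L" for \<eta>
    by (rule intertwine_c [OF Uop UV _ that]) (simp_all add: Ux A.e_in_R ue)
  have "symbol M' (v \<delta>) = symbol M \<delta>" if \<delta>: "\<delta> \<in> D" for \<delta>
    unfolding symbol_def
  proof (rule A.M_eqI)
    show "M' (vacuum \<otimes> v \<delta>) \<in> Fock A.L" "M (vacuum \<otimes> \<delta>) \<in> Fock A.L"
      by (simp_all add: A.M_in B.M_in A.vac_in B.vac_in \<delta> v'(4))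
    fix \<eta> :: "('d, 'c ^ 'd) fock" assume \<eta>: "\<eta> \<in> Fock A.L"
    have "cinner \<eta> (M' (vacuum \<otimes> v \<delta>)) = cinner (U (c \<eta>)) (U (k (vacuum \<otimes> \<delta>)))"
      by (simp add: Uc \<eta> Uk A.vac_in \<delta> Fvac B.c_k B.vac_in v'(4))
    also have "\<dots> = cinner \<eta> (M (vacuum \<otimes> \<delta>))"
      by (simp add: isomD [OF Uiso] A.c(2) A.k(2) \<eta> A.vac_in \<delta> A.c_k)
    finally show "cinner \<eta> (M' (vacuum \<otimes> v \<delta>)) = cinner \<eta> (M (vacuum \<otimes> \<delta>))" .
  qed
  then show ?thesis
    using v by blast
qed

text \<open>The unitary between the couplings maps the copies of \<Gamma> \<otimes> D onto each
  other, hence commutes with the projections to their complements and restricts to these.\<close>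

lemma compressions_of_symbols:
  assumes v: "unitary_op D D' v" and sym: "\<And>\<delta>. \<delta> \<in> D \<Longrightarrow> symbol M' (v \<delta>) = symbol M \<delta>"
  shows "\<exists>u. unitary_op A.R B.R u \<and> (\<forall>j. \<forall>x\<in>A.R. u (A.T j x) = B.T j (u x)) \<and> (\<forall>h\<in>HC. u (e h) = e' h)"
proof -
  note v' = unitary_opD [OF v]
  obtain F :: "('d, 'x) fock \<Rightarrow> ('d, 'y) fock" where F: "unitary_op (Fock D) (Fock D') F"
    "\<And>\<alpha> \<delta>. \<delta> \<in> D \<Longrightarrow> F (basis_vec \<alpha> \<otimes> \<delta>) = basis_vec \<alpha> \<otimes> v \<delta>"
    "\<And>j \<xi>. \<xi> \<in> Fock D \<Longrightarrow> F (creation j \<xi>) = creation j (F \<xi>)"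
    using ampliation [OF A.D v] by blast
  note F1 = unitary_opD [OF F(1)]
  \<comment> \<open>Symbols give only the values at vacuum tensors; multi-analyticity moves the
    letters of a word out of M one at a time.\<close>
  have basis: "M' (basis_vec \<alpha> \<otimes> v \<delta>) = M (basis_vec \<alpha> \<otimes> \<delta>)" if \<delta>: "\<delta> \<in> D" for \<alpha> \<delta>
  proof (induction \<alpha>)
    case Nil
    show ?case
      using sym [OF \<delta>] by (simp add: symbol_def vacuum_def)
  next
    case (Cons i \<alpha>)
    then show ?case
      by (simp add: A.M_creation B.M_creation basis_tensor_in_Fock [OF A.D] basis_tensor_in_Fock [OF B.D]
          \<delta> v'(4) flip: creation_basis_tensor)
  qed
  have MF: "M' (F \<xi>) = M \<xi>" if "\<xi> \<in> Fock D" for \<xi>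
    by (rule bounded_op_eq_on_Fock [OF bounded_op_comp [OF F1(3) B.M_op] A.M_op A.D _ that])
      (simp add: basis F(2))
  let ?I = "HC \<times> Fock A.L \<times> Fock D"
  let ?f = "\<lambda>(h, \<eta>, \<xi>). e h + c \<eta> + k \<xi>" and ?g = "\<lambda>(h, \<eta>, \<xi>). e' h + c' \<eta> + k' (F \<xi>)"
  have gram: "cinner (?f p) (?f q) = cinner (?g p) (?g q)" if "p \<in> ?I" "q \<in> ?I" for p q
    using that by (auto simp: cinner_add_left cinner_add_right A.e_c B.e_c A.e_k B.e_k A.c_k B.c_k A.c_e B.c_e A.k_e B.k_e A.k_c B.k_c
        isomD [OF A.e(1)] isomD [OF A.c(1)] isomD [OF A.k(1)] isomD [OF B.e(1)] isomD [OF B.c(1)]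
        isomD [OF B.k(1)] isomD [OF F1(1)] F1(4) MF)
  obtain U where U0: "unitary_op (closed_cspan (?f ` ?I)) (closed_cspan (?g ` ?I)) U"
    and U: "\<And>p. p \<in> ?I \<Longrightarrow> U (?f p) = ?g p"
    using gram_unitary [of ?I ?f ?g] gram by blast
  have z: "e 0 = 0" "c 0 = 0" "k 0 = 0" "e' 0 = 0" "c' 0 = 0" "k' 0 = 0" "F 0 = 0"
    using bounded_op_0 [OF A.e_op A.HC] bounded_op_0 [OF A.c_op A.FL] bounded_op_0 [OF A.k_op A.FD]
      bounded_op_0 [OF B.e_op A.HC] bounded_op_0 [OF B.c_op A.FL] bounded_op_0 [OF B.k_op B.FD]
      bounded_op_0 [OF F1(3) A.FD] by auto
  note m0 = csubspace_0 [OF A.HC] csubspace_0 [OF A.FL] csubspace_0 [OF A.FD]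
  have Ue: "U (e h) = e' h" if "h \<in> HC" for h
    using U [of "(h, 0, 0)"] that by (simp add: z m0)
  have Uc: "U (c \<eta>) = c' \<eta>" if "\<eta> \<in> Fock A.L" for \<eta>
    using U [of "(0, \<eta>, 0)"] that by (simp add: z m0)
  have Uk: "U (k \<xi>) = k' (F \<xi>)" if "\<xi> \<in> Fock D" for \<xi>
    using U [of "(0, 0, \<xi>)"] that by (simp add: z m0)
  let ?G = "e ` HC \<union> c ` Fock A.L \<union> k ` Fock D"
  \<comment> \<open>\<open>F\<close> is onto, so the second family runs through all generating sums
    of the second coupling.\<close>
  have "?g ` ?I = (\<lambda>(h, \<eta>, \<xi>). e' h + c' \<eta> + k' \<xi>) ` (HC \<times> Fock A.L \<times> Fock D')"
    unfolding F1(2) [symmetric] by (force simp: image_iff)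
  then have ran: "closed_cspan (?g ` ?I) = K'"
    by (simp add: B.generate_sum)
  have "unitary_op K K' U"
    using U0 by (simp add: A.generate_sum ran)
  note U1 = unitary_opD [OF this]
  have UV: "U (V j x) = V' j (U x)" if "x \<in> K" for j x
  proof (rule bounded_op_eq_on_cspan [OF bounded_op_comp [OF A.V_op U1(3)] bounded_op_comp [OF U1(3) B.V_op] A.K])
    show "?G \<subseteq> K"
      by (auto simp: A.e(2) A.c(2) A.k(2))
    show "x \<in> closed_cspan ?G"
      by (simp add: A.generate that)
    have "U (V j (e h)) = V' j (U (e h))" if "h \<in> HC" for h
      using that by (simp add: A.V_e B.V_e Ue Uc bounded_op_add [OF U1(3)] A.e(2) A.c(2) A.C_in A.vac_defect_in)
    moreover have "U (V j (c \<eta>)) = V' j (U (c \<eta>))" if "\<eta> \<in> Fock A.L" for \<eta>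
      using that by (simp add: A.V_c B.V_c Uc creation_in_Fock [OF A.L])
    moreover have "U (V j (k \<xi>)) = V' j (U (k \<xi>))" if "\<xi> \<in> Fock D" for \<xi>
      using that by (simp add: A.V_k B.V_k Uk creation_in_Fock [OF A.D] F1(4) F(3))
    ultimately show "U (V j s) = V' j (U s)" if "s \<in> ?G" for s
      using that by blast
  qed
  have UR: "U x \<in> B.R" if "x \<in> A.R" for x
  proof -
    have "cinner (k' \<xi>) (U x) = 0" if "\<xi> \<in> Fock D'" for \<xi>
    proof -
      obtain \<zeta> where \<zeta>: "\<zeta> \<in> Fock D" "\<xi> = F \<zeta>"
        using \<open>\<xi> \<in> Fock D'\<close> F1(2) by auto
      have "cinner (k' \<xi>) (U x) = cinner (U (k \<zeta>)) (U x)"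
        by (simp add: \<zeta> Uk)
      also have "\<dots> = 0"
        using \<open>x \<in> A.R\<close> \<zeta> by (simp add: isomD [OF U1(1)] A.k(2) A.R_sub A.cinner_R_k)
      finally show ?thesis .
    qed
    then show ?thesis
      using U1(4) A.R_sub [OF that] by (auto simp: ortho_diff_def)
  qed
  have proj: "proj B.R (U x) = U (proj A.R x)" if x: "x \<in> K" for x
  proof -
    obtain y \<xi> where y: "y \<in> A.R" "\<xi> \<in> Fock D" "x = y + k \<xi>" "proj A.R x = y"
      using A.decompose [OF x] .
    then have "U x = U y + k' (F \<xi>)"
      by (simp add: bounded_op_add [OF U1(3)] A.R_sub A.k(2) Uk)
    then show ?thesis
      using y by (simp add: proj_add [OF B.R] B.proj_R_k F1(4) proj_ident [OF B.R] UR)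
  qed
  have "unitary_op A.R B.R U"
  proof (rule unitary_opI [OF A.R])
    show "isom A.R U"
      using U1(1) A.R_sub by (simp add: isom_def)
    show "U ` A.R = B.R"
    proof
      show "B.R \<subseteq> U ` A.R"
      proof
        fix y assume y: "y \<in> B.R"
        then obtain x where x: "x \<in> K" "y = U x"
          using U1(2) B.R_sub [OF y] by auto
        have "y = U (proj A.R x)"
          using proj [OF x(1)] y by (simp add: x(2) proj_ident [OF B.R])
        then show "y \<in> U ` A.R"
          using proj_in [OF A.R] by blast
      qed
    qed (use UR in auto)
  qed
  moreover have "U (A.T j x) = B.T j (U x)" if "x \<in> A.R" for j x
    using that by (simp add: A.T_def B.T_def proj [symmetric] A.V_in A.R_sub UV)
  ultimately show ?thesis
    using Ue by blast
qed

text \<open>Conjugation by the identifications \<open>\<iota>\<close> and \<open>\<iota>'\<close>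
  turns an equivalence of liftings into one of compressions, as
  \<open>symbols_of_compressions\<close> requires.\<close>

lemma symbol_equiv_if_lifting_equiv:
  assumes inj: "inj_on (symbol M) D" "inj_on (symbol M') D'" and HA: "closed_csubspace HA"
    and \<iota>: "A.compresses_to HA E \<iota>" and \<iota>': "B.compresses_to HA' E' \<iota>'"
    and eq: "lifting_equiv HC HA E HA' E'"
  shows "symbol_equiv D (symbol M) D' (symbol M')"
proof -
  note I = \<iota> [unfolded A.compresses_to_def] and I' = \<iota>' [unfolded B.compresses_to_def]
  have X: "closed_csubspace (HC \<times> HA)"
    by (rule closed_csubspace_Times [OF A.HC HA])
  obtain u where u: "unitary_op (HC \<times> HA) (HC \<times> HA') u"
    "\<And>j x. x \<in> HC \<times> HA \<Longrightarrow> u (E j x) = E' j (u x)" "\<And>h. h \<in> HC \<Longrightarrow> u (h, 0) = (h, 0)"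
    using eq by (auto simp: lifting_equiv_def)
  obtain w where w: "unitary_op A.R (HC \<times> HA) w" "\<And>x. x \<in> HC \<times> HA \<Longrightarrow> w (\<iota> x) = x"
    "\<And>y. y \<in> A.R \<Longrightarrow> \<iota> (w y) = y"
    using unitary_op_inverse [OF X] I by metis
  have "\<exists>v. unitary_op D D' v \<and> (\<forall>\<delta>\<in>D. symbol M' (v \<delta>) = symbol M \<delta>)"
  proof (rule symbols_of_compressions [OF inj, of "\<lambda>y. \<iota>' (u (w y))"])
    show "unitary_op A.R B.R (\<lambda>y. \<iota>' (u (w y)))"
      using unitary_op_comp [OF unitary_op_comp [OF w(1) u(1)], of B.R \<iota>'] I' A.R by auto
    show "\<iota>' (u (w (A.T j y))) = B.T j (\<iota>' (u (w y)))" if y: "y \<in> A.R" for j y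
    proof -
      have x: "w y \<in> HC \<times> HA"
        using unitary_opD(4) [OF w(1) y] .
      have "A.T j y = \<iota> (E j (w y))"
        using I x w(3) [OF y] by metis
      moreover have "E j (w y) \<in> HC \<times> HA"
        by (rule A.compresses_toD [OF \<iota> x])
      ultimately have "\<iota>' (u (w (A.T j y))) = \<iota>' (E' j (u (w y)))"
        using x by (simp add: w(2) u(2))
      then show ?thesis
        using I' unitary_opD(4) [OF u(1) x] by simp
    qed
    show "\<iota>' (u (w (e h))) = e' h" if h: "h \<in> HC" for h
    proof -
      have "(h, 0) \<in> HC \<times> HA" "e h = \<iota> (h, 0)"
        using h I csubspace_0 [OF HA] by auto
      then show ?thesis
        using h I' by (simp add: w(2) u(3))
    qed
  qed
  then show ?thesis
    by (auto simp: symbol_equiv_def)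
qed

lemma lifting_equiv_if_symbol_equiv:
  assumes HA': "closed_csubspace HA'"
    and \<iota>: "A.compresses_to HA E \<iota>" and \<iota>': "B.compresses_to HA' E' \<iota>'"
    and eq: "symbol_equiv D (symbol M) D' (symbol M')"
  shows "lifting_equiv HC HA E HA' E'"
proof -
  note I = \<iota> [unfolded A.compresses_to_def] and I' = \<iota>' [unfolded B.compresses_to_def]
  have X': "closed_csubspace (HC \<times> HA')"
    by (rule closed_csubspace_Times [OF A.HC HA'])
  obtain v where v: "unitary_op D D' v" "\<And>\<delta>. \<delta> \<in> D \<Longrightarrow> symbol M' (v \<delta>) = symbol M \<delta>"
    using eq by (auto simp: symbol_equiv_def)
  obtain u where u: "unitary_op A.R B.R u" "\<And>j x. x \<in> A.R \<Longrightarrow> u (A.T j x) = B.T j (u x)"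
    "\<And>h. h \<in> HC \<Longrightarrow> u (e h) = e' h"
    using compressions_of_symbols [OF v] by blast
  obtain w where w: "unitary_op B.R (HC \<times> HA') w" "\<And>x. x \<in> HC \<times> HA' \<Longrightarrow> w (\<iota>' x) = x"
    "\<And>y. y \<in> B.R \<Longrightarrow> \<iota>' (w y) = y"
    using unitary_op_inverse [OF X'] I' by metis
  have "unitary_op (HC \<times> HA) (HC \<times> HA') (\<lambda>x. w (u (\<iota> x)))"
    using unitary_op_comp [OF unitary_op_comp [OF conjunct1 [OF I] u(1)] w(1)] .
  moreover have "w (u (\<iota> (E j x))) = E' j (w (u (\<iota> x)))" if x: "x \<in> HC \<times> HA" for j x
  proof -
    have y: "u (\<iota> x) \<in> B.R" and r: "\<iota> x \<in> A.R"
      using I x unitary_opD(4) [OF u(1)] unitary_opD(4) by blast+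
    have z: "w (u (\<iota> x)) \<in> HC \<times> HA'"
      using unitary_opD(4) [OF w(1) y] .
    have "u (\<iota> (E j x)) = B.T j (\<iota>' (w (u (\<iota> x))))"
      by (simp add: A.compresses_toD [OF \<iota> x] u(2) r w(3) [OF y])
    also have "\<dots> = \<iota>' (E' j (w (u (\<iota> x))))"
      using I' z by metis
    finally show ?thesis
      using I' z w(2) by metis
  qed
  moreover have "w (u (\<iota> (h, 0))) = (h, 0)" if h: "h \<in> HC" for h
  proof -
    have "u (\<iota> (h, 0)) = \<iota>' (h, 0)"
      using h I I' by (simp add: u(3))
    moreover have "(h, 0) \<in> HC \<times> HA'"
      using h csubspace_0 [OF HA'] by simp
    ultimately show ?thesis
      by (simp add: w(2))
  qed
  ultimately show ?thesis
    by (auto simp: lifting_equiv_def intro!: exI [of _ "\<lambda>x. w (u (\<iota> x))"])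
qed

end

section \<open>The coupling of a minimal contractive lifting\<close>

context
  fixes H :: "'h::complex_hilbert set" and T :: "'d::finite \<Rightarrow> 'h \<Rightarrow> 'h"
  assumes H: "closed_csubspace H" and T: "row_contraction H T"
begin

private abbreviation (input) "dil \<equiv> min_dilation H T"
private abbreviation (input) "dilspace \<equiv> H \<times> (Fock (defect_space H T) :: ('d, 'h ^ 'd) fock set)"

lemma closed_csubspace_dilation_space: "closed_csubspace dilspace"
  by (intro closed_csubspace_Times closed_csubspace_Fock H closed_csubspace_defect_space T)

text \<open>The defect term restores exactly what T loses: by \<open>cinner_defect_op_axis\<close>
  the Gram matrices of the vectors T_j h and of their defects add up to that of a row
  isometry.\<close>

lemma row_isometry_min_dilation: "row_isometry dilspace dil"
proof -
  note L = closed_csubspace_defect_space [OF H T]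
  have d: "defect_op H T (axis j h) \<in> defect_space H T" if "h \<in> H" for j h
    by (rule defect_op_in [OF H T axis_in_copies [OF H that]])
  have "min_dilation H T j x \<in> dilspace" if x: "x \<in> dilspace" for j x
    using x by (auto simp: min_dilation_def row_contraction_bounded_op [OF H T, THEN bounded_op_in]
        intro!: csubspace_add [OF closed_csubspace_Fock [OF L]] vacuum_tensor_in_Fock [OF L d]
          creation_in_Fock [OF L])
  moreover have "cinner (min_dilation H T i x) (min_dilation H T j y) = (if i = j then cinner x y else 0)"
    if "x \<in> dilspace" "y \<in> dilspace" for i j x y
    using that by (auto simp: min_dilation_def cinner_prod_def cinner_add_left cinner_add_right
        cinner_vacuum_tensor cinner_vacuum_creation cinner_creation_vacuum cinner_creation cinner_defect_op_axis [OF H T])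
  ultimately show ?thesis
    by (simp add: row_isometry_def)
qed

lemma dilation_min_dilation: "dilation H T dilspace dil (\<lambda>x. (x, 0))"
proof
  note b = row_contraction_bounded_op [OF H T]
  show "cinner (h, 0) (min_dilation H T j x) = cinner (adj H (T j) h, 0) x"
    if "h \<in> H" "x \<in> dilspace" for j h x
    using that by (auto simp: min_dilation_def cinner_prod_def cinner_adj_left [OF b H])
qed (auto simp: H T closed_csubspace_dilation_space row_isometry_min_dilation isom_def cinner_prod_def
    csubspace_0 [OF closed_csubspace_Fock [OF closed_csubspace_defect_space [OF H T]]])

text \<open>In the concrete realization K_T is the inclusion of the Fock component, which makes the
  K_E inside \<open>calM\<close> explicit.\<close>

lemma Kappa_min_dilation:
  assumes \<xi>: "\<xi> \<in> Fock (defect_space H T)"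
  shows "Kappa H T (\<lambda>x. (x, 0)) dil \<xi> = (0, \<xi>)"
proof -
  interpret dilation H T dilspace dil "\<lambda>x. (x, 0)"
    by (rule dilation_min_dilation)
  have T0: "T j 0 = 0" and D0: "defect_op H T 0 = 0" for j
    using bounded_op_0 [OF T_op H] bounded_op_0 [OF bounded_op_defect_op [OF H T] closed_csubspace_copies [OF H]]
    by auto
  have dil0: "min_dilation H T j (0, \<eta>) = (0, creation j \<eta>)" for j \<eta>
    by (simp add: min_dilation_def T0 axis_zero D0 tensor_zero_right)
  have vac_op: "bounded_op \<L> UNIV (\<lambda>\<delta>. (0 :: 'h, vacuum \<otimes> \<delta> :: ('d, 'h ^ 'd) fock))"
    by (rule isom_bounded_op [OF closed_csubspace_L]) (auto simp: isom_def cinner_prod_def cinner_vacuum_tensor)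
  have kap: "\<kappa> \<delta> = (0, vacuum \<otimes> \<delta>)" if \<delta>: "\<delta> \<in> \<L>" for \<delta>
    by (rule bounded_op_eq_on_defect_space [OF H T unitary_opD(3) [OF conjunct1 [OF kappa_props]] vac_op _ \<delta>])
      (simp add: kappa_axis wander_def min_dilation_def creation_zero)
  have foldr0: "foldr dil \<alpha> (0, \<eta>) = (0, foldr creation \<alpha> \<eta>)" for \<alpha> \<eta>
    by (induction \<alpha>) (simp_all add: dil0)
  have id_op: "bounded_op (Fock \<L>) UNIV (\<lambda>\<xi>. (0 :: 'h, \<xi> :: ('d, 'h ^ 'd) fock))"
    by (rule isom_bounded_op [OF closed_csubspace_Fock [OF closed_csubspace_L]]) (auto simp: isom_def cinner_prod_def)
  show ?thesis
    by (rule bounded_op_eq_on_Fock [OF Kappa_op id_op closed_csubspace_L _ \<xi>])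
      (simp add: Kappa_basis kap foldr0 foldr_creation)
qed

end

context
  fixes HC :: "'c::complex_hilbert set" and C :: "'d::finite \<Rightarrow> 'c \<Rightarrow> 'c"
    and HA :: "'a::complex_hilbert set" and E :: "'d \<Rightarrow> 'c \<times> 'a \<Rightarrow> 'c \<times> 'a"
  assumes HC: "closed_csubspace HC" and C: "row_contraction HC C"
    and E: "minimal_contractive_lifting HC C HA E"
begin

private abbreviation (input) "HE \<equiv> HC \<times> HA"
private abbreviation (input) "DE \<equiv> defect_space (HC \<times> HA) E"
private abbreviation (input) "VE \<equiv> min_dilation (HC \<times> HA) E"
private abbreviation (input) "KE \<equiv> (HC \<times> HA) \<times> (Fock (defect_space (HC \<times> HA) E) :: ('d, ('c \<times> 'a) ^ 'd) fock set)"
private abbreviation (input) "embC \<equiv> \<lambda>h :: 'c. ((h, 0 :: 'a), 0 :: ('d, ('c \<times> 'a) ^ 'd) fock)"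

lemma lifting_HA: "closed_csubspace HA" and lifting_row: "row_contraction HE E"
  and lifting_minimal: "minimal_lifting HC HA E"
  using E by (auto simp: minimal_contractive_lifting_def contractive_lifting_def)

lemma lifting_HE: "closed_csubspace HE"
  by (intro closed_csubspace_Times HC lifting_HA)

lemma lifting_fst: "x \<in> HE \<Longrightarrow> fst (E j x) = C j (fst x)"
  using E by (cases x) (auto simp: minimal_contractive_lifting_def contractive_lifting_def)

text \<open>Here the triangular form of the lifting enters: its first row is C alone, see
  \<open>lifting_fst\<close>, so H_C is coinvariant in the dilation of \<open>E\<close>.\<close>

lemma dilation_lifting: "dilation HC C KE VE embC"
proof
  note FD = closed_csubspace_Fock [OF closed_csubspace_defect_space [OF lifting_HE lifting_row]]
  note b = row_contraction_bounded_op [OF HC C]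
  show "cinner (embC h) (VE j x) = cinner (embC (adj HC (C j) h)) x" if h: "h \<in> HC" and x: "x \<in> KE" for j h x
    using that by (auto simp: min_dilation_def cinner_prod_def lifting_fst cinner_adj_left [OF b HC])
  show "embC h \<in> KE" if "h \<in> HC" for h
    using that csubspace_0 [OF lifting_HA] csubspace_0 [OF FD] by simp
qed (auto simp: HC C closed_csubspace_dilation_space row_isometry_min_dilation lifting_HE lifting_row
    isom_def cinner_prod_def)

text \<open>As K_E is the inclusion, \<open>calM\<close> is c* k with c = K_C by its very
  definition. The substantial axiom is generation, which comes from minimality of the
  lifting.\<close>

lemma coupling_lifting:
  "coupling HC C DE (calM HC C HA E) KE VE embC (Kappa HC C embC VE) (\<lambda>\<xi>. (0, \<xi>))"
proof -
  interpret dilation HC C KE VE embC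
    by (rule dilation_lifting)
  note DE = closed_csubspace_defect_space [OF lifting_HE lifting_row]
  note FD = closed_csubspace_Fock [OF DE]
  interpret E: dilation HE E KE VE "\<lambda>x. (x, 0)"
    by (rule dilation_min_dilation [OF lifting_HE lifting_row])
  note FL = closed_csubspace_Fock [OF closed_csubspace_L]
  have ws: "closed_csubspace (wandering_sum HC embC VE)"
    using closed_csubspace_isom_image [OF FL Kappa_isom] unitary_opD(2) [OF Kappa_unitary] by simp
  have KE: "Kappa HE E (\<lambda>x. (x, 0)) VE \<xi> = (0, \<xi>)" if "\<xi> \<in> Fock DE" for \<xi>
    by (rule Kappa_min_dilation [OF lifting_HE lifting_row that])
  have M: "calM HC C HA E \<xi> = adj (Fock \<L>) \<K> (proj (wandering_sum HC embC VE) (0, \<xi>))"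
    if "\<xi> \<in> Fock DE" for \<xi>
    by (simp add: calM_def Let_def KE that)
  let ?k = "\<lambda>\<xi>. (0 :: 'c \<times> 'a, \<xi> :: ('d, ('c \<times> 'a) ^ 'd) fock)"
  show ?thesis
  proof
    show "cinner (\<K> \<eta>) (?k \<xi>) = cinner \<eta> (calM HC C HA E \<xi>)" if "\<eta> \<in> Fock \<L>" "\<xi> \<in> Fock DE" for \<eta> \<xi>
      using that unitary_opD(4) [OF Kappa_unitary]
      by (simp add: M cinner_adj_right [OF Kappa_op FL] cinner_proj_right [OF ws])
    show "calM HC C HA E \<xi> \<in> Fock \<L>" if "\<xi> \<in> Fock DE" for \<xi>
      by (simp add: M that adj_in [OF Kappa_op FL])
    show Vk: "VE j (?k \<xi>) = ?k (creation j \<xi>)" if "\<xi> \<in> Fock DE" for j \<xi>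
      using E.Kappa_creation [OF that, of j] by (simp add: KE that creation_in_Fock [OF DE])
    let ?G = "embC ` HC \<union> \<K> ` Fock \<L> \<union> ?k ` Fock DE"
    have GK: "?G \<subseteq> KE"
      by (intro Un_least image_subsetI emb_in Kappa_in)
        (auto simp: zero_prod_def csubspace_0 [OF HC] csubspace_0 [OF lifting_HA])
    have VG: "VE j s \<in> closed_cspan ?G" if "s \<in> ?G" for j s
    proof -
      have "VE j (embC h) \<in> closed_cspan ?G" if h: "h \<in> HC" for h
      proof -
        have "vacuum \<otimes> defect_op HC C (axis j h) \<in> Fock \<L>"
          by (intro vacuum_tensor_in_Fock closed_csubspace_L defect_op_in HC C axis_in_copies h)
        then have "\<K> (vacuum \<otimes> defect_op HC C (axis j h)) \<in> closed_cspan ?G"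
          by (intro cspan_inc) auto
        moreover have "embC (C j h) \<in> closed_cspan ?G"
          using T_in [OF h] by (intro cspan_inc) auto
        ultimately show ?thesis
          unfolding V_emb [OF h] by (rule csubspace_add [OF closed_csubspace_cspan, rotated])
      qed
      moreover have "VE j (\<K> \<eta>) \<in> closed_cspan ?G" if \<eta>: "\<eta> \<in> Fock \<L>" for \<eta>
        using creation_in_Fock [OF closed_csubspace_L \<eta>] by (intro cspan_inc) (auto simp flip: Kappa_creation [OF \<eta>])
      moreover have "VE j (?k \<xi>) \<in> closed_cspan ?G" if \<xi>: "\<xi> \<in> Fock DE" for \<xi>
        using creation_in_Fock [OF DE \<xi>] by (intro cspan_inc) (auto simp: Vk [OF \<xi>])
      ultimately show ?thesis
        using \<open>s \<in> ?G\<close> by blast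
    qed
    have V_cspan: "VE j x \<in> closed_cspan ?G" if "x \<in> closed_cspan ?G" for j x
      by (rule bounded_op_maps_cspan [OF row_isometry_bounded_op [OF V K] K GK closed_csubspace_cspan VG that])
    have k_cspan: "?k \<xi> \<in> closed_cspan ?G" if "\<xi> \<in> Fock DE" for \<xi>
      using that by (intro cspan_inc) auto
    \<comment> \<open>The vectors of H_E reached by the generators. Invariance under E holds because
      V_j x and E_j x differ by a defect vector, which lies in the image of
      \<open>?k\<close>.\<close>
    define Z where "Z = {x \<in> HE. (x, 0) \<in> closed_cspan ?G}"
    have "Z = HE"
    proof (rule lifting_minimal [unfolded minimal_lifting_def, rule_format], intro conjI allI)
      have "bounded_op HE KE (\<lambda>x. (x, 0))"
        by (rule isom_bounded_op [OF lifting_HE E.emb E.emb_in])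
      then show "closed_csubspace Z"
        unfolding Z_def by (rule closed_csubspace_vimage [OF _ lifting_HE closed_csubspace_cspan])
      show "Z \<subseteq> HE"
        by (auto simp: Z_def)
      show "HC \<times> {0} \<subseteq> Z"
        using csubspace_0 [OF lifting_HA] by (auto simp: Z_def intro!: cspan_inc)
      show "E j ` Z \<subseteq> Z" for j
      proof (rule image_subsetI)
        fix x assume x: "x \<in> Z"
        then have xH: "x \<in> HE"
          by (simp add: Z_def)
        have "VE j (x, 0) = (E j x, 0) + ?k (vacuum \<otimes> defect_op HE E (axis j x))"
          unfolding E.V_emb [OF xH] by (subst KE) (intro vacuum_tensor_in_Fock DE defect_op_in
            lifting_HE lifting_row axis_in_copies xH refl)+
        moreover have "VE j (x, 0) \<in> closed_cspan ?G"
          using x by (intro V_cspan) (simp add: Z_def)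
        moreover have "?k (vacuum \<otimes> defect_op HE E (axis j x)) \<in> closed_cspan ?G"
          by (intro k_cspan vacuum_tensor_in_Fock DE defect_op_in lifting_HE lifting_row axis_in_copies xH)
        ultimately have "(E j x, 0) \<in> closed_cspan ?G"
          using csubspace_diff [OF closed_csubspace_cspan] by (metis add_diff_cancel_right')
        then show "E j x \<in> Z"
          using E.T_in [OF xH] by (simp add: Z_def)
      qed
    qed
    have "x \<in> closed_cspan ?G" if x: "x \<in> KE" for x
    proof -
      have "fst x \<in> Z"
        using x \<open>Z = HE\<close> by auto
      then have "(fst x, 0) + ?k (snd x) \<in> closed_cspan ?G"
        using x by (intro csubspace_add [OF closed_csubspace_cspan] k_cspan) (auto simp: Z_def)
      then show ?thesis
        by simp
    qed
    then show "closed_cspan ?G = KE"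
      using cspan_subset [OF GK K] by blast
    show "isom (Fock DE) ?k"
      by (simp add: isom_def cinner_prod_def)
    show "?k \<xi> \<in> KE" if "\<xi> \<in> Fock DE" for \<xi>
      using that by (simp add: zero_prod_def csubspace_0 [OF HC] csubspace_0 [OF lifting_HA])
    show "cinner (embC h) (?k \<xi>) = 0" for h \<xi>
      by (simp add: cinner_prod_def)
  qed (simp_all only: HC C DE K V emb emb_in Kappa_isom Kappa_in cinner_emb_Kappa V_emb Kappa_creation)
qed

interpretation lift: coupling HC C DE "calM HC C HA E" KE VE embC "Kappa HC C embC VE" "\<lambda>\<xi>. (0, \<xi>)"
  by (rule coupling_lifting)

section \<open>The lifting as a compression of its dilation, with injective symbol\<close>

lemma lifting_residual: "lift.R = HE \<times> {0}"
proof
  show "lift.R \<subseteq> HE \<times> {0}"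
  proof
    fix z assume "z \<in> lift.R"
    then have z: "fst z \<in> HE" "cinner (0, snd z) z = 0"
      by (auto simp: ortho_diff_def)
    then have "snd z = 0"
      by (simp add: cinner_prod_def)
    then show "z \<in> HE \<times> {0}"
      using z(1) by (simp add: mem_Times_iff)
  qed
qed (auto simp: ortho_diff_def cinner_prod_def csubspace_0 [OF lift.FD])

lemma lifting_compresses: "lift.compresses_to HA E (\<lambda>x. (x, 0))"
  unfolding lift.compresses_to_def
proof (intro conjI allI ballI)
  show "unitary_op HE lift.R (\<lambda>x. (x, 0))"
    by (rule unitary_opI [OF lifting_HE]) (auto simp: isom_def cinner_prod_def lifting_residual)
  note E_in = bounded_op_in [OF row_contraction_bounded_op [OF lifting_HE lifting_row]]
  show "E j x \<in> HE" "(E j x, 0) = lift.T j (x, 0)" if x: "x \<in> HE" for j x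
  proof -
    show "E j x \<in> HE"
      by (rule E_in [OF x])
    show "(E j x, 0) = lift.T j (x, 0)"
      unfolding lift.T_def
      by (intro proj_eqI [OF lift.R, symmetric])
        (use E_in [OF x] in \<open>auto simp: lifting_residual min_dilation_def cinner_prod_def creation_zero\<close>)
  qed
qed simp

lemma lifting_symbol_inj: "inj_on (symbol (calM HC C HA E)) DE"
proof (rule inj_onI)
  note E_in = bounded_op_in [OF row_contraction_bounded_op [OF lifting_HE lifting_row]]
  let ?vac = "\<lambda>\<delta>. vacuum \<otimes> \<delta> :: ('d, ('c \<times> 'a) ^ 'd) fock"
  fix \<delta>1 \<delta>2
  assume \<delta>12: "\<delta>1 \<in> DE" "\<delta>2 \<in> DE" and eq: "symbol (calM HC C HA E) \<delta>1 = symbol (calM HC C HA E) \<delta>2"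
  define \<delta> where "\<delta> = \<delta>1 - \<delta>2"
  have \<delta>: "\<delta> \<in> DE"
    unfolding \<delta>_def by (intro csubspace_diff lift.D \<delta>12)
  have "?vac \<delta> = ?vac \<delta>1 - ?vac \<delta>2"
    unfolding \<delta>_def vacuum_def by (intro bounded_op_diff [OF bounded_op_basis_tensor closed_csubspace_UNIV]) auto
  then have M0: "calM HC C HA E (?vac \<delta>) = 0"
    using eq by (simp add: symbol_def bounded_op_diff [OF lift.M_op lift.FD] lift.vac_in \<delta>12)
  define l where "l = (0 :: 'c \<times> 'a, ?vac \<delta>)"
  have l_e: "cinner l (embC h) = 0" for h
    by (simp add: l_def cinner_prod_def)
  have l_c: "cinner l (Kappa HC C embC VE \<eta>) = 0" if "\<eta> \<in> Fock (defect_space HC C)" for \<eta>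
    using lift.k_c [OF that lift.vac_in [OF \<delta>]] by (simp add: l_def M0)
  let ?P = "\<lambda>\<alpha> x. cinner l (foldr VE \<alpha> (x, 0))"
  have dil_E: "VE j (x, 0) = (E j x, 0) + (0, ?vac (defect_op HE E (axis j x)))" for j x
    by (simp add: min_dilation_def creation_zero)
  \<comment> \<open>Orthogonality is required for all words at once, so that a further letter stays
    within the condition; for the empty word it is automatic.\<close>
  define Z where "Z = (\<Inter>\<alpha>. {x \<in> HE. foldr VE \<alpha> (x, 0) \<in> UNIV \<ominus> {l}})"
  have Zin: "cinner l (foldr VE \<alpha> (x, 0)) = 0" if "x \<in> Z" for \<alpha> x
    using that by (auto simp: Z_def ortho_diff_def)
  have ZI: "x \<in> Z" if "x \<in> HE" "\<And>\<alpha>. cinner l (foldr VE \<alpha> (x, 0)) = 0" for x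
    using that by (auto simp: Z_def ortho_diff_def)
  have "Z = HE"
  proof (rule lifting_minimal [unfolded minimal_lifting_def, rule_format], intro conjI allI)
    have emb: "bounded_op HE KE (\<lambda>x. (x, 0))"
      by (rule isom_bounded_op [OF lifting_HE])
        (auto simp: isom_def cinner_prod_def csubspace_0 [OF lift.FD])
    show "closed_csubspace Z"
      unfolding Z_def
      by (intro closed_csubspace_INT closed_csubspace_vimage [OF bounded_op_comp [OF emb lift.V_word_op]]
          lifting_HE closed_csubspace_ortho_diff closed_csubspace_UNIV)
    show "Z \<subseteq> HE"
      by (auto simp: Z_def)
    show "HC \<times> {0} \<subseteq> Z"
    proof clarify
      fix h assume h: "h \<in> HC"
      \<comment> \<open>Generators of the dilation space of \<open>C\<close>. Their closed span is
        invariant under V and orthogonal to \<open>l\<close>, the latter by \<open>l_e\<close> and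
        \<open>l_c\<close>.\<close>
      let ?G = "embC ` HC \<union> Kappa HC C embC VE ` Fock (defect_space HC C)"
      have V_cspan: "VE j x \<in> closed_cspan ?G" if "x \<in> closed_cspan ?G" for j x
      proof (rule bounded_op_maps_cspan [OF lift.V_op lift.K _ closed_csubspace_cspan _ that])
        show "?G \<subseteq> KE"
          by (intro Un_least image_subsetI lift.e(2) lift.c(2))
        have "VE j (embC g) \<in> closed_cspan ?G" if "g \<in> HC" for g
          unfolding lift.V_e [OF that]
          using imageI [OF lift.C_in [OF that], of embC] imageI [OF lift.vac_defect_in [OF that], of "Kappa HC C embC VE"]
          by (intro csubspace_add [OF closed_csubspace_cspan] cspan_inc) simp_all
        moreover have "VE j (Kappa HC C embC VE \<eta>) \<in> closed_cspan ?G" if "\<eta> \<in> Fock (defect_space HC C)" for \<eta>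
          unfolding lift.V_c [OF that] by (intro cspan_inc UnI2 imageI creation_in_Fock lift.L that)
        ultimately show "VE j s \<in> closed_cspan ?G" if "s \<in> ?G" for s
          using that by blast
      qed
      have "embC h \<in> closed_cspan ?G"
        using h by (intro cspan_inc) auto
      then have "foldr VE \<alpha> (embC h) \<in> closed_cspan ?G" for \<alpha>
        by (induction \<alpha>) (simp_all add: V_cspan)
      then have "cinner (foldr VE \<alpha> (embC h)) l = 0" for \<alpha>
        by (rule cinner_cspan_eq_0 [rotated]) (use l_e l_c in \<open>auto simp: cinner_eq_0_commute [of _ l]\<close>)
      then show "(h, 0) \<in> Z"
        using h csubspace_0 [OF lifting_HA] by (intro ZI) (simp_all add: cinner_eq_0_commute [of l])
    qed
    show "E i ` Z \<subseteq> Z" for i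
    proof (rule image_subsetI)
      fix x assume x: "x \<in> Z"
      then have xH: "x \<in> HE"
        by (simp add: Z_def)
      let ?\<zeta> = "?vac (defect_op HE E (axis i x))"
      have \<zeta>: "?\<zeta> \<in> Fock DE"
        by (intro vacuum_tensor_in_Fock lift.D defect_op_in lifting_HE lifting_row axis_in_copies xH)
      \<comment> \<open>Words keep the defect vector in \<Gamma> \<otimes> D; for a nonempty word
        the outermost letter puts it into the range of a creation operator, which is orthogonal to
        the vacuum vector in \<open>l\<close>.\<close>
      have words: "\<exists>\<eta>\<in>Fock DE. foldr VE \<beta> (0, ?\<zeta>) = (0, \<eta>)" for \<beta>
        by (induction \<beta>) (use \<zeta> lift.V_k creation_in_Fock [OF lift.D] in auto)
      have "cinner l (foldr VE \<alpha> (E i x, 0)) = 0" for \<alpha>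
      proof (cases \<alpha>)
        case Nil
        then show ?thesis
          by (simp add: l_def cinner_prod_def)
      next
        case (Cons j \<beta>)
        obtain \<eta> where "\<eta> \<in> Fock DE" "foldr VE \<beta> (0, ?\<zeta>) = (0, \<eta>)"
          using words by blast
        then have "cinner l (foldr VE \<alpha> (0, ?\<zeta>)) = 0"
          by (simp add: Cons lift.V_k l_def cinner_prod_def cinner_vacuum_creation)
        moreover have "cinner l (foldr VE \<alpha> (VE i (x, 0))) = 0"
          using Zin [OF x, of "\<alpha> @ [i]"] by simp
        moreover have "foldr VE \<alpha> (VE i (x, 0)) = foldr VE \<alpha> (E i x, 0) + foldr VE \<alpha> (0, ?\<zeta>)"
          unfolding dil_E using bounded_op_in [OF emb E_in [OF xH]] lift.k(2) [OF \<zeta>]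
          by (rule bounded_op_add [OF lift.V_word_op])
        ultimately show ?thesis
          by (simp add: cinner_add_right)
      qed
      then show "E i x \<in> Z"
        by (intro ZI E_in xH)
    qed
  qed
  have "cinner (defect_op HE E (axis j x)) \<delta> = 0" if x: "x \<in> HE" for j x
  proof -
    have "cinner l (VE j (x, 0)) = 0"
      using Zin [of x "[j]"] x \<open>Z = HE\<close> by simp
    then show ?thesis
      unfolding dil_E by (simp add: l_def cinner_prod_def cinner_vacuum_tensor cinner_eq_0_commute [of \<delta>])
  qed
  then have 0: "cinner s \<delta> = 0" if "s \<in> (\<lambda>p. defect_op HE E (axis (fst p) (snd p))) ` (UNIV \<times> HE)" for s
    using that by (elim imageE) (simp add: mem_Times_iff)
  have "\<delta> \<in> closed_cspan ((\<lambda>p. defect_op HE E (axis (fst p) (snd p))) ` (UNIV \<times> HE))"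
    using \<delta> defect_space_eq_cspan_axis [OF lifting_HE lifting_row] by (simp add: case_prod_unfold)
  then have "cinner \<delta> \<delta> = 0"
    by (rule cinner_cspan_eq_0 [rotated]) (rule 0)
  then show "\<delta>1 = \<delta>2"
    by (simp add: \<delta>_def)
qed

end

section \<open>The coupling of a contractive multi-analytic operator\<close>

context
  fixes HC :: "'c::complex_hilbert set" and C :: "'d::finite \<Rightarrow> 'c \<Rightarrow> 'c"
    and D :: "'x::complex_hilbert set" and M :: "('d, 'x) fock \<Rightarrow> ('d, 'c ^ 'd) fock"
  assumes HC: "closed_csubspace HC" and C: "row_contraction HC C"
    and D: "closed_csubspace D" and M: "contractive_multi_analytic D (defect_space HC C) M"
begin

private abbreviation (input) "L \<equiv> defect_space HC C"
private abbreviation (input) "\<Delta> \<equiv> Delta D M"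
private abbreviation (input) "S \<equiv> closure (Delta D M ` Fock D)"
private abbreviation (input) "N \<equiv> model_shift (defect_space HC C) D M"
private abbreviation (input) "VM \<equiv> coupled_shift HC C D M"
private abbreviation (input) "KM \<equiv> HC \<times> model_space (defect_space HC C) D M"

lemma model_L: "closed_csubspace L"
  by (rule closed_csubspace_defect_space [OF HC C])

lemma model_FL: "closed_csubspace (Fock L :: ('d, 'c ^ 'd) fock set)"
  by (rule closed_csubspace_Fock [OF model_L])

lemma model_FD: "closed_csubspace (Fock D :: ('d, 'x) fock set)"
  by (rule closed_csubspace_Fock [OF D])

lemma model_M_op: "bounded_op (Fock D) (Fock L) M"
  and model_M_creation: "\<xi> \<in> Fock D \<Longrightarrow> M (creation j \<xi>) = creation j (M \<xi>)"
  and model_M_norm: "\<xi> \<in> Fock D \<Longrightarrow> norm (M \<xi>) \<le> norm \<xi>"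
  using M by (auto simp: contractive_multi_analytic_def multi_analytic_def)

lemma model_M_in: "\<xi> \<in> Fock D \<Longrightarrow> M \<xi> \<in> Fock L"
  by (rule bounded_op_in [OF model_M_op])

text \<open>Read backwards, the Gram identity says that \<xi> |-> (M \<xi>, \<Delta> \<xi>) is
  isometric, which embeds \<Gamma> \<otimes> D into the model space.\<close>

lemma Delta_op: "bounded_op (Fock D) (Fock D) \<Delta>"
  and cinner_Delta: "x \<in> Fock D \<Longrightarrow> y \<in> Fock D \<Longrightarrow>
    cinner (\<Delta> x) (\<Delta> y) = cinner x y - cinner (M x) (M y)"
proof -
  let ?Q = "\<lambda>\<xi>. \<xi> - adj (Fock D) M (M \<xi>)"
  have Q: "?Q x \<in> Fock D" if "x \<in> Fock D" for x
    by (intro csubspace_diff [OF model_FD] that adj_in [OF model_M_op model_FD])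
  have c: "cinner x (?Q y) = cinner x y - cinner (M x) (M y)" if "x \<in> Fock D" for x y
    by (simp add: cinner_diff_right cinner_adj_right [OF model_M_op model_FD] that)
  show "bounded_op (Fock D) (Fock D) \<Delta>"
    unfolding Delta_def by (rule sqrt_op_gram(1) [OF model_FD model_M_op model_M_norm Q c])
  show "cinner (\<Delta> x) (\<Delta> y) = cinner x y - cinner (M x) (M y)" if "x \<in> Fock D" "y \<in> Fock D"
    unfolding Delta_def by (rule sqrt_op_gram(2) [OF model_FD model_M_op model_M_norm Q c that])
qed

lemma closure_Delta: "closed_cspan (\<Delta> ` Fock D) = S"
  by (rule closure_image_eq_cspan [OF model_FD Delta_op, symmetric])

lemma model_S: "closed_csubspace S"
  unfolding closure_Delta [symmetric] by simp

lemma Delta_in: "\<xi> \<in> Fock D \<Longrightarrow> \<Delta> \<xi> \<in> S"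
  by (rule subsetD [OF closure_subset imageI])

lemma Delta_zero: "\<Delta> 0 = 0"
  by (rule bounded_op_0 [OF Delta_op model_FD])

lemma closed_csubspace_model_space: "closed_csubspace (model_space L D M)"
  unfolding model_space_def by (intro closed_csubspace_Times model_FL model_S)

lemma model_space_eq_cspan:
  "closed_cspan ((\<lambda>(\<eta>, \<xi>). (\<eta>, \<Delta> \<xi>)) ` (Fock L \<times> Fock D)) = model_space L D M"
proof
  let ?G = "(\<lambda>(\<eta>, \<xi>). (\<eta>, \<Delta> \<xi>)) ` ((Fock L :: ('d, 'c ^ 'd) fock set) \<times> Fock D)"
  show "closed_cspan ?G \<subseteq> model_space L D M"
    by (rule cspan_subset [OF _ closed_csubspace_model_space]) (auto simp: model_space_def Delta_in)
  have "(\<eta>, \<zeta>) \<in> closed_cspan ?G" if \<eta>: "\<eta> \<in> Fock L" and \<zeta>: "\<zeta> \<in> S" for \<eta> \<zeta>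
  proof -
    have "(\<eta>, 0) \<in> closed_cspan ?G"
      by (rule cspan_inc, rule image_eqI [of _ _ "(\<eta>, 0)"]) (simp_all add: Delta_zero csubspace_0 [OF model_FD] \<eta>)
    moreover
    have op: "bounded_op S UNIV (\<lambda>\<zeta>. (0 :: ('d, 'c ^ 'd) fock, \<zeta>))"
      by (rule isom_bounded_op [OF model_S]) (simp_all add: isom_def cinner_prod_def)
    have "(0, \<zeta>) \<in> closed_cspan ?G"
    proof (rule bounded_op_maps_cspan [OF op model_S])
      show "\<Delta> ` Fock D \<subseteq> S" "\<zeta> \<in> closed_cspan (\<Delta> ` Fock D)"
        using \<zeta> by (auto simp: closure_Delta Delta_in)
      show "(0, s) \<in> closed_cspan ?G" if "s \<in> \<Delta> ` Fock D" for s
        using that csubspace_0 [OF model_FL] by (intro cspan_inc) auto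
    qed auto
    ultimately have "(\<eta>, 0) + (0, \<zeta>) \<in> closed_cspan ?G"
      by (rule csubspace_add [OF closed_csubspace_cspan])
    then show ?thesis
      by simp
  qed
  then show "model_space L D M \<subseteq> closed_cspan ?G"
    by (auto simp: model_space_def)
qed

text \<open>Settles the choice in \<open>model_shift\<close>: as \<open>M\<close> commutes with
  creation, \<open>\<Delta>\<close> after creation has the Gram matrix of \<open>\<Delta>\<close>,
  so the prescription on generators extends isometrically.\<close>

lemma model_shift_props:
  "bounded_op (model_space L D M) (model_space L D M) (N j) \<and>
    (\<forall>\<eta>\<in>Fock L. \<forall>\<xi>\<in>Fock D. N j (\<eta>, \<Delta> \<xi>) = (creation j \<eta>, \<Delta> (creation j \<xi>)))"
proof -
  let ?I = "(Fock L :: ('d, 'c ^ 'd) fock set) \<times> (Fock D :: ('d, 'x) fock set)"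
  let ?f = "\<lambda>(\<eta>, \<xi>). (\<eta>, \<Delta> \<xi>)" and ?g = "\<lambda>(\<eta>, \<xi>). (creation j \<eta>, \<Delta> (creation j \<xi>))"
  have "cinner (?f p) (?f q) = cinner (?g p) (?g q)" if "p \<in> ?I" "q \<in> ?I" for p q
    using that by (auto simp: cinner_prod_def cinner_creation cinner_Delta creation_in_Fock [OF D] model_M_creation)
  then obtain u where u: "unitary_op (closed_cspan (?f ` ?I)) (closed_cspan (?g ` ?I)) u"
    "\<And>p. p \<in> ?I \<Longrightarrow> u (?f p) = ?g p"
    using gram_unitary [of ?I ?f ?g] by blast
  have "closed_cspan (?g ` ?I) \<subseteq> model_space L D M"
    by (rule cspan_subset [OF _ closed_csubspace_model_space])
      (auto simp: model_space_def Delta_in creation_in_Fock [OF D] creation_in_Fock [OF model_L])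
  then have "bounded_op (model_space L D M) (model_space L D M) u"
    using unitary_opD(3) [OF u(1)] by (simp add: model_space_eq_cspan bounded_op_mono)
  moreover have "u (\<eta>, \<Delta> \<xi>) = (creation j \<eta>, \<Delta> (creation j \<xi>))" if "\<eta> \<in> Fock L" "\<xi> \<in> Fock D" for \<eta> \<xi>
    using u(2) [of "(\<eta>, \<xi>)"] that by simp
  ultimately have "\<exists>V. bounded_op (model_space L D M) (model_space L D M) V \<and>
    (\<forall>\<eta>\<in>Fock L. \<forall>\<xi>\<in>Fock D. V (\<eta>, \<Delta> \<xi>) = (creation j \<eta>, \<Delta> (creation j \<xi>)))"
    by blast
  then show ?thesis
    unfolding model_shift_def by (rule someI_ex)
qed

lemma model_shift_Delta: "\<xi> \<in> Fock D \<Longrightarrow> N j (0, \<Delta> \<xi>) = (0, \<Delta> (creation j \<xi>))"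
  using model_shift_props csubspace_0 [OF model_FL] by (simp add: creation_zero)

lemma model_shift_op: "bounded_op S (model_space L D M) (\<lambda>\<zeta>. N j (0, \<zeta>))"
proof -
  have op: "bounded_op S (model_space L D M) (\<lambda>\<zeta>. (0, \<zeta>))"
    by (rule isom_bounded_op [OF model_S])
      (auto simp: isom_def cinner_prod_def model_space_def csubspace_0 [OF model_FL])
  show ?thesis
    by (rule bounded_op_comp [OF op conjunct1 [OF model_shift_props]])
qed

lemma model_shift_in: "\<zeta> \<in> S \<Longrightarrow> N j (0, \<zeta>) \<in> {0} \<times> S"
proof (rule bounded_op_maps_cspan [OF model_shift_op model_S _ closed_csubspace_Times
      [OF closed_csubspace_singleton model_S]])
  show "\<Delta> ` Fock D \<subseteq> S"
    by (auto simp: Delta_in)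
qed (auto simp: closure_Delta model_shift_Delta Delta_in creation_in_Fock [OF D])

lemma cinner_model_shift:
  assumes "x \<in> S" "y \<in> S"
  shows "cinner (N i (0, x)) (N j (0, y)) = (if i = j then cinner x y else 0)"
proof -
  \<comment> \<open>The case distinction is put into a bounded operator, so that one extension from
    generators covers both cases.\<close>
  let ?p = "\<lambda>x :: ('d, 'x) fock. if i = j then x else 0"
  have sub: "\<Delta> ` Fock D \<subseteq> S"
    by (auto simp: Delta_in)
  have p: "bounded_op S UNIV ?p" and id: "bounded_op S UNIV (\<lambda>x. x)"
    by (auto simp: bounded_op_def intro!: exI [of _ 1])
  have "cinner (N i (0, x)) (N j (0, y)) = cinner (?p x) y"
  proof (rule cinner_eq_on_cspan [OF model_shift_op p model_S sub model_shift_op id model_S sub])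
    show "x \<in> closed_cspan (\<Delta> ` Fock D)" "y \<in> closed_cspan (\<Delta> ` Fock D)"
      using assms by (simp_all add: closure_Delta)
  qed (auto simp: model_shift_Delta cinner_prod_def cinner_Delta creation_in_Fock [OF D] model_M_creation
      cinner_creation)
  then show ?thesis
    by simp
qed

text \<open>By \<open>model_shift_in\<close> the model shift of a pure \<Delta>-component has no
  first coordinate, so the \<Delta>-component evolves by itself.\<close>

lemma coupled_shift_eq:
  assumes "\<zeta> \<in> S"
  shows "VM j (h, \<eta>, \<zeta>) = (C j h, vacuum \<otimes> defect_op HC C (axis j h) + creation j \<eta>, snd (N j (0, \<zeta>)))"
  using model_shift_in [OF assms, of j] by (auto simp: coupled_shift_def min_dilation_def)

lemma row_isometry_coupled_shift: "row_isometry KM VM"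
proof -
  have d: "defect_op HC C (axis j h) \<in> L" if "h \<in> HC" for j h
    by (rule defect_op_in [OF HC C axis_in_copies [OF HC that]])
  have "VM j x \<in> KM" if x: "x \<in> KM" for j x
  proof -
    obtain h \<eta> \<zeta> where x: "x = (h, \<eta>, \<zeta>)" "h \<in> HC" "\<eta> \<in> Fock L" "\<zeta> \<in> S"
      using x by (auto simp: model_space_def)
    have "snd (N j (0, \<zeta>)) \<in> S"
      using model_shift_in [OF x(4), of j] by auto
    moreover have "vacuum \<otimes> defect_op HC C (axis j h) + creation j \<eta> \<in> Fock L"
      by (intro csubspace_add [OF model_FL] vacuum_tensor_in_Fock model_L d creation_in_Fock x)
    moreover have "C j h \<in> HC"
      by (rule bounded_op_in [OF row_contraction_bounded_op [OF HC C] x(2)])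
    ultimately show ?thesis
      by (simp add: x(1) coupled_shift_eq [OF x(4)] model_space_def)
  qed
  moreover have "cinner (VM i x) (VM j y) = (if i = j then cinner x y else 0)"
    if xy: "x \<in> KM" "y \<in> KM" for i j x y
  proof -
    obtain h \<eta> \<zeta> where x: "x = (h, \<eta>, \<zeta>)" "h \<in> HC" "\<eta> \<in> Fock L" "\<zeta> \<in> S"
      using xy(1) by (auto simp: model_space_def)
    obtain h' \<eta>' \<zeta>' where y: "y = (h', \<eta>', \<zeta>')" "h' \<in> HC" "\<eta>' \<in> Fock L" "\<zeta>' \<in> S"
      using xy(2) by (auto simp: model_space_def)
    have "cinner (snd (N i (0, \<zeta>))) (snd (N j (0, \<zeta>'))) = (if i = j then cinner \<zeta> \<zeta>' else 0)"
      using cinner_model_shift [OF x(4) y(4), of i j] model_shift_in [OF x(4), of i] by (auto simp: cinner_prod_def)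
    then show ?thesis
      using x(2) y(2) by (simp add: x(1) y(1) coupled_shift_eq x(4) y(4) cinner_prod_def cinner_add_left
          cinner_add_right cinner_vacuum_tensor cinner_vacuum_creation cinner_creation_vacuum cinner_creation
          cinner_defect_op_axis [OF HC C])
  qed
  ultimately show ?thesis
    unfolding row_isometry_def by blast
qed

text \<open>The embedding of \<Gamma> \<otimes> D is isometric by \<open>cinner_Delta\<close>, and
  its component in \<Gamma> \<otimes> D_C is M \<xi>, which is what \<open>c_k\<close>
  demands.\<close>

lemma coupling_model:
  "coupling HC C D M KM VM (\<lambda>h. (h, 0, 0)) (\<lambda>\<eta>. (0, \<eta>, 0)) (\<lambda>\<xi>. (0, M \<xi>, \<Delta> \<xi>))"
proof -
  note zero = csubspace_0 [OF HC] csubspace_0 [OF model_FL] csubspace_0 [OF model_S]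
  have C0: "C j 0 = 0" for j
    by (rule bounded_op_0 [OF row_contraction_bounded_op [OF HC C] HC])
  have D0: "defect_op HC C (axis j 0) = 0" for j
    using bounded_op_0 [OF bounded_op_defect_op [OF HC C] closed_csubspace_copies [OF HC]] by (simp add: axis_zero)
  have N0: "snd (N j (0, 0)) = 0" for j
    using bounded_op_0 [OF model_shift_op model_S, of j] by simp
  have K: "closed_csubspace KM"
    by (intro closed_csubspace_Times HC closed_csubspace_model_space)
  let ?e = "\<lambda>h. (h, 0, 0) :: 'c \<times> ('d, 'c ^ 'd) fock \<times> ('d, 'x) fock"
  let ?c = "\<lambda>\<eta>. (0, \<eta>, 0) :: 'c \<times> ('d, 'c ^ 'd) fock \<times> ('d, 'x) fock"
  let ?k = "\<lambda>\<xi>. (0, M \<xi>, \<Delta> \<xi>) :: 'c \<times> ('d, 'c ^ 'd) fock \<times> ('d, 'x) fock"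
  let ?G = "?e ` HC \<union> ?c ` Fock L \<union> ?k ` Fock D"
  have GK: "?G \<subseteq> KM"
    by (auto simp: model_space_def zero model_M_in Delta_in)
  show ?thesis
  proof
    show "closed_csubspace KM" "row_isometry KM VM"
      by (rule K row_isometry_coupled_shift)+
    show "isom HC ?e" "isom (Fock L) ?c"
      by (auto simp: isom_def cinner_prod_def)
    show "isom (Fock D) ?k"
      by (auto simp: isom_def cinner_prod_def cinner_Delta)
    show "VM j (?e h) = ?e (C j h) + ?c (vacuum \<otimes> defect_op HC C (axis j h))" if "h \<in> HC" for j h
      by (simp add: coupled_shift_eq zero creation_zero N0)
    show "VM j (?c \<eta>) = ?c (creation j \<eta>)" for j \<eta>
      by (simp add: coupled_shift_eq zero C0 D0 tensor_zero_right N0)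
    show "VM j (?k \<xi>) = ?k (creation j \<xi>)" if "\<xi> \<in> Fock D" for j \<xi>
      using that by (simp add: coupled_shift_eq Delta_in C0 D0 tensor_zero_right model_shift_Delta model_M_creation)
    have "(h, \<eta>, \<zeta>) \<in> closed_cspan ?G" if h: "h \<in> HC" and \<eta>: "\<eta> \<in> Fock L" and \<zeta>: "\<zeta> \<in> S" for h \<eta> \<zeta>
    proof -
      have e: "?e h \<in> closed_cspan ?G"
        using h by (intro cspan_inc) auto
      have c: "?c \<eta> \<in> closed_cspan ?G" if "\<eta> \<in> Fock L" for \<eta>
        using that by (intro cspan_inc) auto
      have op: "bounded_op S UNIV (\<lambda>\<zeta>. (0 :: 'c, 0 :: ('d, 'c ^ 'd) fock, \<zeta>))"
        by (rule isom_bounded_op [OF model_S]) (simp_all add: isom_def cinner_prod_def)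
      have "(0, 0, \<zeta>) \<in> closed_cspan ?G"
      proof (rule bounded_op_maps_cspan [OF op model_S])
        show "\<Delta> ` Fock D \<subseteq> S" "\<zeta> \<in> closed_cspan (\<Delta> ` Fock D)"
          using \<zeta> by (auto simp: closure_Delta Delta_in)
        show "(0, 0, s) \<in> closed_cspan ?G" if "s \<in> \<Delta> ` Fock D" for s
        proof -
          obtain \<xi> where \<xi>: "\<xi> \<in> Fock D" "s = \<Delta> \<xi>"
            using \<open>s \<in> \<Delta> ` Fock D\<close> by blast
          have "?k \<xi> \<in> closed_cspan ?G"
            using \<xi>(1) by (intro cspan_inc) auto
          \<comment> \<open>The \<Delta>-component alone is not a generator; it is what remains of
            \<open>?k \<xi>\<close> after removing its component in \<Gamma> \<otimes> D_C.\<close>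
          then have "?k \<xi> - ?c (M \<xi>) \<in> closed_cspan ?G"
            using c [OF model_M_in [OF \<xi>(1)]] by (rule csubspace_diff [OF closed_csubspace_cspan])
          then show ?thesis
            by (simp add: \<xi>(2))
        qed
      qed auto
      with e c [OF \<eta>] have "?e h + ?c \<eta> + (0, 0, \<zeta>) \<in> closed_cspan ?G"
        by (intro csubspace_add [OF closed_csubspace_cspan])
      then show ?thesis
        by simp
    qed
    then have "KM \<subseteq> closed_cspan ?G"
      by (auto simp: model_space_def)
    then show "closed_cspan ?G = KM"
      using cspan_subset [OF GK K] by blast
  qed (auto simp: HC C D model_space_def zero model_M_in Delta_in cinner_prod_def)
qed

interpretation model: coupling HC C D M KM VM "\<lambda>h. (h, 0, 0)" "\<lambda>\<eta>. (0, \<eta>, 0)" "\<lambda>\<xi>. (0, M \<xi>, \<Delta> \<xi>)"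
  by (rule coupling_model)

section \<open>The lifting read off from the model\<close>

lemma model_residual_eq: "model.R = HC \<times> calE_space HC C D M"
  by (auto simp: ortho_diff_def calE_space_def model_residual_def cinner_prod_def)

lemma model_T_eq: "model.T j x = calE HC C D M j x"
  by (simp add: model.T_def calE_def model_residual_eq)

lemma closed_csubspace_calE_space: "closed_csubspace (calE_space HC C D M)"
  unfolding calE_space_def model_residual_def
  by (rule closed_csubspace_ortho_diff [OF closed_csubspace_model_space])

lemma model_compresses: "model.compresses_to (calE_space HC C D M) (calE HC C D M) (\<lambda>x. x)"
  unfolding model.compresses_to_def model_T_eq [symmetric] model_residual_eq [symmetric]
proof (intro conjI allI ballI)
  show "unitary_op model.R model.R (\<lambda>x. x)"
    by (rule unitary_opI [OF model.R]) (auto simp: isom_def)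
qed (auto simp: model.T_in zero_prod_def)

text \<open>The residual space is a product with H_C as a full factor, so the projection acts
  coordinatewise and fixes the first coordinate C_j h of the shifted vector.\<close>

lemma fst_calE:
  assumes "x \<in> HC \<times> calE_space HC C D M"
  shows "fst (calE HC C D M j x) = C j (fst x)"
proof -
  let ?A = "calE_space HC C D M"
  have "x \<in> model.R"
    using assms by (simp add: model_residual_eq)
  then obtain h \<eta> \<zeta> where x: "x = (h, \<eta>, \<zeta>)" "h \<in> HC" "\<zeta> \<in> S"
    by (auto simp: ortho_diff_def model_space_def)
  obtain y where y: "VM j x = (C j h, y)"
    by (simp add: x coupled_shift_eq)
  have Ch: "C j h \<in> HC"
    by (rule bounded_op_in [OF row_contraction_bounded_op [OF HC C] x(2)])
  have "proj (HC \<times> ?A) (C j h, y) = (C j h, proj ?A y)"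
    by (rule proj_eqI [OF closed_csubspace_Times [OF HC closed_csubspace_calE_space]])
      (auto simp: Ch proj_in [OF closed_csubspace_calE_space] cinner_Pair
        cinner_proj_diff [OF closed_csubspace_calE_space])
  then show ?thesis
    by (simp add: calE_def y) (simp add: x)
qed

lemma minimal_contractive_lifting_calE:
  "minimal_contractive_lifting HC C (calE_space HC C D M) (calE HC C D M)"
proof -
  let ?A = "calE_space HC C D M" and ?E = "calE HC C D M"
  note A = closed_csubspace_calE_space
  have row: "row_contraction (HC \<times> ?A) ?E"
    using model.row_contraction_T by (simp add: model_residual_eq model_T_eq [abs_def])
  note HE = closed_csubspace_Times [OF HC A]
  note E_op = row_contraction_bounded_op [OF HE row]
  \<comment> \<open>The second row of the block matrix, read off along the two coordinate
    embeddings.\<close>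
  define B where "B j h = snd (?E j (h, 0))" for j h
  define A' where "A' j a = snd (?E j (0, a))" for j a
  have snd_op: "bounded_op (HC \<times> ?A) ?A snd"
    by (auto simp: bounded_op_def scaleC_prod_def norm_snd_le intro!: exI [of _ 1])
  have i: "bounded_op HC (HC \<times> ?A) (\<lambda>h. (h, 0))" "bounded_op ?A (HC \<times> ?A) (\<lambda>a. (0, a))"
    by (rule isom_bounded_op; simp add: HC A isom_def cinner_prod_def csubspace_0)+
  have "bounded_op HC ?A (B j) \<and> bounded_op ?A ?A (A' j)" for j
    unfolding B_def A'_def
    by (intro conjI bounded_op_comp [OF bounded_op_comp [OF i(1) E_op] snd_op]
        bounded_op_comp [OF bounded_op_comp [OF i(2) E_op] snd_op])
  moreover have "?E j (h, a) = (C j h, B j h + A' j a)" if "h \<in> HC" "a \<in> ?A" for j h a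
  proof -
    have mem: "(h, 0) \<in> HC \<times> ?A" "(0, a) \<in> HC \<times> ?A"
      using that csubspace_0 [OF HC] csubspace_0 [OF A] by auto
    have "?E j (h, a) = ?E j (h, 0) + ?E j (0, a)"
      using bounded_op_add [OF E_op mem, of j] by simp
    moreover have "fst (?E j (h, a)) = C j h"
      using fst_calE [of "(h, a)"] that by simp
    ultimately show ?thesis
      by (auto simp: prod_eq_iff B_def A'_def)
  qed
  ultimately have "contractive_lifting HC C ?A ?E"
    unfolding contractive_lifting_def using A row by blast
  moreover have "minimal_lifting HC ?A ?E"
    unfolding minimal_lifting_def
  proof (intro allI impI, elim conjE)
    fix Z assume Z: "closed_csubspace Z" "Z \<subseteq> HC \<times> ?A" "HC \<times> {0} \<subseteq> Z" "\<forall>j. ?E j ` Z \<subseteq> Z"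
    have "Z = model.R"
    proof (rule model.minimal [OF Z(1)])
      show "Z \<subseteq> model.R"
        using Z(2) by (simp add: model_residual_eq)
      show "(h, 0, 0) \<in> Z" if "h \<in> HC" for h
        using Z(3) that by (auto simp: zero_prod_def)
      show "model.T j z \<in> Z" if "z \<in> Z" for j z
        using Z(4) that by (auto simp: model_T_eq)
    qed
    then show "Z = HC \<times> ?A"
      by (simp add: model_residual_eq)
  qed
  ultimately show ?thesis
    by (simp add: minimal_contractive_lifting_def)
qed

end

section \<open>Hilbert dimension\<close>

definition orthonormal :: "'a::complex_hilbert set \<Rightarrow> bool"
  where "orthonormal B \<longleftrightarrow> (\<forall>b\<in>B. norm b = 1) \<and> (\<forall>b\<in>B. \<forall>c\<in>B. b \<noteq> c \<longrightarrow> cinner b c = 0)"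

lemma orthonormal_subset: "orthonormal B \<Longrightarrow> A \<subseteq> B \<Longrightarrow> orthonormal A"
  by (auto simp: orthonormal_def)

lemma cinner_orthonormal: "orthonormal B \<Longrightarrow> b \<in> B \<Longrightarrow> c \<in> B \<Longrightarrow> cinner b c = (if b = c then 1 else 0)"
  by (auto simp: orthonormal_def cinner_self_norm)

lemma orthonormal_basis_iff: "orthonormal_basis X B \<longleftrightarrow> B \<subseteq> X \<and> orthonormal B \<and> closed_cspan B = X"
  by (auto simp: orthonormal_basis_def orthonormal_def)

lemma orthonormal_basis_exists:
  fixes X :: "'a::complex_hilbert set"
  assumes X: "closed_csubspace X"
  shows "\<exists>B. orthonormal_basis X B"
proof -
  let ?A = "{B. B \<subseteq> X \<and> orthonormal B}"
  have "\<exists>B\<in>?A. \<forall>Y\<in>?A. B \<subseteq> Y \<longrightarrow> Y = B"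
  proof (rule subset_Zorn_nonempty)
    show "?A \<noteq> {}"
      by (auto simp: orthonormal_def intro!: exI [of _ "{}"])
    fix \<C> :: "'a set set"
    assume \<C>: "\<C> \<noteq> {}" "subset.chain ?A \<C>"
    have on: "orthonormal Y" "Y \<subseteq> X" if "Y \<in> \<C>" for Y
      using \<C>(2) that by (auto simp: subset.chain_def)
    have "cinner b c = 0" if "b \<in> Y" "Y \<in> \<C>" "c \<in> Z" "Z \<in> \<C>" "b \<noteq> c" for b c Y Z
    proof -
      have "Y \<subseteq> Z \<or> Z \<subseteq> Y"
        using \<C>(2) that by (auto simp: subset_chain_def)
      then show ?thesis
        using on that by (auto simp: orthonormal_def)
    qed
    then have "orthonormal (\<Union>\<C>)"
      using on unfolding orthonormal_def by blast
    then show "\<Union>\<C> \<in> ?A"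
      using on by auto
  qed
  then obtain B where "B \<in> ?A" and max: "\<forall>Y\<in>?A. B \<subseteq> Y \<longrightarrow> Y = B"
    by (rule bexE)
  then have B: "B \<subseteq> X" "orthonormal B"
    by auto
  have "closed_cspan B = X"
  proof (rule cspan_eqI [OF X B(1)], rule ccontr)
    fix x assume x: "x \<in> X" "x \<noteq> 0" and 0: "\<And>s. s \<in> B \<Longrightarrow> cinner s x = 0"
    \<comment> \<open>A unit vector orthogonal to \<open>B\<close> would enlarge the maximal
      orthonormal family.\<close>
    define y where "y = inverse (norm x) *\<^sub>R x"
    have y: "y \<in> X" "norm y = 1"
      using x by (simp_all add: y_def csubspace_scaleR [OF X])
    have y0: "cinner s y = 0" if "s \<in> B" for s
      using 0 [OF that] by (simp add: y_def cinner_scaleR_right)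
    then have y1: "cinner y s = 0" if "s \<in> B" for s
      using that by (simp add: cinner_eq_0_commute [of y])
    have "orthonormal (insert y B)"
      using B(2) y(2) y0 y1 by (auto simp: orthonormal_def)
    then have "insert y B = B"
      using B(1) y(1) by (intro max [rule_format]) auto
    then have "y \<in> B"
      by (rule subst) simp
    then have "cinner y y = 0"
      by (rule y0)
    then show False
      using y(2) by (simp only: cinner_self_eq_0 norm_zero)
  qed
  then show ?thesis
    using B by (auto simp: orthonormal_basis_iff)
qed

lemma cinner_orthonormal_remainder:
  assumes F: "finite F" "orthonormal F" and b: "b \<in> F"
  shows "cinner b (x - (\<Sum>c\<in>F. cinner c x *\<^sub>C c)) = 0"
proof -
  have "cinner b (\<Sum>c\<in>F. cinner c x *\<^sub>C c) = (\<Sum>c\<in>F. if c = b then cinner b x else 0)"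
    unfolding cinner_sum_right
    by (rule sum.cong) (auto simp: cinner_scaleC_right cinner_orthonormal [OF F(2)] b)
  then show ?thesis
    using F(1) b by (simp add: cinner_diff_right)
qed

text \<open>The remainder is orthogonal to each \<open>b\<close> in \<open>F\<close>, hence to the
  partial sum, so its squared norm is its inner product with \<open>x\<close>.\<close>

lemma bessel_identity:
  assumes "finite F" "orthonormal F"
  shows "(norm (x - (\<Sum>b\<in>F. cinner b x *\<^sub>C b)))\<^sup>2 = (norm x)\<^sup>2 - (\<Sum>b\<in>F. (cmod (cinner b x))\<^sup>2)"
proof -
  let ?y = "\<Sum>b\<in>F. cinner b x *\<^sub>C b"
  have "cinner (x - ?y) (x - ?y) = cinner x (x - ?y)"
    by (simp add: cinner_diff_left [of x] cinner_sum_left cinner_scaleC_left cinner_orthonormal_remainder assms)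
  also have "\<dots> = cinner x x - (\<Sum>b\<in>F. cinner b x * cnj (cinner b x))"
    by (simp add: cinner_diff_right cinner_sum_right cinner_scaleC_right flip: cinner_commute)
  also have "\<dots> = complex_of_real ((norm x)\<^sup>2 - (\<Sum>b\<in>F. (cmod (cinner b x))\<^sup>2))"
    by (simp only: cinner_self_norm complex_norm_square [symmetric] of_real_diff of_real_sum)
  finally show ?thesis
    unfolding cinner_self_norm of_real_eq_iff .
qed

lemma bessel: "finite F \<Longrightarrow> orthonormal F \<Longrightarrow> (\<Sum>b\<in>F. (cmod (cinner b x))\<^sup>2) \<le> (norm x)\<^sup>2"
  using bessel_identity [of F x] zero_le_power2 [of "norm (x - (\<Sum>b\<in>F. cinner b x *\<^sub>C b))"] by linarith

lemma parseval:
  assumes F: "finite F" "orthonormal F" and x: "x \<in> closed_cspan F"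
  shows "(\<Sum>b\<in>F. (cmod (cinner b x))\<^sup>2) = (norm x)\<^sup>2"
proof -
  let ?y = "\<Sum>b\<in>F. cinner b x *\<^sub>C b"
  have m: "x - ?y \<in> closed_cspan F"
    by (intro csubspace_diff [OF closed_csubspace_cspan] x csubspace_sum [OF closed_csubspace_cspan]
        csubspace_scaleC [OF closed_csubspace_cspan] cspan_inc)
  have "cinner (x - ?y) (x - ?y) = 0"
    by (rule cinner_cspan_eq_0 [OF cinner_orthonormal_remainder [OF F] m])
  then have "x - ?y = 0"
    by (simp only: cinner_self_eq_0)
  then show ?thesis
    using bessel_identity [OF F, of x] by simp
qed

lemma orthonormal_basisD:
  assumes "orthonormal_basis X B"
  shows "B \<subseteq> X" "orthonormal B" "closed_cspan B = X"
  using assms by (simp_all add: orthonormal_basis_iff)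

text \<open>If \<open>B'\<close> is finite, the squares of |<c, b>| are summed in both orders, with
  Parseval in one and Bessel in the other. If \<open>B'\<close> is infinite, each of its members
  meets only countably many members of \<open>B\<close>, and every member of \<open>B\<close> is
  met.\<close>

lemma orthonormal_basis_card_le:
  assumes B: "orthonormal_basis X B" and B': "orthonormal_basis X B'"
  shows "|B| \<le>o |B'|"
proof (cases "finite B'")
  case True
  \<comment> \<open>The count is made for finite parts \<open>F\<close> of \<open>B\<close>, since
    finiteness of \<open>B\<close> is itself a consequence.\<close>
  have le: "card F \<le> card B'" if F: "finite F" "F \<subseteq> B" for F
  proof -
    have on: "orthonormal F"
      by (rule orthonormal_subset [OF orthonormal_basisD(2) [OF B] F(2)])
    have "real (card F) = (\<Sum>b\<in>F. (norm b)\<^sup>2)"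
    proof -
      have "(norm b)\<^sup>2 = 1" if "b \<in> F" for b
        using on that unfolding orthonormal_def by simp
      then show ?thesis
        by simp
    qed
    also have "\<dots> = (\<Sum>b\<in>F. \<Sum>c\<in>B'. (cmod (cinner c b))\<^sup>2)"
    proof (rule sum.cong [OF refl])
      fix b assume "b \<in> F"
      then have "b \<in> closed_cspan B'"
        unfolding orthonormal_basisD(3) [OF B'] using orthonormal_basisD(1) [OF B] F(2) by (meson subsetD)
      then show "(norm b)\<^sup>2 = (\<Sum>c\<in>B'. (cmod (cinner c b))\<^sup>2)"
        by (rule parseval [OF True orthonormal_basisD(2) [OF B'], symmetric])
    qed
    also have "\<dots> = (\<Sum>c\<in>B'. \<Sum>b\<in>F. (cmod (cinner c b))\<^sup>2)"
      by (rule sum.swap)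
    also have "\<dots> \<le> (\<Sum>c\<in>B'. 1)"
    proof (rule sum_mono)
      fix c assume c: "c \<in> B'"
      have "(\<Sum>b\<in>F. (cmod (cinner c b))\<^sup>2) = (\<Sum>b\<in>F. (cmod (cinner b c))\<^sup>2)"
        by (intro sum.cong refl) (metis cinner_commute complex_mod_cnj)
      also have "\<dots> \<le> (norm c)\<^sup>2"
        by (rule bessel [OF F(1) on])
      also have "\<dots> = 1"
        using c orthonormal_basisD(2) [OF B'] by (simp add: orthonormal_def)
      finally show "(\<Sum>b\<in>F. (cmod (cinner c b))\<^sup>2) \<le> 1" .
    qed
    finally show ?thesis
      by simp
  qed
  have "finite B"
  proof (rule ccontr)
    assume "infinite B"
    then obtain F where "F \<subseteq> B" "finite F" "card F = Suc (card B')"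
      using infinite_arbitrarily_large by metis
    then show False
      using le [of F] by simp
  qed
  then have "\<exists>f. inj_on f B \<and> f ` B \<subseteq> B'"
    using le [of B] by (simp add: inj_on_iff_card_le True)
  then show ?thesis
    by (simp add: card_of_ordLeq)
next
  case False
  \<comment> \<open>The support of a family that is summable by Bessel's inequality, hence a
    countable set.\<close>
  define S where "S c = {b \<in> B. (cmod (cinner b c))\<^sup>2 \<noteq> 0}" for c
  have "|S c| \<le>o |B'|" for c
  proof -
    have "(\<lambda>b. (cmod (cinner b c))\<^sup>2) summable_on B"
    proof (rule nonneg_bdd_above_summable_on)
      have "(\<Sum>b\<in>F. (cmod (cinner b c))\<^sup>2) \<le> (norm c)\<^sup>2" if "F \<subseteq> B" "finite F" for F
        by (rule bessel [OF that(2) orthonormal_subset [OF orthonormal_basisD(2) [OF B] that(1)]])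
      then show "bdd_above (sum (\<lambda>b. (cmod (cinner b c))\<^sup>2) ` {F. F \<subseteq> B \<and> finite F})"
        by (intro bdd_aboveI2 [where M = "(norm c)\<^sup>2"]) simp
    qed simp
    then have "countable (S c)"
      unfolding S_def by (rule summable_countable_real)
    then have "|S c| \<le>o |UNIV :: nat set|"
      by (auto simp: countable_def simp flip: card_of_ordLeq)
    then show ?thesis
      by (rule ordLeq_transitive) (use False in \<open>simp add: infinite_iff_card_of_nat\<close>)
  qed
  then have "|\<Union>c\<in>B'. S c| \<le>o |B'|"
    by (rule card_of_UNION_ordLeq_infinite [OF False card_of_mono1 [OF subset_refl] ballI])
  moreover have "B \<subseteq> (\<Union>c\<in>B'. S c)"
  proof
    fix b assume b: "b \<in> B"
    show "b \<in> (\<Union>c\<in>B'. S c)"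
    proof (rule ccontr)
      assume "b \<notin> (\<Union>c\<in>B'. S c)"
      then have "cinner c b = 0" if "c \<in> B'" for c
        using b that by (auto simp: S_def cinner_eq_0_commute [of c])
      moreover have "b \<in> closed_cspan B'"
        unfolding orthonormal_basisD(3) [OF B'] by (rule subsetD [OF orthonormal_basisD(1) [OF B] b])
      ultimately have "cinner b b = 0"
        by (rule cinner_cspan_eq_0)
      then show False
        using b orthonormal_basisD(2) [OF B] by (auto simp: orthonormal_def)
    qed
  qed
  ultimately show ?thesis
    by (meson card_of_mono1 ordLeq_transitive)
qed

text \<open>The image of the basis chosen for \<open>X\<close> is a basis of \<open>Y\<close>,
  though perhaps not the chosen one; \<open>orthonormal_basis_card_le\<close>, applied in both
  directions, bridges the gap.\<close>

lemma hilbert_dim_unitary: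
  assumes X: "closed_csubspace X" and v: "unitary_op X Y v"
  shows "hilbert_dim X =o hilbert_dim Y"
proof -
  note v = unitary_opD [OF v]
  have Y: "closed_csubspace Y"
    using closed_csubspace_isom_image [OF X v(1)] v(2) by simp
  define B where "B = (SOME B. orthonormal_basis X B)"
  define B' where "B' = (SOME B. orthonormal_basis Y B)"
  have B: "orthonormal_basis X B" and B': "orthonormal_basis Y B'"
    unfolding B_def B'_def
    by (rule someI_ex [OF orthonormal_basis_exists [OF X]] someI_ex [OF orthonormal_basis_exists [OF Y]])+
  have sub: "B \<subseteq> X" and on: "orthonormal B" and span: "closed_cspan B = X"
    using B by (auto simp: orthonormal_basis_iff)
  have "inj_on v B"
    using sub isom_eq_iff [OF X v(1)] by (auto simp: inj_on_def)
  then have "|B| =o |v ` B|"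
    by (intro card_of_ordIsoI [of v]) (simp add: bij_betw_def)
  have "orthonormal_basis Y (v ` B)"
    unfolding orthonormal_basis_iff
  proof (intro conjI)
    show "v ` B \<subseteq> Y"
      using sub v(4) by auto
    show "orthonormal (v ` B)"
      using on sub by (auto simp: orthonormal_def isom_norm [OF v(1)] isomD [OF v(1)] subset_iff)
    show "closed_cspan (v ` B) = Y"
    proof (rule cspan_eqI [OF Y \<open>v ` B \<subseteq> Y\<close>])
      fix y assume y: "y \<in> Y" and 0: "\<And>s. s \<in> v ` B \<Longrightarrow> cinner s y = 0"
      obtain x where x: "x \<in> X" "y = v x"
        using y v(2) by auto
      have bx: "cinner b x = 0" if "b \<in> B" for b
        using 0 [OF imageI [OF that]] isomD [OF v(1) subsetD [OF sub that] x(1)] by (simp add: x(2))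
      have "cinner x x = 0"
      proof (rule cinner_cspan_eq_0 [OF bx])
        show "x \<in> closed_cspan B"
          unfolding span by (rule x(1))
      qed
      then have "cinner y y = 0"
        using isomD [OF v(1) x(1) x(1)] by (simp only: x(2))
      then show "y = 0"
        by simp
    qed
  qed
  then have "|v ` B| =o |B'|"
    using orthonormal_basis_card_le B' by (auto simp: ordIso_iff_ordLeq)
  then show ?thesis
    using ordIso_transitive [OF \<open>|B| =o |v ` B|\<close>] by (simp add: hilbert_dim_def B_def B'_def)
qed

section \<open>The correspondence\<close>

lemma unitary_op_ident: "closed_csubspace X \<Longrightarrow> unitary_op X X (\<lambda>x. x)"
  by (rule unitary_opI) (simp_all add: isom_def)

lemma symbol_equiv_refl: "closed_csubspace D \<Longrightarrow> symbol_equiv D \<Theta> D \<Theta>"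
  unfolding symbol_equiv_def by (intro exI [of _ "\<lambda>x. x"]) (simp add: unitary_op_ident)

lemma lifting_equiv_refl: "closed_csubspace HC \<Longrightarrow> closed_csubspace HA \<Longrightarrow> lifting_equiv HC HA E HA E"
  unfolding lifting_equiv_def by (intro exI [of _ "\<lambda>x. x"]) (simp add: unitary_op_ident closed_csubspace_Times)

theorem theorem3p2:
  fixes HC :: "'c::complex_hilbert set" and C :: "'d::finite \<Rightarrow> 'c \<Rightarrow> 'c"
  assumes "closed_csubspace HC" and "row_contraction HC C"
  shows
    \<comment> \<open>\<open>\<M>\<close> maps minimal contractive liftings to operators with injective symbol\<close>
    "(\<forall>(HA :: 'a::complex_hilbert set) E.
        minimal_contractive_lifting HC C HA E \<longrightarrow>
        injective_contractive_symbol (defect_space (HC \<times> HA) E) (defect_space HC C)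
          (calM HC C HA E)) \<and>
    \<comment> \<open>\<open>\<E>\<close> maps operators with injective symbol to minimal contractive liftings\<close>
     (\<forall>(D :: 'x::complex_hilbert set) M.
        injective_contractive_symbol D (defect_space HC C) M \<longrightarrow>
        minimal_contractive_lifting HC C (calE_space HC C D M) (calE HC C D M)) \<and>
    \<comment> \<open>\<open>\<M>\<close> is well defined on equivalence classes\<close>
     (\<forall>(HA :: 'a set) E (HA' :: 'b::complex_hilbert set) E'.
        minimal_contractive_lifting HC C HA E \<longrightarrow>
        minimal_contractive_lifting HC C HA' E' \<longrightarrow>
        lifting_equiv HC HA E HA' E' \<longrightarrow>
        symbol_equiv (defect_space (HC \<times> HA) E) (symbol (calM HC C HA E))
          (defect_space (HC \<times> HA') E') (symbol (calM HC C HA' E'))) \<and>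
    \<comment> \<open>\<open>\<E>\<close> is well defined on equivalence classes\<close>
     (\<forall>(D :: 'x set) M (D' :: 'y::complex_hilbert set) M'.
        injective_contractive_symbol D (defect_space HC C) M \<longrightarrow>
        injective_contractive_symbol D' (defect_space HC C) M' \<longrightarrow>
        symbol_equiv D (symbol M) D' (symbol M') \<longrightarrow>
        lifting_equiv HC (calE_space HC C D M) (calE HC C D M)
          (calE_space HC C D' M') (calE HC C D' M')) \<and>
    \<comment> \<open>the induced maps are inverse to each other\<close>
     (\<forall>(HA :: 'a set) E.
        minimal_contractive_lifting HC C HA E \<longrightarrow>
        lifting_equiv HC
          (calE_space HC C (defect_space (HC \<times> HA) E) (calM HC C HA E))
          (calE HC C (defect_space (HC \<times> HA) E) (calM HC C HA E))
          HA E) \<and>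
     (\<forall>(D :: 'x set) M.
        injective_contractive_symbol D (defect_space HC C) M \<longrightarrow>
        symbol_equiv
          (defect_space (HC \<times> calE_space HC C D M) (calE HC C D M))
          (symbol (calM HC C (calE_space HC C D M) (calE HC C D M)))
          D (symbol M)) \<and>
    \<comment> \<open>\<open>dim D\<close> is the defect of every lifting in the corresponding class\<close>
     (\<forall>(D :: 'x set) M (HA :: 'a set) E.
        injective_contractive_symbol D (defect_space HC C) M \<longrightarrow>
        minimal_contractive_lifting HC C HA E \<longrightarrow>
        lifting_equiv HC HA E (calE_space HC C D M) (calE HC C D M) \<longrightarrow>
        hilbert_dim D =o defect (HC \<times> HA) E)"
proof (intro conjI allI impI)
  note HC = assms(1) and C = assms(2)
  note lift = coupling_lifting [OF HC C] and lift_comp = lifting_compresses [OF HC C]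
    and lift_inj = lifting_symbol_inj [OF HC C] and lift_HA = lifting_HA [OF HC C]
  note model = coupling_model [OF HC C] and model_comp = model_compresses [OF HC C]
    and model_HA = closed_csubspace_calE_space [OF HC C]
    and model_lift = minimal_contractive_lifting_calE [OF HC C]
  \<comment> \<open>The two transfer principles between arbitrary couplings. Each of the last five
    claims is an instance, with couplings taken from liftings or from models.\<close>
  note S = coupling_pair.symbol_equiv_if_lifting_equiv [OF coupling_pair.intro]
    and U = coupling_pair.lifting_equiv_if_symbol_equiv [OF coupling_pair.intro]
  note injective = injective_contractive_symbol_def
  show "injective_contractive_symbol (defect_space (HC \<times> HA) E) (defect_space HC C) (calM HC C HA E)"
    if "minimal_contractive_lifting HC C HA E" for HA :: "'a set" and E
    unfolding injective
    by (intro conjI coupling.D [OF lift] coupling.contractive_multi_analytic [OF lift] lift_inj that)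
  show "minimal_contractive_lifting HC C (calE_space HC C D M) (calE HC C D M)"
    if "injective_contractive_symbol D (defect_space HC C) M" for D :: "'x set" and M
    using that unfolding injective by (intro model_lift) simp_all
  show "symbol_equiv (defect_space (HC \<times> HA) E) (symbol (calM HC C HA E))
      (defect_space (HC \<times> HA') E') (symbol (calM HC C HA' E'))"
    if E: "minimal_contractive_lifting HC C HA E" and E': "minimal_contractive_lifting HC C HA' E'"
      and eq: "lifting_equiv HC HA E HA' E'"
    for HA :: "'a set" and E and HA' :: "'b set" and E'
    by (rule S [OF lift [OF E] lift [OF E'] lift_inj [OF E] lift_inj [OF E'] lift_HA [OF E]
          lift_comp [OF E] lift_comp [OF E'] eq])
  show "lifting_equiv HC (calE_space HC C D M) (calE HC C D M) (calE_space HC C D' M') (calE HC C D' M')"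
    if M: "injective_contractive_symbol D (defect_space HC C) M"
      and M': "injective_contractive_symbol D' (defect_space HC C) M'"
      and eq: "symbol_equiv D (symbol M) D' (symbol M')"
    for D :: "'x set" and M and D' :: "'y set" and M'
  proof -
    note M = M [unfolded injective, THEN conjunct1] M [unfolded injective, THEN conjunct2, THEN conjunct1]
    note M' = M' [unfolded injective, THEN conjunct1] M' [unfolded injective, THEN conjunct2, THEN conjunct1]
    show ?thesis
      by (rule U [OF model [OF M] model [OF M'] model_HA [OF M'] model_comp [OF M] model_comp [OF M'] eq])
  qed
  show "lifting_equiv HC (calE_space HC C (defect_space (HC \<times> HA) E) (calM HC C HA E))
      (calE HC C (defect_space (HC \<times> HA) E) (calM HC C HA E)) HA E"
    if E: "minimal_contractive_lifting HC C HA E" for HA :: "'a set" and E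
  proof -
    note M = coupling.D [OF lift [OF E]] coupling.contractive_multi_analytic [OF lift [OF E]]
    \<comment> \<open>The dilation of \<open>E\<close> and the model of its \<open>calM\<close> are
      couplings of the very same operator, so the unitary on the coefficient space is the
      identity.\<close>
    show ?thesis
      by (rule U [OF model [OF M] lift [OF E] lift_HA [OF E] model_comp [OF M] lift_comp [OF E]
            symbol_equiv_refl [OF M(1)]])
  qed
  show "symbol_equiv (defect_space (HC \<times> calE_space HC C D M) (calE HC C D M))
      (symbol (calM HC C (calE_space HC C D M) (calE HC C D M))) D (symbol M)"
    if inj: "injective_contractive_symbol D (defect_space HC C) M" for D :: "'x set" and M
  proof -
    note M = inj [unfolded injective, THEN conjunct1] inj [unfolded injective, THEN conjunct2, THEN conjunct1]
    note E = model_lift [OF M]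
    \<comment> \<open>The model of \<open>M\<close> and the dilation of its \<open>calE\<close>
      compress to the very same lifting, so the identity is the required equivalence of
      liftings.\<close>
    show ?thesis
      by (rule S [OF lift [OF E] model [OF M] lift_inj [OF E]
            inj [unfolded injective, THEN conjunct2, THEN conjunct2] model_HA [OF M] lift_comp [OF E]
            model_comp [OF M] lifting_equiv_refl [OF HC model_HA [OF M]]])
  qed
  show "hilbert_dim D =o defect (HC \<times> HA) E"
    if inj: "injective_contractive_symbol D (defect_space HC C) M"
      and E: "minimal_contractive_lifting HC C HA E"
      and eq: "lifting_equiv HC HA E (calE_space HC C D M) (calE HC C D M)"
    for D :: "'x set" and M and HA :: "'a set" and E
  proof -
    note M = inj [unfolded injective, THEN conjunct1] inj [unfolded injective, THEN conjunct2, THEN conjunct1]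
    \<comment> \<open>The equivalence of symbols already contains a unitary from the defect space of
      \<open>E\<close> onto \<open>D\<close>.\<close>
    have "symbol_equiv (defect_space (HC \<times> HA) E) (symbol (calM HC C HA E)) D (symbol M)"
      by (rule S [OF lift [OF E] model [OF M] lift_inj [OF E]
            inj [unfolded injective, THEN conjunct2, THEN conjunct2] lift_HA [OF E] lift_comp [OF E]
            model_comp [OF M] eq])
    then obtain v where "unitary_op (defect_space (HC \<times> HA) E) D v"
      by (auto simp: symbol_equiv_def)
    then show ?thesis
      unfolding defect_def
      by (intro ordIso_symmetric [OF hilbert_dim_unitary [OF coupling.D [OF lift [OF E]]]])
  qed
qed

end
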